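(* For $j\in\{1,2\}$ there is a discrete set $\mathcal{Z}_1\subset(0,1)$ such that $\Psi_j$ is non-constant for every $p\in(0,1)\setminus\mathcal{Z}_1$. Moreover, for every integer $j\ge1$, $\Psi_j$ is non-constant for all $p<1$ in a neighbourhood of $1$ (i.e. there is $p_0=p_0(j)<1$ such that $\Psi_j$ is non-constant for every $p\in(p_0,1)$). In either case (for such $j$ and $p$), $p_k$ is not asymptotic, as $k\to\infty$, to any constant multiple of $k^{-1-\rho}$.
   Context: Notation: $0<p<1$, $q=1-p$, $\lambda=1+p$, $a=1+2p$, $\rho=\log(1+2p)/\log(1+p)$ (so $a=\lambda^\rho$, $1<\rho<2$). The sequence $\{p_k\}$: for an integer $j\ge1$, the functional equation $$(1+2p)\,g(x)=2p\,x^{j}+g\bigl(x-px+px^{2}\bigr),\qquad 0\le x\le1,$$ has a unique solution $g$ that is a probability generating function (a recalled fact); write $g(x)=\sum_{k\ge j}p_kx^k$. Here $p_k$ depends on $p$ and $j$. Equivalently, $p_k=\sum_{n\ge0}\frac{2p}{a}a^{-n}P(D^*_n=k)$ for $k\ge j$, with $(D^*_n)$ as follows. Branching process: $(D_n)_{n\ge0}$ is the Galton-Watson process with $D_0=1$ and offspring variable $\xi$ with $P(\xi=1)=q$, $P(\xi=2)=p$. $(D^*_n)$ is the same process started from $j$ ancestors. $W=\lim_{n}\lambda^{-n}D_n$ is the almost sure martingale limit ($E[W]=1$). $V_j=W_1+\cdots+W_j$ with $W_i$ independent copies of $W$, and $w_j$ is the continuous density of $V_j$. The function $\Psi_j$ (depending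 on $p$) is the continuous, strictly positive, $1$-periodic function $$\Psi_j(u)=\frac{2p}{a}\sum_{\ell\in\mathbb{Z}}\eta\bigl(\lambda^{u-\ell}\bigr),\qquad \eta(y)=y^{\rho+1}w_j(y),\quad y>0;$$ it satisfies $p_k=k^{-1-\rho}\Psi_j(\log_\lambda k)+o(k^{-1-\rho})$ as $k\to\infty$. *)

theory Defs
  imports "HOL-Probability.Probability" "HOL-Library.Landau_Symbols"
begin

definition rho :: "real \<Rightarrow> real" where
  "rho p = ln (1 + 2 * p) / ln (1 + p)"

definition pgf :: "nat pmf \<Rightarrow> real \<Rightarrow> real" where
  "pgf P x = (\<Sum>k. pmf P k * x ^ k)"

definition pk_pmf :: "real \<Rightarrow> nat \<Rightarrow> nat pmf" where
  "pk_pmf p j = (THE P. \<forall>x\<in>{0..1}.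
     (1 + 2 * p) * pgf P x = 2 * p * x ^ j + pgf P (x - p * x + p * x\<^sup>2))"

abbreviation pk :: "real \<Rightarrow> nat \<Rightarrow> nat \<Rightarrow> real" where
  "pk p j \<equiv> pmf (pk_pmf p j)"

definition offspring :: "real \<Rightarrow> nat pmf" where
  "offspring p = map_pmf (\<lambda>b. if b then 2 else 1) (bernoulli_pmf p)"

text \<open>The coordinate \<open>(i, n, m)\<close> is the number of children of individual \<open>m\<close> of generation
  \<open>n\<close> in the \<open>i\<close>-th of countably many independent copies of the process.\<close>

definition gw_space :: "real \<Rightarrow> (nat \<times> nat \<times> nat \<Rightarrow> nat) measure" where
  "gw_space p = Pi\<^sub>M UNIV (\<lambda>_. measure_pmf (offspring p))"

primrec D :: "nat \<Rightarrow> nat \<Rightarrow> (nat \<times> nat \<times> nat \<Rightarrow> nat) \<Rightarrow> nat" where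
  "D i 0 \<omega> = 1"
| "D i (Suc n) \<omega> = (\<Sum>m<D i n \<omega>. \<omega> (i, n, m))"

definition W :: "real \<Rightarrow> nat \<Rightarrow> (nat \<times> nat \<times> nat \<Rightarrow> nat) \<Rightarrow> real" where
  "W p i \<omega> = lim (\<lambda>n. real (D i n \<omega>) / (1 + p) ^ n)"

definition V :: "real \<Rightarrow> nat \<Rightarrow> (nat \<times> nat \<times> nat \<Rightarrow> nat) \<Rightarrow> real" where
  "V p j \<omega> = (\<Sum>i<j. W p i \<omega>)"

text \<open>A density continuous on the whole line exists since \<open>(1 - p) * (1 + p) < 1\<close>, which makes
  the characteristic function of \<open>W\<close> integrable. Nonnegativity is required because
  \<^term>\<open>ennreal\<close> sends negative numbers to \<open>0\<close>.\<close>

definition w :: "real \<Rightarrow> nat \<Rightarrow> real \<Rightarrow> real" where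
  "w p j = (THE f. continuous_on UNIV f \<and> (\<forall>y. 0 \<le> f y) \<and>
     distributed (gw_space p) lborel (V p j) (\<lambda>y. ennreal (f y)))"

definition eta :: "real \<Rightarrow> nat \<Rightarrow> real \<Rightarrow> real" where
  "eta p j y = y powr (rho p + 1) * w p j y"

definition Psi :: "real \<Rightarrow> nat \<Rightarrow> real \<Rightarrow> real" where
  "Psi p j u = 2 * p / (1 + 2 * p) *
     (\<Sum>\<^sub>\<infinity>l\<in>(UNIV :: int set). eta p j ((1 + p) powr (u - of_int l)))"

end

theory Submission
  imports Defs "HOL-Complex_Analysis.Complex_Analysis"
begin

text \<open>Let F(x) = (1-p)x + p x^2 be the offspring generating function, lam = 1+p = F'(1), a =
  1+2p, and let phi be the Laplace transform of W, so that phi(lam t) = F(phi(t)). Put r_j(t) =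
  phi(t)^j - 1 + j t and H(t) = sum over all integers n of a^(-n) r_j(lam^n t), which is
  \<open>periodic_part\<close>. The sum converges because r_j is O(t^2) at 0, has linear growth at
  infinity, and lam < a < lam^2. By a shift of index H(lam t) = a H(t). Everything rests on one
  fact, valid for all p in (0,1) and j >= 1: H is not a pure power C t^rho
  (\<open>periodic_part_not_power\<close>).

  Both claims contradict that fact. First, H(t) is the integral over z > 0 of (e^(-tz) - 1 + tz)
  z^(-1-rho) times the sum of eta(z lam^(-l)) over l (\<open>periodic_part_integral\<close>). That
  inner sum is Psi_j(log_lam z) up to a constant factor, so for constant Psi_j the substitution z ->
  z/t gives H(t) = H(1) t^rho (\<open>Psi_not_constant\<close>). Second, if p_k is asymptotic to c
  k^(-1-rho), an Abelian argument (\<open>abelian_limit\<close>) shows that the generating function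
  of p_k at e^(-s), minus its linear part, is J s^rho up to a smaller error. At e^(-s) = phi(t) the
  same quantity is (2p/a) H(t) plus a linear term plus O(t^2). Comparing along t0/lam^n makes H a
  pure power (\<open>pk_not_regular\<close>).

  Why H is no pure power (\<open>periodic_part_not_pure_power\<close>): the series gsum_j(z) = sum
  of F^n(z)^j / a^n is holomorphic on the basin of attraction of 0, and gsum_j(phi(t)) = H(t) +
  B(phi(t)) with B holomorphic on the plane slit along the nonpositive reals
  (\<open>gsum_phi\<close>). Here B is built from the Koenigs function kappa(z) = lim lam^n (1 -
  G^n(z)), where G is the inverse branch of F fixing 1; it satisfies kappa(phi(t)) = t. If H = C
  t^rho, then gsum_j = C kappa^rho + B at all phi(t), and by analytic continuation also inside the
  upper half of the basin, where Im kappa < 0 keeps kappa^rho analytic. Now go up the vertical line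
  over the critical point of F to the point y0 with F(y0) = -1/p and F(F(y0)) = 1. The right-hand
  side is holomorphic at y0. But gsum_j(z) = z^j + F(z)^j/a + gsum_j(F(F(z)))/a^2, and below y0 on
  this line F(F(z)) = phi(t) with t comparable to |z - y0|, so C t^rho / a^2 would agree there with
  a function holomorphic at y0. Since 1 < rho < 2, such a fractional order of vanishing is
  impossible unless C = 0 (\<open>holomorphic_no_fractional_order\<close>). Finally C = 0 is
  excluded because all terms of H are nonnegative and r_j(2) > 0.

  The rest supplies the probabilistic input: convergence of the martingale, the functional equation
  and second order expansion of phi, existence and uniqueness of the continuous density w_j by
  Fourier inversion, and the identification of p_k as a geometric mixture of the laws of the
  process.\<close>

definition F :: "real \<Rightarrow> 'a :: real_normed_field \<Rightarrow> 'a" where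
  "F p z = of_real (1 - p) * z + of_real p * z\<^sup>2"

section \<open>The inverse branch of F on the slit plane\<close>

locale splitting =
  fixes p :: real
  assumes p_pos: "0 < p" and p_less_1: "p < 1"
begin

abbreviation slit :: "complex set" where
  "slit \<equiv> - \<real>\<^sub>\<le>\<^sub>0"

text \<open>The root of the quadratic F(w) = z lying to the right of the critical point -(1-p)/(2p);
  the principal square root makes this choice.\<close>

definition G :: "complex \<Rightarrow> complex" where
  "G z = (of_real (p - 1) + csqrt (of_real ((1 - p)\<^sup>2) + of_real (4 * p) * z)) / of_real (2 * p)"

lemma two_p_G: "of_real (1 - p) + of_real (2 * p) * G z =
    csqrt (of_real ((1 - p)\<^sup>2) + of_real (4 * p) * z)"
  using p_pos by (simp add: G_def field_simps)

lemma F_G [simp]: "F p (G z) = z"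
proof -
  define s where "s = csqrt (of_real ((1 - p)\<^sup>2) + of_real (4 * p) * z)"
  have G: "G z = (of_real (p - 1) + s) / of_real (2 * p)"
    by (simp add: G_def s_def)
  have s2: "s\<^sup>2 = of_real ((1 - p)\<^sup>2) + of_real (4 * p) * z"
    by (simp add: s_def)
  have "of_real (4 * p) * F p (G z) = s\<^sup>2 - of_real ((1 - p)\<^sup>2)"
    using p_pos unfolding F_def G
    by (simp add: field_simps power2_eq_square)
  then show ?thesis
    using s2 p_pos by simp
qed

lemma Re_G_ge: "0 \<le> 1 - p + 2 * p * Re (G z)"
proof -
  have "Re (of_real (1 - p) + of_real (2 * p) * G z) \<ge> 0"
    unfolding two_p_G using csqrt_principal[of "of_real ((1 - p)\<^sup>2) + of_real (4 * p) * z"] by auto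
  then show ?thesis by simp
qed

lemma Im_F: "Im (F p z) = Im z * (1 - p + 2 * p * Re z)"
  by (simp add: F_def power2_eq_square algebra_simps)

lemma F_of_real: "F p (of_real x) = of_real (F p x)"
  by (simp add: F_def)

lemma G_F: assumes "0 < 1 - p + 2 * p * Re z" shows "G (F p z) = z"
proof -
  have "(of_real (1 - p) + of_real (2 * p) * z)\<^sup>2 = of_real ((1 - p)\<^sup>2) + of_real (4 * p) * F p z"
    by (simp add: F_def power2_eq_square algebra_simps)
  moreover have "csqrt ((of_real (1 - p) + of_real (2 * p) * z)\<^sup>2) = of_real (1 - p) + of_real (2 * p) * z"
    using assms by (intro csqrt_square) auto
  ultimately have "of_real (1 - p) + of_real (2 * p) * G (F p z) = of_real (1 - p) + of_real (2 * p) * z"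
    unfolding two_p_G by simp
  then show ?thesis using p_pos by simp
qed

text \<open>A value y <= 0 of G lies right of the critical point, where 1 - p + p y >= 0, so F(y) =
  y (1 - p + p y) <= 0 would put z on the slit.\<close>

lemma G_slit: assumes "z \<in> slit" shows "G z \<in> slit"
proof
  assume "G z \<in> \<real>\<^sub>\<le>\<^sub>0"
  then obtain y where y: "G z = of_real y" "y \<le> 0"
    by (auto elim!: nonpos_Reals_cases)
  have "0 \<le> 1 - p + 2 * p * y" using Re_G_ge[of z] y by simp
  with p_less_1 have "0 \<le> 1 - p + p * y" by linarith
  have "z = F p (of_real y)" using F_G[of z] y by simp
  also have "\<dots> = of_real (y * (1 - p + p * y))"
    unfolding F_of_real by (simp add: F_def power2_eq_square algebra_simps)
  finally have "z \<in> \<real>\<^sub>\<le>\<^sub>0"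
    using y \<open>0 \<le> 1 - p + p * y\<close> by (simp add: mult_nonpos_nonneg del: of_real_mult)
  with assms show False by simp
qed

lemma G_pow_slit: "z \<in> slit \<Longrightarrow> (G ^^ n) z \<in> slit"
  by (induction n) (auto simp: G_slit simp del: Compl_iff)

lemma G_Im_pos: assumes "0 < Im z" shows "0 < Im (G z)"
proof -
  have "Im z = Im (G z) * (1 - p + 2 * p * Re (G z))"
    using Im_F[of "G z"] by simp
  with assms Re_G_ge[of z] show ?thesis
    by (metis linorder_not_le mult_nonpos_nonneg not_less)
qed

lemma G_pow_Im_pos: "0 < Im z \<Longrightarrow> 0 < Im ((G ^^ n) z)"
  by (induction n) (auto simp: G_Im_pos)

lemma holomorphic_G: "G holomorphic_on slit"
proof -
  have "of_real ((1 - p)\<^sup>2) + of_real (4 * p) * z \<in> slit" if "z \<in> slit" for z :: complex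
  proof
    assume "of_real ((1 - p)\<^sup>2) + of_real (4 * p) * z \<in> \<real>\<^sub>\<le>\<^sub>0"
    then have "(1 - p)\<^sup>2 + 4 * p * Re z \<le> 0" "4 * p * Im z = 0"
      by (auto simp: complex_nonpos_Reals_iff)
    then have "4 * p * Re z \<le> 0" "Im z = 0"
      using p_pos zero_le_power2[of "1 - p"] by (linarith, simp)
    then have "z \<in> \<real>\<^sub>\<le>\<^sub>0"
      using p_pos by (auto simp: complex_nonpos_Reals_iff mult_le_0_iff)
    with that show False by simp
  qed
  then show ?thesis
    unfolding G_def[abs_def] using p_pos by (intro holomorphic_intros) auto
qed

lemma holomorphic_G_pow: "(G ^^ n) holomorphic_on slit"
proof (induction n)
  case (Suc n)
  have "G \<circ> (G ^^ n) holomorphic_on slit"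
    using Suc holomorphic_G G_pow_slit by (intro holomorphic_on_compose_gen[where t = slit]) auto
  then show ?case by (simp add: o_def)
qed (auto simp: id_def)

lemma G_1 [simp]: "G 1 = 1"
  using G_F[of 1] p_pos by (simp add: F_def)

lemma G_pow_1 [simp]: "(G ^^ n) 1 = 1"
  by (induction n) auto

section \<open>Convergence of the iterates of G to 1, by the Schwarz lemma\<close>

definition disc :: "complex \<Rightarrow> complex" where
  "disc z = (csqrt z - 1) / (csqrt z + 1)"

text \<open>Inverse of \<open>disc\<close>. The square root followed by a Cayley map is a conformal
  bijection from the slit plane onto the unit disc, and it sends the fixed point 1 of G to
  0.\<close>

definition undisc :: "complex \<Rightarrow> complex" where
  "undisc \<zeta> = ((1 + \<zeta>) / (1 - \<zeta>))\<^sup>2"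

lemma Re_csqrt_slit:
  assumes "z \<in> slit" shows "0 < Re (csqrt z)"
proof (rule ccontr)
  assume "\<not> 0 < Re (csqrt z)"
  then have "Re (csqrt z) = 0"
    using csqrt_principal[of z] by auto
  then have "Im ((csqrt z)\<^sup>2) = 0" "Re ((csqrt z)\<^sup>2) \<le> 0"
    unfolding Im_power2 Re_power2 by auto
  then show False using assms by (simp add: complex_nonpos_Reals_iff)
qed

end

lemma geometric_increments_limit:
  fixes x :: "nat \<Rightarrow> 'a :: banach"
  assumes r: "0 \<le> r" "r < 1" and x: "\<And>n. norm (x (Suc n) - x n) \<le> B * r ^ n"
  shows "convergent x" and "norm (lim x - x n) \<le> B * r ^ n / (1 - r)"
proof -
  define d where "d k = x (Suc k) - x k" for k
  have sg: "summable (\<lambda>k. B * r ^ k)"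
    using r by (intro summable_mult summable_geometric) auto
  have sd: "summable d"
    using x unfolding d_def by (intro summable_comparison_test'[OF sg])
  have tele: "(\<Sum>k<n. d k) = x n - x 0" for n
    by (simp add: d_def sum_lessThan_telescope)
  have "(\<lambda>n. (\<Sum>k<n. d k) + x 0) \<longlonglongrightarrow> suminf d + x 0"
    using sd by (intro tendsto_intros summable_LIMSEQ)
  then have lim: "x \<longlonglongrightarrow> suminf d + x 0"
    by (simp add: tele)
  then show "convergent x" by (rule convergentI)
  have "lim x - x n = suminf d - (\<Sum>k<n. d k)"
    using limI[OF lim] by (simp add: tele)
  also have "\<dots> = (\<Sum>k. d (k + n))"
    using suminf_minus_initial_segment[OF sd, of n] by simp
  finally have "norm (lim x - x n) = norm (\<Sum>k. d (k + n))" by simp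
  also have "\<dots> \<le> (\<Sum>k. B * r ^ n * r ^ k)"
    using x[of "_ + n"] r
    by (intro norm_suminf_le summable_mult summable_geometric)
       (auto simp: d_def power_add mult_ac)
  also have "\<dots> = B * r ^ n / (1 - r)"
    using r by (subst suminf_mult) (auto intro!: summable_geometric simp: suminf_geometric)
  finally show "norm (lim x - x n) \<le> B * r ^ n / (1 - r)" .
qed

context splitting
begin

lemma norm_disc_less_1: assumes "z \<in> slit" shows "norm (disc z) < 1"
proof -
  define s where "s = csqrt z"
  have "0 < Re s" using Re_csqrt_slit[OF assms] by (simp add: s_def)
  then have "(norm (s - 1))\<^sup>2 < (norm (s + 1))\<^sup>2"
    unfolding cmod_power2 by (simp add: power2_eq_square algebra_simps)
  then have "norm (s - 1) < norm (s + 1)"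
    by (rule power2_less_imp_less) simp
  then show ?thesis
    by (simp add: disc_def s_def[symmetric] norm_divide divide_less_eq)
qed

lemma Re_cayley_pos: assumes "norm \<zeta> < 1" shows "0 < Re ((1 + \<zeta>) / (1 - \<zeta>))"
proof -
  have ne: "1 - \<zeta> \<noteq> 0" using assms by auto
  have "(norm \<zeta>)\<^sup>2 < 1" using assms by (simp add: power_less_one_iff abs_square_less_1)
  then have "(1 + Re \<zeta>) * (1 - Re \<zeta>) - Im \<zeta> * Im \<zeta> > 0"
    unfolding cmod_power2 by (simp add: power2_eq_square algebra_simps)
  moreover have "0 < (norm (1 - \<zeta>))\<^sup>2" using ne by simp
  ultimately show ?thesis
    unfolding cmod_power2 by (simp add: Re_divide)
qed

lemma csqrt_undisc: assumes "norm \<zeta> < 1" shows "csqrt (undisc \<zeta>) = (1 + \<zeta>) / (1 - \<zeta>)"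
  unfolding undisc_def using Re_cayley_pos[OF assms] by (intro csqrt_square) auto

lemma undisc_slit: assumes "norm \<zeta> < 1" shows "undisc \<zeta> \<in> slit"
proof
  assume "undisc \<zeta> \<in> \<real>\<^sub>\<le>\<^sub>0"
  then obtain x where x: "undisc \<zeta> = of_real x" "x \<le> 0"
    by (auto elim!: nonpos_Reals_cases)
  then have "Re (csqrt (undisc \<zeta>)) = 0" by (simp add: Re_csqrt)
  with Re_cayley_pos[OF assms] csqrt_undisc[OF assms] show False by simp
qed

lemma disc_undisc: assumes "norm \<zeta> < 1" shows "disc (undisc \<zeta>) = \<zeta>"
proof -
  have "1 - \<zeta> \<noteq> 0" using assms by auto
  then show ?thesis
    by (simp add: disc_def csqrt_undisc[OF assms] field_simps)
qed

lemma undisc_disc: assumes "z \<in> slit" shows "undisc (disc z) = z"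
proof -
  have "csqrt z + 1 \<noteq> 0" using Re_csqrt_slit[OF assms]
    by (metis Re_complex_of_real add_eq_0_iff less_asym' minus_add_cancel neg_less_0_iff_less of_real_1 one_complex.sel(1) uminus_complex.sel(1) zero_less_one)
  moreover from this have "1 - disc z = 2 / (csqrt z + 1)" "1 + disc z = 2 * csqrt z / (csqrt z + 1)"
    by (simp_all add: disc_def field_simps)
  ultimately show ?thesis by (simp add: undisc_def)
qed

lemma continuous_on_disc: "continuous_on slit disc"
proof -
  have "csqrt z + 1 \<noteq> 0" if "z \<in> slit" for z
    using Re_csqrt_slit[OF that]
    by (metis Re_complex_of_real add_eq_0_iff less_asym' minus_add_cancel neg_less_0_iff_less of_real_1 one_complex.sel(1) uminus_complex.sel(1) zero_less_one)
  then show ?thesis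
    unfolding disc_def[abs_def] by (intro continuous_intros) auto
qed

text \<open>In the disc coordinate G is a holomorphic self-map of the unit disc fixing 0. It is not
  a rotation, because G misses everything left of the critical line; so the Schwarz inequality is
  strict, and compactness makes it uniform on a smaller disc.\<close>

lemma G_disc_contraction:
  assumes "r < 1"
  obtains m where "0 \<le> m" "m < 1"
    "\<And>\<zeta>. norm \<zeta> \<le> r \<Longrightarrow> norm (disc (G (undisc \<zeta>))) \<le> m * norm \<zeta>"
proof -
  define f where "f \<zeta> = disc (G (undisc \<zeta>))" for \<zeta>
  have lt: "norm (f \<zeta>) < 1" if "norm \<zeta> < 1" for \<zeta>
    unfolding f_def by (intro norm_disc_less_1 G_slit undisc_slit that)
  have f0: "f 0 = 0"
    by (simp add: f_def undisc_def disc_def)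
  have "undisc holomorphic_on ball 0 1"
    unfolding undisc_def[abs_def] by (intro holomorphic_intros) auto
  moreover have "disc holomorphic_on slit"
  proof -
    have "csqrt z + 1 \<noteq> 0" if "z \<in> slit" for z
      using Re_csqrt_slit[OF that]
      by (metis Re_complex_of_real add_eq_0_iff less_asym' minus_add_cancel neg_less_0_iff_less of_real_1 one_complex.sel(1) uminus_complex.sel(1) zero_less_one)
    then show ?thesis
      unfolding disc_def[abs_def] by (intro holomorphic_intros) auto
  qed
  ultimately have "disc \<circ> (G \<circ> undisc) holomorphic_on ball 0 1"
    using holomorphic_G undisc_slit G_slit
    by (intro holomorphic_on_compose_gen[where t = slit]) auto
  then have hol: "f holomorphic_on ball 0 1"
    by (simp add: f_def[abs_def] o_def)
  have not_rot: "\<not> (\<exists>\<alpha>. (\<forall>z. norm z < 1 \<longrightarrow> f z = \<alpha> * z) \<and> norm \<alpha> = 1)"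
  proof
    assume "\<exists>\<alpha>. (\<forall>z. norm z < 1 \<longrightarrow> f z = \<alpha> * z) \<and> norm \<alpha> = 1"
    then obtain \<alpha> where \<alpha>: "\<And>z. norm z < 1 \<Longrightarrow> f z = \<alpha> * z" "norm \<alpha> = 1" by blast
    \<comment> \<open>A point of the slit plane to the left of the critical line; a rotation would
      be onto, so G would have to attain it.\<close>
    define z0 where "z0 = Complex (- 1 / p) 1"
    have z0: "z0 \<in> slit" by (simp add: z0_def complex_nonpos_Reals_iff)
    define \<zeta> where "\<zeta> = disc z0 / \<alpha>"
    have \<zeta>: "norm \<zeta> < 1"
      using norm_disc_less_1[OF z0] \<alpha>(2) by (simp add: \<zeta>_def norm_divide)
    have "\<alpha> * \<zeta> = disc z0" using \<alpha>(2) by (auto simp: \<zeta>_def)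
    then have "disc (G (undisc \<zeta>)) = disc z0" using \<alpha>(1)[OF \<zeta>] by (simp add: f_def)
    then have "G (undisc \<zeta>) = z0"
      using undisc_disc z0 G_slit[OF undisc_slit[OF \<zeta>]] by metis
    then have "0 \<le> 1 - p + 2 * p * (- 1 / p)"
      using Re_G_ge[of "undisc \<zeta>"] by (simp add: z0_def)
    then show False using p_pos by simp
  qed
  have strict: "norm (f \<zeta>) < norm \<zeta>" if "norm \<zeta> < 1" "\<zeta> \<noteq> 0" for \<zeta>
    using Schwarz_Lemma(1)[OF hol f0 lt that(1)] Schwarz_Lemma(3)[OF hol f0 lt that(1)] that not_rot
    by (metis order_le_less)
  have deriv: "norm (deriv f 0) < 1"
    using Schwarz_Lemma(2)[OF hol f0 lt, of 0] Schwarz_Lemma(3)[OF hol f0 lt, of 0] not_rot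
    by (metis norm_zero order_le_less zero_less_one)
  \<comment> \<open>The quotient f(\<zeta>)/\<zeta> with its removable singularity filled in. Its
    modulus is continuous and below 1, so its maximum over the closed disc of radius r serves as
    m.\<close>
  define u where "u \<zeta> = (if \<zeta> = 0 then deriv f 0 else f \<zeta> / \<zeta>)" for \<zeta>
  have "isCont u \<zeta>" if "norm \<zeta> < 1" for \<zeta>
  proof (cases "\<zeta> = 0")
    case True
    have "(f has_field_derivative deriv f 0) (at 0)"
      using hol by (intro holomorphic_derivI) auto
    then have "(\<lambda>h. (f (0 + h) - f 0) / h) \<midarrow>0\<rightarrow> deriv f 0"
      by (simp add: DERIV_def)
    then have "u \<midarrow>0\<rightarrow> deriv f 0"
      by (rule Lim_transform_eventually) (auto simp: u_def f0 eventually_at_filter)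
    then show ?thesis using True by (simp add: isCont_def u_def)
  next
    case False
    have "isCont f \<zeta>"
      using hol that
      by (metis centre_in_ball continuous_on_interior dist_0_norm holomorphic_on_imp_continuous_on interior_ball mem_ball)
    then have "isCont (\<lambda>\<zeta>. f \<zeta> / \<zeta>) \<zeta>" using False by (intro continuous_intros)
    moreover have "\<forall>\<^sub>F \<zeta> in nhds \<zeta>. f \<zeta> / \<zeta> = u \<zeta>"
      using t1_space_nhds[OF False] by (rule eventually_mono) (simp add: u_def)
    ultimately show ?thesis
      using isCont_cong[of "\<lambda>\<zeta>. f \<zeta> / \<zeta>" u \<zeta>] by simp
  qed
  then have "continuous_on (cball 0 r) u"
    using assms by (intro continuous_at_imp_continuous_on) auto
  then have cont: "continuous_on (cball 0 r) (\<lambda>\<zeta>. norm (u \<zeta>))"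
    by (intro continuous_intros)
  have u1: "norm (u \<zeta>) < 1" if "norm \<zeta> < 1" for \<zeta>
    using deriv strict[OF that] by (auto simp: u_def norm_divide divide_less_eq)
  show ?thesis
  proof (cases "r \<ge> 0")
    case True
    then obtain w0 where w0: "w0 \<in> cball 0 r" "\<And>\<zeta>. \<zeta> \<in> cball 0 r \<Longrightarrow> norm (u \<zeta>) \<le> norm (u w0)"
      using continuous_attains_sup[OF compact_cball _ cont] by (metis cball_eq_empty not_le)
    show ?thesis
    proof (rule that[of "norm (u w0)"])
      show "norm (u w0) < 1" using w0 assms by (intro u1) auto
      fix \<zeta> :: complex assume \<zeta>: "norm \<zeta> \<le> r"
      have "norm (f \<zeta>) = norm (u \<zeta>) * norm \<zeta>"
        by (simp add: u_def norm_divide f0)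
      also have "\<dots> \<le> norm (u w0) * norm \<zeta>"
        using w0(2)[of \<zeta>] \<zeta> by (intro mult_right_mono) auto
      finally show "norm (disc (G (undisc \<zeta>))) \<le> norm (u w0) * norm \<zeta>"
        by (simp add: f_def)
    qed auto
  next
    case False
    then have "\<not> norm \<zeta> \<le> r" for \<zeta> :: complex
      using norm_ge_zero[of \<zeta>] by linarith
    then show ?thesis
      by (intro that[of 0]) auto
  qed
qed

text \<open>Iterate the contraction in the disc coordinate and return to the plane by 1 -
  \<open>undisc\<close> \<zeta> = -4 \<zeta> / (1 - \<zeta>)^2. The rate m depends on K; it serves
  only to start the sharp estimate of \<open>G_pow_linear_bound\<close>.\<close>

lemma G_pow_geometric:
  assumes K: "compact K" "K \<subseteq> slit"
  obtains C m where "0 \<le> C" "0 \<le> m" "m < 1" "\<And>z n. z \<in> K \<Longrightarrow> norm (1 - (G ^^ n) z) \<le> C * m ^ n"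
proof -
  have "compact (disc ` K)"
    using K by (intro compact_continuous_image continuous_on_subset[OF continuous_on_disc])
  moreover have "disc ` K \<subseteq> ball 0 1"
    using norm_disc_less_1 K by auto
  ultimately obtain r where r: "r < 1" "disc ` K \<subseteq> cball 0 r"
  proof (cases "K = {}")
    case False
    have "continuous_on K (\<lambda>z. norm (disc z))"
      using K by (intro continuous_intros continuous_on_subset[OF continuous_on_disc])
    then obtain z0 where "z0 \<in> K" "\<And>z. z \<in> K \<Longrightarrow> norm (disc z) \<le> norm (disc z0)"
      using continuous_attains_sup[OF K(1) False] by blast
    then show ?thesis using K norm_disc_less_1[of z0] by (intro that[of "norm (disc z0)"]) auto
  qed (auto intro: that[of 0])
  obtain m where m: "0 \<le> m" "m < 1" "\<And>\<zeta>. norm \<zeta> \<le> r \<Longrightarrow> norm (disc (G (undisc \<zeta>))) \<le> m * norm \<zeta>"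
    using G_disc_contraction[OF r(1)] by blast
  have G: "norm (disc ((G ^^ n) z)) \<le> m ^ n * norm (disc z)" if z: "z \<in> K" for z n
  proof (induction n)
    case (Suc n)
    have "norm (disc ((G ^^ n) z)) \<le> 1 * norm (disc z)"
      using m by (intro order_trans[OF Suc] mult_right_mono power_le_one) auto
    also have "\<dots> \<le> r" using r z by auto
    finally have "norm (disc (G (undisc (disc ((G ^^ n) z))))) \<le> m * norm (disc ((G ^^ n) z))"
      by (rule m)
    also have "undisc (disc ((G ^^ n) z)) = (G ^^ n) z"
      using K z by (intro undisc_disc G_pow_slit) auto
    also have "m * norm (disc ((G ^^ n) z)) \<le> m * (m ^ n * norm (disc z))"
      using m Suc by (intro mult_left_mono)
    finally show ?case by simp
  qed simp
  show ?thesis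
  proof (rule that[of "4 / (1 - r)\<^sup>2" m])
    fix z n assume z: "z \<in> K"
    define \<zeta> where "\<zeta> = disc ((G ^^ n) z)"
    have d0: "norm (disc z) \<le> r" "norm (disc z) \<le> 1" using r z by auto
    have "norm \<zeta> \<le> 1 * norm (disc z)"
      unfolding \<zeta>_def using m by (intro order_trans[OF G[OF z]] mult_right_mono power_le_one) auto
    with d0 r have \<zeta>: "norm \<zeta> \<le> r" "norm \<zeta> < 1" by auto
    then have ne: "1 - \<zeta> \<noteq> 0" by auto
    have "(G ^^ n) z = undisc \<zeta>"
      unfolding \<zeta>_def using K z undisc_disc[OF G_pow_slit[of z n]] by auto
    then have "1 - (G ^^ n) z = ((1 - \<zeta>)\<^sup>2 - (1 + \<zeta>)\<^sup>2) / (1 - \<zeta>)\<^sup>2"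
      using ne by (simp add: undisc_def power_divide diff_divide_distrib)
    also have "(1 - \<zeta>)\<^sup>2 - (1 + \<zeta>)\<^sup>2 = - 4 * \<zeta>"
      by (simp add: power2_eq_square algebra_simps)
    finally have "1 - (G ^^ n) z = - 4 * \<zeta> / (1 - \<zeta>)\<^sup>2" .
    then have "norm (1 - (G ^^ n) z) = 4 * norm \<zeta> / (norm (1 - \<zeta>))\<^sup>2"
      by (simp add: norm_mult norm_divide norm_power)
    also have "\<dots> \<le> 4 * m ^ n / (1 - r)\<^sup>2"
    proof (intro frac_le mult_left_mono power_mono)
      show "1 - r \<le> norm (1 - \<zeta>)"
        using norm_triangle_ineq2[of 1 \<zeta>] \<zeta> by simp
      have "norm \<zeta> \<le> m ^ n * norm (disc z)" using G[OF z] by (simp add: \<zeta>_def)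
      also have "\<dots> \<le> m ^ n * 1" using d0 m by (intro mult_left_mono) auto
      finally show "norm \<zeta> \<le> m ^ n" by simp
    qed (use m r in auto)
    finally show "norm (1 - (G ^^ n) z) \<le> 4 / (1 - r)\<^sup>2 * m ^ n" by simp
  qed (use m in auto)
qed

end

text \<open>Second order Taylor bound for (1-d)^j at d = 0. The quadratic order matters because a <
  lam^2 lets it absorb weights a^n.\<close>

lemma mono_binomial_remainder:
  fixes D :: real
  assumes "0 \<le> D"
  obtains c where "0 \<le> c"
    "\<And>d :: 'a :: real_normed_field. norm d \<le> D \<Longrightarrow> norm ((1 - d) ^ j - 1 + of_nat j * d) \<le> c * (norm d)\<^sup>2"
proof -
  have "\<exists>c\<ge>0. \<forall>d :: 'a. norm d \<le> D \<longrightarrow> norm ((1 - d) ^ j - 1 + of_nat j * d) \<le> c * (norm d)\<^sup>2"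
  proof (induction j)
    case (Suc j)
    then obtain c where c: "0 \<le> c"
      "\<And>d :: 'a. norm d \<le> D \<Longrightarrow> norm ((1 - d) ^ j - 1 + of_nat j * d) \<le> c * (norm d)\<^sup>2" by blast
    show ?case
    proof (intro exI conjI allI impI)
      fix d :: 'a assume d: "norm d \<le> D"
      have "(1 - d) ^ Suc j - 1 + of_nat (Suc j) * d
          = (1 - d) * ((1 - d) ^ j - 1 + of_nat j * d) + of_nat j * d\<^sup>2"
        by (simp add: algebra_simps power2_eq_square)
      also have "norm \<dots> \<le> norm (1 - d) * norm ((1 - d) ^ j - 1 + of_nat j * d) + real j * (norm d)\<^sup>2"
        by (rule order_trans[OF norm_triangle_ineq]) (simp add: norm_mult norm_power)
      also have "norm (1 - d) \<le> 1 + D"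
        using norm_triangle_ineq4[of 1 d] d by simp
      then have "norm (1 - d) * norm ((1 - d) ^ j - 1 + of_nat j * d) \<le> (1 + D) * (c * (norm d)\<^sup>2)"
        using c d assms by (intro mult_mono) auto
      finally show "norm ((1 - d) ^ Suc j - 1 + of_nat (Suc j) * d) \<le> ((1 + D) * c + real j) * (norm d)\<^sup>2"
        by (simp add: algebra_simps)
    qed (use c assms in auto)
  qed auto
  then show ?thesis using that by blast
qed

section \<open>The Koenigs function of G at the fixed point 1\<close>

context splitting
begin

abbreviation "lam \<equiv> 1 + p"

text \<open>The linearizing coordinate of G at 1, where G has multiplier 1/lam.\<close>

definition koenigs :: "complex \<Rightarrow> complex" where
  "koenigs z = lim (\<lambda>n. of_real lam ^ n * (1 - (G ^^ n) z))"

lemma one_minus_F: "1 - F p z = (1 - z) * (1 + of_real p * z)"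
  by (simp add: F_def power2_eq_square algebra_simps)

lemma one_minus_G: "1 - z = (1 - G z) * (of_real lam - of_real p * (1 - G z))"
  using one_minus_F[of "G z"] by (simp add: algebra_simps)

text \<open>Upgrades the rate m^n to the true rate lam^(-n). With e_k = |1 - G^k z| one has lam
  e_(k+1) (1 - e_(k+1)) <= e_k, so each step loses against the factor 1/lam only by 1/(1 - e_(k+1)).
  The product of these losses is bounded because the e_k are summable by
  \<open>G_pow_geometric\<close>.\<close>

lemma G_pow_linear_bound:
  assumes K: "compact K" "K \<subseteq> slit"
  obtains C where "0 \<le> C" "\<And>z n. z \<in> K \<Longrightarrow> norm (1 - (G ^^ n) z) \<le> C / lam ^ n"
proof -
  obtain C m where C: "0 \<le> C" "0 \<le> m" "m < 1" "\<And>z n. z \<in> K \<Longrightarrow> norm (1 - (G ^^ n) z) \<le> C * m ^ n"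
    using G_pow_geometric[OF K] by blast
  have "(\<lambda>n. C * m ^ n) \<longlonglongrightarrow> C * 0"
    using C by (intro tendsto_intros LIMSEQ_realpow_zero) auto
  then have "eventually (\<lambda>n. C * m ^ n < 1 / 2) sequentially"
    by (intro order_tendstoD) auto
  then obtain N where N: "\<And>n. n \<ge> N \<Longrightarrow> C * m ^ n < 1 / 2"
    by (auto simp: eventually_sequentially)
  define M where "M = lam ^ N * C * exp (2 * (C / (1 - m)))"
  have M_ge: "lam ^ N * C \<le> M"
  proof -
    have "lam ^ N * C * 1 \<le> lam ^ N * C * exp (2 * (C / (1 - m)))"
      using C p_pos by (intro mult_left_mono) auto
    then show ?thesis by (simp add: M_def)
  qed
  have main: "lam ^ n * norm (1 - (G ^^ n) z) \<le> M" if z: "z \<in> K" for z n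
  proof -
    define e where "e k = norm (1 - (G ^^ k) z)" for k
    have e: "0 \<le> e k" "e k \<le> C * m ^ k" for k
      using C(4)[OF z] by (auto simp: e_def)
    have step: "lam * e (Suc k) \<le> e k * exp (2 * e (Suc k))" if "k \<ge> N" for k
    proof -
      have "e (Suc k) < 1 / 2" using e(2)[of "Suc k"] N[of "Suc k"] that by simp
      have "1 - (G ^^ k) z = (1 - (G ^^ Suc k) z) * (of_real lam - of_real p * (1 - (G ^^ Suc k) z))"
        using one_minus_G[of "(G ^^ k) z"] by simp
      then have "e k = e (Suc k) * norm (of_real lam - of_real p * (1 - (G ^^ Suc k) z))"
        by (simp only: e_def norm_mult)
      moreover have "lam - p * e (Suc k) \<le> norm (of_real lam - of_real p * (1 - (G ^^ Suc k) z))"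
        using norm_triangle_ineq2[of "of_real lam" "of_real p * (1 - (G ^^ Suc k) z)"] p_pos
        by (simp add: e_def norm_mult del: of_real_add)
      ultimately have "e (Suc k) * (lam - p * e (Suc k)) \<le> e k"
        using e by (simp add: mult_left_mono)
      moreover have "lam * (1 - e (Suc k)) \<le> lam - p * e (Suc k)"
        using e(1)[of "Suc k"] p_pos by (simp add: algebra_simps)
      ultimately have 1: "lam * (e (Suc k) * (1 - e (Suc k))) \<le> e k"
        using mult_left_mono[of "lam * (1 - e (Suc k))" "lam - p * e (Suc k)" "e (Suc k)"] e(1)[of "Suc k"]
        by (simp add: mult.left_commute)
      \<comment> \<open>For 0 <= e <= 1/2 one has 1/(1-e) <= 1 + 2e <= exp(2e); in exponential form
        the losses add up in the exponent.\<close>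
      have "0 \<le> e (Suc k) * (1 - 2 * e (Suc k))"
        using e(1)[of "Suc k"] \<open>e (Suc k) < 1 / 2\<close> by (intro mult_nonneg_nonneg) auto
      then have "1 \<le> (1 - e (Suc k)) * (1 + 2 * e (Suc k))"
        by (simp add: algebra_simps)
      also have "\<dots> \<le> (1 - e (Suc k)) * exp (2 * e (Suc k))"
        using \<open>e (Suc k) < 1 / 2\<close> by (intro mult_left_mono exp_ge_add_one_self) auto
      finally have 2: "1 \<le> (1 - e (Suc k)) * exp (2 * e (Suc k))" .
      have "lam * e (Suc k) * 1 \<le> lam * e (Suc k) * ((1 - e (Suc k)) * exp (2 * e (Suc k)))"
        using e p_pos 2 by (intro mult_left_mono) auto
      also have "\<dots> = lam * (e (Suc k) * (1 - e (Suc k))) * exp (2 * e (Suc k))"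
        by (simp only: mult_ac)
      also have "\<dots> \<le> e k * exp (2 * e (Suc k))"
        using 1 by (intro mult_right_mono) auto
      finally show ?thesis by simp
    qed
    have sums: "(\<Sum>i<k. C * m ^ i) \<le> C / (1 - m)" for k
    proof -
      have "(\<Sum>i<k. C * m ^ i) = C * (\<Sum>i<k. m ^ i)" by (simp add: sum_distrib_left)
      also have "\<dots> \<le> C * (\<Sum>i. m ^ i)"
        using C by (intro mult_left_mono sum_le_suminf summable_geometric) auto
      finally show ?thesis using C by (simp add: suminf_geometric)
    qed
    have "lam ^ (N + k) * e (N + k) \<le> lam ^ N * C * exp (2 * (\<Sum>i<k. C * m ^ i))" for k
    proof (induction k)
      case 0
      have "C * m ^ N \<le> C" using C by (intro mult_left_le power_le_one) auto
      then show ?case using e(2)[of N] p_pos by simp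
    next
      case (Suc k)
      have "e (Suc (N + k)) \<le> C * m ^ (Suc (N + k))" by (rule e)
      also have "\<dots> \<le> C * m ^ k" using C by (intro mult_left_mono power_decreasing) auto
      finally have ek: "e (Suc (N + k)) \<le> C * m ^ k" .
      have "lam ^ (N + Suc k) * e (N + Suc k) = lam ^ (N + k) * (lam * e (Suc (N + k)))"
        by (simp add: mult_ac)
      also have "\<dots> \<le> lam ^ (N + k) * (e (N + k) * exp (2 * e (Suc (N + k))))"
        using p_pos by (intro mult_left_mono step) auto
      also have "\<dots> \<le> lam ^ (N + k) * e (N + k) * exp (2 * (C * m ^ k))"
        using ek p_pos e by (subst mult.assoc[symmetric]) (intro mult_left_mono, auto)
      also have "\<dots> \<le> lam ^ N * C * exp (2 * (\<Sum>i<k. C * m ^ i)) * exp (2 * (C * m ^ k))"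
        using Suc by (intro mult_right_mono) auto
      finally show ?case by (simp add: exp_add[symmetric] algebra_simps)
    qed
    moreover have "lam ^ N * C * exp (2 * (\<Sum>i<k. C * m ^ i)) \<le> M" for k
      unfolding M_def using sums[of k] C p_pos by (intro mult_left_mono) auto
    ultimately have ge: "lam ^ (N + k) * e (N + k) \<le> M" for k
      by (rule order_trans)
    show ?thesis
    proof (cases "n \<ge> N")
      case True
      then show ?thesis using ge[of "n - N"] by (simp add: e_def)
    next
      case False
      have "C * m ^ n \<le> C" using C by (intro mult_left_le power_le_one) auto
      then have "lam ^ n * e n \<le> lam ^ N * C"
        using e[of n] p_pos False C by (intro mult_mono power_increasing) auto
      then show ?thesis using M_ge by (simp add: e_def)
    qed
  qed
  show ?thesis
  proof (rule that[of M])
    show "0 \<le> M" using C p_pos by (simp add: M_def)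
    fix z n assume "z \<in> K"
    from main[OF this, of n] show "norm (1 - (G ^^ n) z) \<le> M / lam ^ n"
      using p_pos by (simp add: field_simps)
  qed
qed

text \<open>By \<open>one_minus_G\<close> consecutive approximants differ by lam^n p d^2 with d =
  O(lam^(-n)), so the increments are O(lam^(-n)) uniformly on K and the limit is reached at that
  rate.\<close>

lemma koenigs_approx:
  assumes K: "compact K" "K \<subseteq> slit"
  obtains C where "0 \<le> C" "\<And>z n. z \<in> K \<Longrightarrow> norm (1 - (G ^^ n) z) \<le> C / lam ^ n"
    "\<And>z. z \<in> K \<Longrightarrow> (\<lambda>n. of_real lam ^ n * (1 - (G ^^ n) z)) \<longlonglongrightarrow> koenigs z"
    "\<And>z n. z \<in> K \<Longrightarrow> norm (koenigs z - of_real lam ^ n * (1 - (G ^^ n) z)) \<le> C / lam ^ n"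
proof -
  obtain C where C: "0 \<le> C" "\<And>z n. z \<in> K \<Longrightarrow> norm (1 - (G ^^ n) z) \<le> C / lam ^ n"
    using G_pow_linear_bound[OF K] by blast
  define k where "k z n = complex_of_real lam ^ n * (1 - (G ^^ n) z)" for z n
  have incr: "norm (k z (Suc n) - k z n) \<le> C\<^sup>2 * (1 / lam) ^ n" if z: "z \<in> K" for z n
  proof -
    define d where "d = 1 - (G ^^ Suc n) z"
    have "1 - (G ^^ n) z = d * (of_real lam - of_real p * d)"
      using one_minus_G[of "(G ^^ n) z"] by (simp add: d_def)
    then have "k z n = complex_of_real lam ^ n * (d * (of_real lam - of_real p * d))"
      by (simp only: k_def)
    moreover have "k z (Suc n) = complex_of_real lam ^ n * (of_real lam * d)"
      by (simp only: k_def d_def power_Suc mult_ac)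
    ultimately have "k z (Suc n) - k z n = complex_of_real lam ^ n * (of_real p * d\<^sup>2)"
      by (simp only: algebra_simps power2_eq_square)
    then have "norm (k z (Suc n) - k z n) = lam ^ n * (p * (norm d)\<^sup>2)"
      using p_pos by (simp add: norm_mult norm_power del: of_real_add)
    also have "\<dots> \<le> lam ^ n * (1 * (C / lam ^ Suc n)\<^sup>2)"
      using C(2)[OF z, of "Suc n"] p_pos p_less_1 C(1)
      by (intro mult_left_mono mult_mono power_mono) (auto simp: d_def)
    also have "\<dots> \<le> lam ^ n * (C / lam ^ n)\<^sup>2"
      using C p_pos by (auto intro!: mult_left_mono power_mono divide_left_mono)
    also have "\<dots> = C\<^sup>2 * (1 / lam) ^ n"
      using p_pos by (simp add: power2_eq_square field_simps)
    finally show ?thesis .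
  qed
  have lim: "norm (koenigs z - k z n) \<le> C\<^sup>2 / (1 - 1 / lam) / lam ^ n" if z: "z \<in> K" for z n
    using geometric_increments_limit(2)[OF _ _ incr[OF z], of n] p_pos
    by (simp add: koenigs_def k_def[abs_def] power_one_over mult.commute)
  have conv: "k z \<longlonglongrightarrow> koenigs z" if z: "z \<in> K" for z
    using geometric_increments_limit(1)[OF _ _ incr[OF z]] p_pos
    by (simp add: koenigs_def k_def[abs_def] convergent_LIMSEQ_iff)
  define C' where "C' = max C (C\<^sup>2 / (1 - 1 / lam))"
  show ?thesis
  proof (rule that[of C'])
    show "0 \<le> C'" using C by (simp add: C'_def)
    fix z n assume z: "z \<in> K"
    show "norm (1 - (G ^^ n) z) \<le> C' / lam ^ n"
      using C(2)[OF z, of n] p_pos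
      by (rule_tac order_trans) (auto simp: C'_def intro!: divide_right_mono)
    show "norm (koenigs z - of_real lam ^ n * (1 - (G ^^ n) z)) \<le> C' / lam ^ n"
    proof -
      have "C\<^sup>2 / (1 - 1 / lam) / lam ^ n \<le> C' / lam ^ n"
        using p_pos by (intro divide_right_mono) (simp_all add: C'_def)
      with lim[OF z, of n] show ?thesis
        unfolding k_def by (rule order_trans)
    qed
    show "(\<lambda>n. of_real lam ^ n * (1 - (G ^^ n) z)) \<longlonglongrightarrow> koenigs z"
      using conv[OF z] by (simp add: k_def[abs_def])
  qed
qed

lemma koenigs_tendsto:
  assumes "z \<in> slit"
  shows "(\<lambda>n. of_real lam ^ n * (1 - (G ^^ n) z)) \<longlonglongrightarrow> koenigs z"
proof -
  have "{z} \<subseteq> slit" using assms by simp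
  then show ?thesis
    using koenigs_approx[OF compact_sing] by (metis singletonI)
qed

lemma open_slit: "open slit"
  by (intro open_Compl closed_nonpos_Reals_complex)

lemma uniform_limit_geometric:
  assumes "\<And>z n. z \<in> K \<Longrightarrow> norm (g z - f n z) \<le> C / lam ^ n"
  shows "uniform_limit K f g sequentially"
proof (rule uniform_limitI)
  fix e :: real assume "0 < e"
  have "(\<lambda>n. C * (1 / lam) ^ n) \<longlonglongrightarrow> C * 0"
    using p_pos by (intro tendsto_intros LIMSEQ_realpow_zero) auto
  then have "eventually (\<lambda>n. C * (1 / lam) ^ n < e) sequentially"
    using \<open>0 < e\<close> by (intro order_tendstoD) auto
  then show "\<forall>\<^sub>F n in sequentially. \<forall>x\<in>K. dist (f n x) (g x) < e"
    by (rule eventually_mono)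
      (use assms in \<open>auto simp: dist_norm norm_minus_commute power_one_over intro: le_less_trans\<close>)
qed

lemma holomorphic_koenigs: "koenigs holomorphic_on slit"
proof (rule holomorphic_uniform_sequence[OF open_slit])
  show "(\<lambda>z. of_real lam ^ n * (1 - (G ^^ n) z)) holomorphic_on slit" for n
    using holomorphic_G_pow[of n] by (intro holomorphic_intros)
  fix z :: complex assume "z \<in> slit"
  then obtain d where d: "0 < d" "cball z d \<subseteq> slit"
    using open_slit open_contains_cball by blast
  obtain C where C: "\<And>\<zeta> n. \<zeta> \<in> cball z d \<Longrightarrow> norm (koenigs \<zeta> - of_real lam ^ n * (1 - (G ^^ n) \<zeta>)) \<le> C / lam ^ n"
    using koenigs_approx[OF compact_cball d(2)] by metis
  have "uniform_limit (cball z d) (\<lambda>n z. of_real lam ^ n * (1 - (G ^^ n) z)) koenigs sequentially"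
    by (rule uniform_limit_geometric) (rule C)
  with d show "\<exists>d>0. cball z d \<subseteq> slit \<and>
      uniform_limit (cball z d) (\<lambda>n z. of_real lam ^ n * (1 - (G ^^ n) z)) koenigs sequentially"
    by blast
qed

lemma koenigs_G: assumes "z \<in> slit" shows "koenigs z = of_real lam * koenigs (G z)"
proof -
  have "(\<lambda>n. of_real lam * (of_real lam ^ n * (1 - (G ^^ n) (G z)))) \<longlonglongrightarrow> of_real lam * koenigs (G z)"
    using assms by (intro tendsto_intros koenigs_tendsto G_slit)
  moreover have "(\<lambda>n. of_real lam ^ Suc n * (1 - (G ^^ Suc n) z)) \<longlonglongrightarrow> koenigs z"
    using koenigs_tendsto[OF assms] by (rule LIMSEQ_Suc)
  ultimately show ?thesis
    by (intro LIMSEQ_unique) (simp_all add: funpow_swap1 mult_ac)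
qed

end

section \<open>The holomorphic pieces: residual series on the slit plane, generating series on the
  basin of 0\<close>

context splitting
begin

abbreviation "apar \<equiv> 1 + 2 * p"

lemma apar_less_lam_squared: "apar < lam\<^sup>2"
  using p_pos by (simp add: power2_eq_square algebra_simps)

lemma lam_nonzero: "complex_of_real lam \<noteq> 0" and apar_nonzero: "complex_of_real apar \<noteq> 0"
  unfolding of_real_eq_0_iff using p_pos by auto

text \<open>Both the Taylor remainder of (1-d)^j and the error of d against koenigs(z)/lam^n are
  O(lam^(-2n)); multiplied by a^n this is still geometric, since a < lam^2.\<close>

lemma koenigs_remainder_bound:
  assumes K: "compact K" "K \<subseteq> slit"
  obtains C where "\<And>z n. z \<in> K \<Longrightarrow>
    norm (of_real apar ^ n * ((G ^^ n) z ^ j - 1 + of_nat j * (koenigs z / of_real lam ^ n)))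
      \<le> C * (apar / lam\<^sup>2) ^ n"
proof -
  obtain C where C: "0 \<le> C" "\<And>z n. z \<in> K \<Longrightarrow> norm (1 - (G ^^ n) z) \<le> C / lam ^ n"
    "\<And>z n. z \<in> K \<Longrightarrow> norm (koenigs z - of_real lam ^ n * (1 - (G ^^ n) z)) \<le> C / lam ^ n"
    by (rule koenigs_approx[OF K]) blast
  obtain c where c: "0 \<le> c"
    "\<And>d :: complex. norm d \<le> C \<Longrightarrow> norm ((1 - d) ^ j - 1 + of_nat j * d) \<le> c * (norm d)\<^sup>2"
    using mono_binomial_remainder[OF C(1)] by blast
  show ?thesis
  proof (rule that[of "c * C\<^sup>2 + real j * C"])
    fix z n assume z: "z \<in> K"
    define d where "d = 1 - (G ^^ n) z"
    have lam1: "1 \<le> lam ^ n" using p_pos by (intro one_le_power) auto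
    have d1: "norm d \<le> C / lam ^ n" using C(2)[OF z] by (simp add: d_def)
    also have "\<dots> \<le> C" using lam1 C(1) by (simp add: divide_le_eq mult_le_cancel_left1)
    finally have dC: "norm d \<le> C" .
    have e: "norm (koenigs z / of_real lam ^ n - d) \<le> C / lam ^ n / lam ^ n"
    proof -
      have "koenigs z / of_real lam ^ n - d = (koenigs z - of_real lam ^ n * d) / of_real lam ^ n"
        using p_pos by (simp add: diff_divide_distrib del: of_real_add)
      also have "norm \<dots> \<le> C / lam ^ n / lam ^ n"
        using divide_right_mono[OF C(3)[OF z, of n], of "lam ^ n"] p_pos
        by (simp add: d_def norm_divide norm_power del: of_real_add)
      finally show ?thesis .
    qed
    have "(G ^^ n) z ^ j - 1 + of_nat j * (koenigs z / of_real lam ^ n)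
        = ((1 - d) ^ j - 1 + of_nat j * d) + of_nat j * (koenigs z / of_real lam ^ n - d)"
      by (simp add: d_def algebra_simps)
    also have "norm \<dots> \<le> c * (norm d)\<^sup>2 + real j * (C / lam ^ n / lam ^ n)"
      using c(2)[OF dC] mult_left_mono[OF e, of "real j"]
      by (intro norm_triangle_le) (simp add: norm_mult)
    also have "\<dots> \<le> c * (C / lam ^ n)\<^sup>2 + real j * (C / lam ^ n / lam ^ n)"
      using c d1 by (intro add_right_mono mult_left_mono power_mono) auto
    also have "\<dots> = (c * C\<^sup>2 + real j * C) * (1 / lam\<^sup>2) ^ n"
    proof -
      have *: "(1 / lam\<^sup>2) ^ n = 1 / (lam ^ n)\<^sup>2"
        by (simp only: power_one_over power_mult[symmetric] mult.commute)
      have "c * (C / L)\<^sup>2 + real j * (C / L / L) = (c * C\<^sup>2 + real j * C) * (1 / L\<^sup>2)" for L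
        by (simp add: power2_eq_square add_divide_distrib)
      then show ?thesis unfolding * .
    qed
    finally have "norm (of_real apar ^ n * ((G ^^ n) z ^ j - 1 + of_nat j * (koenigs z / of_real lam ^ n)))
      \<le> apar ^ n * ((c * C\<^sup>2 + real j * C) * (1 / lam\<^sup>2) ^ n)"
      using p_pos by (simp add: norm_mult norm_power mult_left_mono del: of_real_add of_real_mult)
    also have "\<dots> = (c * C\<^sup>2 + real j * C) * (apar / lam\<^sup>2) ^ n"
      by (simp add: power_divide)
    finally show "norm (of_real apar ^ n * ((G ^^ n) z ^ j - 1 + of_nat j * (koenigs z / of_real lam ^ n)))
      \<le> (c * C\<^sup>2 + real j * C) * (apar / lam\<^sup>2) ^ n" .
  qed
qed

text \<open>The part of the two-sided sum \<open>periodic_part\<close> with negative index, written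
  in the variable z = phi(t) and thereby extended to the slit plane: there G^n z = phi(t / lam^n)
  and koenigs z = t (see \<open>resid_phi\<close>).\<close>

definition resid :: "nat \<Rightarrow> complex \<Rightarrow> complex" where
  "resid j z = (\<Sum>n. of_real apar ^ Suc n *
     ((G ^^ Suc n) z ^ j - 1 + of_nat j * (koenigs z / of_real lam ^ Suc n)))"

lemma summable_apar_lam: "summable (\<lambda>n. C * (apar / lam\<^sup>2) ^ Suc n)"
  using p_pos apar_less_lam_squared
  by (intro summable_mult summable_Suc_iff[THEN iffD2] summable_geometric) (simp add: divide_less_eq)

lemma holomorphic_resid: "resid j holomorphic_on slit"
proof (rule holomorphic_uniform_sequence[OF open_slit])
  let ?f = "\<lambda>n z. of_real apar ^ Suc n *
     ((G ^^ Suc n) z ^ j - 1 + of_nat j * (koenigs z / of_real lam ^ Suc n))"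
  show "(\<lambda>z. \<Sum>i<n. ?f i z) holomorphic_on slit" for n
    using holomorphic_G_pow holomorphic_koenigs lam_nonzero
    by (intro holomorphic_intros) (auto simp del: of_real_add funpow.simps)
  fix z :: complex assume "z \<in> slit"
  then obtain d where d: "0 < d" "cball z d \<subseteq> slit"
    using open_slit open_contains_cball by blast
  obtain C where C: "\<And>\<zeta> n. \<zeta> \<in> cball z d \<Longrightarrow> norm (of_real apar ^ n *
      ((G ^^ n) \<zeta> ^ j - 1 + of_nat j * (koenigs \<zeta> / of_real lam ^ n))) \<le> C * (apar / lam\<^sup>2) ^ n"
    using koenigs_remainder_bound[OF compact_cball d(2)] by metis
  have "uniform_limit (cball z d) (\<lambda>n z. \<Sum>i<n. ?f i z) (resid j) sequentially"
    unfolding resid_def[abs_def] using C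
    by (intro Weierstrass_m_test[OF _ summable_apar_lam[of C]]) blast
  with d show "\<exists>d>0. cball z d \<subseteq> slit \<and>
      uniform_limit (cball z d) (\<lambda>n z. \<Sum>i<n. ?f i z) (resid j) sequentially"
    by blast
qed

lemma F_norm_le: "norm (F p z) \<le> norm z * (1 - p + p * norm z)"
proof -
  have "F p z = z * (of_real (1 - p) + of_real p * z)"
    by (simp add: F_def power2_eq_square algebra_simps)
  moreover have "norm (of_real (1 - p) + of_real p * z) \<le> 1 - p + p * norm z"
    using p_pos p_less_1 by (intro norm_triangle_le) (simp add: norm_mult del: of_real_diff)
  ultimately show ?thesis
    by (simp add: norm_mult mult_left_mono)
qed

lemma F_norm_le_self: assumes "norm z \<le> 1" shows "norm (F p z) \<le> norm z"
proof -
  have "1 - p + p * norm z \<le> 1" using assms p_pos by (simp add: mult_left_le)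
  then have "norm z * (1 - p + p * norm z) \<le> norm z * 1" by (intro mult_left_mono) auto
  then show ?thesis using F_norm_le[of z] by simp
qed

lemma F_pow_norm_le: "norm z \<le> 1 \<Longrightarrow> norm ((F p ^^ n) z) \<le> norm z"
  by (induction n) (auto intro: order_trans[OF F_norm_le_self])

text \<open>Basin of attraction of the fixed point 0 of F: the orbit has entered the open unit
  disc.\<close>

definition basin :: "complex set" where
  "basin = (\<Union>n. {z. norm ((F p ^^ n) z) < 1})"

text \<open>Up to the factor 2p/a this is the generating function of (p_k), continued from the unit
  disc to the basin.\<close>

definition gsum :: "nat \<Rightarrow> complex \<Rightarrow> complex" where
  "gsum j z = (\<Sum>n. (F p ^^ n) z ^ j / of_real apar ^ n)"

lemma holomorphic_F_pow: "(F p ^^ n :: complex \<Rightarrow> complex) holomorphic_on A"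
proof (induction n)
  case (Suc n)
  have "(\<lambda>z. of_real (1 - p) * (F p ^^ n) z + of_real p * ((F p ^^ n) z)\<^sup>2 :: complex) holomorphic_on A"
    using Suc by (intro holomorphic_intros)
  moreover have "(F p ^^ Suc n) = (\<lambda>z. of_real (1 - p) * (F p ^^ n) z + of_real p * ((F p ^^ n) z)\<^sup>2 :: complex)"
    by (rule ext) (simp only: funpow.simps o_apply, subst F_def, rule refl)
  ultimately show ?case by simp
qed (auto simp: id_def)

lemma continuous_on_F_pow: "continuous_on A (F p ^^ n :: complex \<Rightarrow> complex)"
  using holomorphic_F_pow by (rule holomorphic_on_imp_continuous_on)

lemma open_F_pow_less_1: "open {z :: complex. norm ((F p ^^ n) z) < 1}"
  using continuous_on_F_pow[of UNIV n] by (intro open_Collect_less continuous_intros)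

lemma open_basin: "open basin"
  unfolding basin_def using open_F_pow_less_1 by auto

lemma basin_shift: "norm ((F p ^^ n) z) < 1 \<Longrightarrow> z \<in> basin"
  by (auto simp: basin_def)

lemma basin_F: assumes "F p z \<in> basin" shows "z \<in> basin"
proof -
  obtain n where "norm ((F p ^^ n) (F p z)) < 1" using assms by (auto simp: basin_def)
  then have "norm ((F p ^^ Suc n) z) < 1" by (simp only: funpow_Suc_right o_apply)
  then show ?thesis by (rule basin_shift)
qed

lemma gsum_tail_bound:
  assumes "norm ((F p ^^ N) z) < 1"
  shows "norm ((F p ^^ (n + N)) z ^ j / complex_of_real apar ^ (n + N)) \<le> (1 / apar) ^ n"
proof -
  have "norm ((F p ^^ (n + N)) z) \<le> 1"
    using F_pow_norm_le[of "(F p ^^ N) z" n] assms by (simp add: funpow_add)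
  then have "norm ((F p ^^ (n + N)) z) ^ j \<le> 1" by (intro power_le_one) auto
  then have "norm ((F p ^^ (n + N)) z ^ j / complex_of_real apar ^ (n + N)) \<le> 1 / apar ^ (n + N)"
    using p_pos by (simp add: norm_divide norm_power divide_right_mono del: of_real_add of_real_mult)
  also have "\<dots> \<le> (1 / apar) ^ n"
    using p_pos by (simp add: power_one_over divide_le_eq power_increasing)
  finally show ?thesis .
qed

lemma summable_inv_apar: "summable (\<lambda>n. (1 / apar) ^ n)"
  using p_pos by (intro summable_geometric) auto

lemma summable_gsum: assumes "z \<in> basin" shows "summable (\<lambda>n. (F p ^^ n) z ^ j / of_real apar ^ n)"
proof -
  obtain N where "norm ((F p ^^ N) z) < 1" using assms by (auto simp: basin_def)
  from gsum_tail_bound[OF this] have "summable (\<lambda>n. (F p ^^ (n + N)) z ^ j / of_real apar ^ (n + N))"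
    by (intro summable_comparison_test'[OF summable_inv_apar]) blast
  then show ?thesis by (rule summable_iff_shift[THEN iffD1])
qed

lemma gsum_F: assumes "F p z \<in> basin" shows "gsum j z = z ^ j + gsum j (F p z) / of_real apar"
proof -
  have "gsum j z = z ^ j + (\<Sum>n. (F p ^^ Suc n) z ^ j / of_real apar ^ Suc n)"
    unfolding gsum_def using suminf_split_head[OF summable_gsum[OF basin_F[OF assms], of j]] by simp
  also have "(\<Sum>n. (F p ^^ Suc n) z ^ j / of_real apar ^ Suc n)
      = (\<Sum>n. ((F p ^^ n) (F p z) ^ j / of_real apar ^ n) / of_real apar)"
    by (intro suminf_cong) (simp add: funpow_swap1 mult_ac)
  also have "\<dots> = gsum j (F p z) / of_real apar"
    unfolding gsum_def using summable_gsum[OF assms, of j] by (rule suminf_divide)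
  finally show ?thesis .
qed

text \<open>Where the N-th iterate lies in the unit disc, the tail from index N is dominated by
  powers of 1/a, and the head is a polynomial in z.\<close>

lemma holomorphic_gsum: "gsum j holomorphic_on basin"
  unfolding basin_def
proof (rule holomorphic_on_UN_open)
  fix N
  let ?U = "{z :: complex. norm ((F p ^^ N) z) < 1}"
  let ?f = "\<lambda>n z. (F p ^^ n) z ^ j / complex_of_real apar ^ n"
  have part: "(\<lambda>z. \<Sum>n<m. ?f (n + k) z) holomorphic_on ?U" for m k
    using apar_nonzero
    by (intro holomorphic_intros holomorphic_F_pow) (auto simp del: of_real_add of_real_mult)
  have "(\<lambda>z. \<Sum>n. ?f (n + N) z) holomorphic_on ?U"
  proof (rule holomorphic_uniform_sequence[OF open_F_pow_less_1 part])
    fix z :: complex assume "z \<in> ?U"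
    then obtain d where d: "0 < d" "cball z d \<subseteq> ?U"
      using open_F_pow_less_1 open_contains_cball by blast
    have "uniform_limit (cball z d) (\<lambda>m z. \<Sum>n<m. ?f (n + N) z) (\<lambda>z. \<Sum>n. ?f (n + N) z) sequentially"
      using d gsum_tail_bound[of N] by (intro Weierstrass_m_test[OF _ summable_inv_apar]) blast
    with d show "\<exists>d>0. cball z d \<subseteq> ?U \<and>
        uniform_limit (cball z d) (\<lambda>m z. \<Sum>n<m. ?f (n + N) z) (\<lambda>z. \<Sum>n. ?f (n + N) z) sequentially"
      by blast
  qed
  then have "(\<lambda>z. (\<Sum>n. ?f (n + N) z) + (\<Sum>n<N. ?f (n + 0) z)) holomorphic_on ?U"
    by (intro holomorphic_intros part)
  moreover have "(\<Sum>n. ?f (n + N) z) + (\<Sum>n<N. ?f (n + 0) z) = gsum j z" if "z \<in> ?U" for z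
    unfolding gsum_def add_0_right
    using summable_gsum[of z j] that
    by (intro suminf_split_initial_segment[symmetric]) (auto simp: basin_def)
  ultimately show "gsum j holomorphic_on ?U"
    by (rule holomorphic_transform)
qed (rule open_F_pow_less_1)

lemma F_real: "F p (x :: real) = x * (1 - p + p * x)"
  by (simp add: F_def power2_eq_square algebra_simps)

text \<open>The left end -1/p is the second preimage of 1 under F. In between there are three cases:
  0 <= x < 1 lies in the disc already; if 1 - p + p x <= 0, one step of F leads into [0,1);
  otherwise x <= 0 and the iterates shrink at least like (1-p)^n.\<close>

lemma of_real_basin:
  assumes "- 1 / p < x" "x < 1" shows "of_real x \<in> basin"
proof -
  have small: "of_real x \<in> basin" if "\<bar>x\<bar> < 1" for x
    using that by (intro basin_shift[of 0]) auto
  have "p * (- 1 / p) < p * x" using assms p_pos by (intro mult_strict_left_mono)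
  then have px: "- 1 < p * x" using p_pos by simp
  consider "0 \<le> x" | "x \<le> 0" "1 - p + p * x \<le> 0" | "x \<le> 0" "0 < 1 - p + p * x" by linarith
  then show ?thesis
  proof cases
    case 1
    then show ?thesis using assms by (intro small) auto
  next
    case 2
    have "0 \<le> x * (1 - p + p * x)" using 2 by (rule mult_nonpos_nonpos)
    moreover have "x * (1 - p + p * x) < 1"
    proof -
      have "(- x) * (- (1 - p + p * x)) \<le> (- x) * p" using 2 px by (intro mult_left_mono) auto
      moreover have "(- x) * p < 1" using px by (simp only: mult.commute[of _ p] mult_minus_right)
      ultimately show ?thesis by (simp only: minus_mult_minus)
    qed
    ultimately have "\<bar>F p x\<bar> < 1" unfolding F_real by linarith
    then have "of_real (F p x) \<in> basin" by (rule small)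
    then show ?thesis unfolding F_of_real[symmetric] by (rule basin_F)
  next
    case 3
    have bnd: "- ((1 - p) ^ n * (- x)) \<le> (F p ^^ n) x \<and> (F p ^^ n) x \<le> 0" for n
    proof (induction n)
      case 0
      then show ?case using 3(1) by simp
    next
      case (Suc n)
      define y where "y = (F p ^^ n) x"
      have "(1 - p) ^ n * (- x) \<le> 1 * (- x)"
        using 3 p_pos p_less_1 by (intro mult_right_mono power_le_one) auto
      then have y: "- ((1 - p) ^ n * (- x)) \<le> y" "y \<le> 0" "x \<le> y"
        using Suc unfolding y_def by linarith+
      have "p * x \<le> p * y" using y(3) p_pos by (intro mult_left_mono) auto
      moreover have "p * y \<le> 0" using y(2) p_pos by (intro mult_nonneg_nonpos) auto
      ultimately have q: "0 \<le> 1 - p + p * y" "1 - p + p * y \<le> 1 - p" using 3 by auto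
      have "(- y) * (1 - p + p * y) \<le> (1 - p) ^ n * (- x) * (1 - p)"
        using y q by (intro mult_mono) auto
      then have "- ((1 - p) ^ Suc n * (- x)) \<le> y * (1 - p + p * y)"
        by (simp only: power_Suc mult.commute mult.left_commute mult_minus_left mult_minus_right)
      moreover have "y * (1 - p + p * y) \<le> 0"
        using y q by (intro mult_nonpos_nonneg)
      moreover have "(F p ^^ Suc n) x = y * (1 - p + p * y)"
        by (simp only: funpow.simps o_apply y_def[symmetric] F_real[of y])
      ultimately show ?case by simp
    qed
    have "(\<lambda>n. (1 - p) ^ n * (- x)) \<longlonglongrightarrow> 0 * (- x)"
      using p_pos p_less_1 by (intro tendsto_intros LIMSEQ_realpow_zero) auto
    then have "eventually (\<lambda>n. (1 - p) ^ n * (- x) < 1) sequentially"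
      by (intro order_tendstoD) auto
    then obtain n where "(1 - p) ^ n * (- x) < 1"
      using eventually_happens'[OF sequentially_bot] by blast
    with bnd[of n] have "\<bar>(F p ^^ n) x\<bar> < 1" by linarith
    moreover have "(F p ^^ n) (complex_of_real x) = of_real ((F p ^^ n) x)" for n
      by (induction n) (simp_all only: funpow.simps id_apply o_apply F_of_real)
    ultimately have "norm ((F p ^^ n) (complex_of_real x)) < 1" by (simp only: norm_of_real)
    then show ?thesis by (rule basin_shift)
  qed
qed

end

text \<open>Order r > 1 along the ray forces f and f' to vanish at \<open>z0\<close>, after which f
  is O(s^2), which contradicts the lower bound of order r < 2. The factor z - \<open>z0\<close> is
  divided out twice, as holomorphic functions g and h.\<close>

lemma holomorphic_no_fractional_order:
  fixes f :: "complex \<Rightarrow> complex"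
  assumes hol: "f holomorphic_on ball z0 e" and "0 < e" "1 < r" "r < 2" "0 < k1" "0 < d"
    and lower: "\<And>s. 0 < s \<Longrightarrow> s < d \<Longrightarrow> k1 * s powr r \<le> norm (f (z0 - \<i> * of_real s))"
    and upper: "\<And>s. 0 < s \<Longrightarrow> s < d \<Longrightarrow> norm (f (z0 - \<i> * of_real s)) \<le> k2 * s powr r"
  shows False
proof -
  have path: "((\<lambda>s. z0 - \<i> * of_real s) \<longlongrightarrow> z0) (at_right 0)"
    by (auto intro!: tendsto_eq_intros)
  have lim: "((\<lambda>s. g (z0 - \<i> * of_real s)) \<longlongrightarrow> g z0) (at_right 0)"
    if "g holomorphic_on ball z0 e" for g
  proof -
    have "isCont g z0"
      using holomorphic_on_imp_continuous_on[OF that] \<open>0 < e\<close>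
      by (intro continuous_on_interior[of "ball z0 e"]) simp_all
    then show ?thesis by (rule isCont_tendsto_compose[OF _ path])
  qed
  have near: "eventually (\<lambda>s::real. 0 < s \<and> s < min d e) (at_right 0)"
    using eventually_at_right_real[of 0 "min d e"] \<open>0 < d\<close> \<open>0 < e\<close> by simp
  have pw: "((\<lambda>s::real. s powr \<alpha>) \<longlongrightarrow> 0) (at_right 0)" if "0 < \<alpha>" for \<alpha>
  proof -
    have "eventually (\<lambda>s::real. 0 \<le> s) (at_right 0)"
      by (rule eventually_mono[OF near]) simp
    then have "((\<lambda>s::real. s powr \<alpha>) \<longlongrightarrow> 0 powr \<alpha>) (at_right 0)"
      using that by (intro tendsto_powr'[OF tendsto_ident_at tendsto_const]) simp
    then show ?thesis by simp
  qed
  have vanish: "g z0 = 0"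
    if "g holomorphic_on ball z0 e" "0 < \<alpha>"
      "\<And>s. 0 < s \<Longrightarrow> s < min d e \<Longrightarrow> norm (g (z0 - \<i> * of_real s)) \<le> k2 * s powr \<alpha>" for g \<alpha>
  proof -
    have "((\<lambda>s::real. k2 * s powr \<alpha>) \<longlongrightarrow> k2 * 0) (at_right 0)"
      by (intro tendsto_mult tendsto_const pw that(2))
    moreover have "((\<lambda>s. norm (g (z0 - \<i> * of_real s))) \<longlongrightarrow> norm (g z0)) (at_right 0)"
      using lim[OF that(1)] by (rule tendsto_norm)
    ultimately have "norm (g z0) \<le> k2 * 0"
      proof (rule tendsto_le[OF trivial_limit_at_right_real])
      show "\<forall>\<^sub>F s in at_right 0. norm (g (z0 - \<i> * of_real s)) \<le> k2 * s powr \<alpha>"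
        by (rule eventually_mono[OF near]) (simp add: that(3))
    qed
    then show ?thesis by simp
  qed
  have factor: "\<exists>h. h holomorphic_on ball z0 e \<and> (\<forall>s. 0 < s \<longrightarrow> s < e \<longrightarrow>
      norm (g (z0 - \<i> * of_real s)) = s * norm (h (z0 - \<i> * of_real s)))"
    if "g holomorphic_on ball z0 e" "g z0 = 0" for g
  proof (intro exI conjI allI impI)
    let ?h = "\<lambda>z. if z = z0 then deriv g z0 else (g z - g z0) / (z - z0)"
    show "?h holomorphic_on ball z0 e" using that(1) by (intro pole_lemma_open) auto
    fix s :: real assume "0 < s" "s < e"
    then show "norm (g (z0 - \<i> * of_real s)) = s * norm (?h (z0 - \<i> * of_real s))"
      using that(2) by (simp add: norm_divide norm_mult)
  qed
  have "f z0 = 0"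
    using upper \<open>1 < r\<close> by (intro vanish[OF hol, of r]) auto
  then obtain g where g: "g holomorphic_on ball z0 e"
    "\<And>s. 0 < s \<Longrightarrow> s < e \<Longrightarrow> norm (f (z0 - \<i> * of_real s)) = s * norm (g (z0 - \<i> * of_real s))"
    using factor[OF hol] by blast
  have "norm (g (z0 - \<i> * of_real s)) \<le> k2 * s powr (r - 1)" if "0 < s" "s < min d e" for s
    using upper[of s] g(2)[of s] that
    by (simp add: powr_diff field_simps)
  then have "g z0 = 0" using \<open>1 < r\<close> by (intro vanish[OF g(1), of "r - 1"]) auto
  then obtain h where h: "h holomorphic_on ball z0 e"
    "\<And>s. 0 < s \<Longrightarrow> s < e \<Longrightarrow> norm (g (z0 - \<i> * of_real s)) = s * norm (h (z0 - \<i> * of_real s))"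
    using factor[OF g(1)] by blast
  have ge: "k1 \<le> s powr (2 - r) * norm (h (z0 - \<i> * of_real s))" if "0 < s" "s < min d e" for s
  proof -
    have "k1 * s powr r \<le> s * (s * norm (h (z0 - \<i> * of_real s)))"
      using lower[of s] g(2)[of s] h(2)[of s] that by simp
    also have "\<dots> = s powr r * (s powr (2 - r) * norm (h (z0 - \<i> * of_real s)))"
    proof -
      have "s powr r * s powr (2 - r) = s * s"
        using that powr_add[of s r "2 - r"] by (simp add: power2_eq_square)
      then show ?thesis by (simp only: mult.assoc[symmetric])
    qed
    finally have "s powr r * k1 \<le> s powr r * (s powr (2 - r) * norm (h (z0 - \<i> * of_real s)))"
      by (simp only: mult.commute[of k1])
    then show ?thesis using that by simp
  qed
  have "((\<lambda>s. s powr (2 - r) * norm (h (z0 - \<i> * of_real s))) \<longlongrightarrow> 0 * norm (h z0)) (at_right 0)"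
    by (intro tendsto_mult tendsto_norm lim[OF h(1)] pw) (use \<open>r < 2\<close> in simp)
  then have "k1 \<le> 0 * norm (h z0)"
  proof (rule tendsto_lowerbound[OF _ _ trivial_limit_at_right_real])
    show "\<forall>\<^sub>F s in at_right 0. k1 \<le> s powr (2 - r) * norm (h (z0 - \<i> * of_real s))"
      by (rule eventually_mono[OF near]) (simp add: ge)
  qed
  then show False using \<open>0 < k1\<close> by simp
qed

section \<open>Solutions phi of the functional equation as inverses of the Koenigs function\<close>

locale splitting_laplace = splitting +
  fixes phi :: "real \<Rightarrow> real" and K :: real
  assumes phi_lam: "0 \<le> t \<Longrightarrow> phi (lam * t) = F p (phi t)"
    and phi_nonneg: "0 \<le> t \<Longrightarrow> 0 \<le> phi t"
    and phi_le_1: "0 \<le> t \<Longrightarrow> phi t \<le> 1"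
    and phi_approx: "0 \<le> t \<Longrightarrow> \<bar>phi t - 1 + t\<bar> \<le> K * t\<^sup>2"
    and phi_cont: "continuous_on {0..} phi"
begin

lemma K_nonneg: "0 \<le> K"
  using phi_approx[of 1] by simp

lemma phi_0 [simp]: "phi 0 = 1"
  using phi_approx[of 0] by simp

lemma phi_lam_pow: "0 \<le> t \<Longrightarrow> phi (lam ^ n * t) = (F p ^^ n) (phi t)"
proof (induction n)
  case (Suc n)
  have "phi (lam ^ Suc n * t) = phi (lam * (lam ^ n * t))" by (simp add: mult.assoc)
  also have "\<dots> = F p (phi (lam ^ n * t))" using Suc.prems p_pos by (intro phi_lam) simp
  also have "phi (lam ^ n * t) = (F p ^^ n) (phi t)" using Suc by simp
  finally show ?case by simp
qed simp

lemma phi_div_lam: "0 \<le> t \<Longrightarrow> F p (phi (t / lam)) = phi t"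
  using phi_lam[of "t / lam"] p_pos by simp

lemma phi_scaled_limit:
  assumes "0 \<le> t" shows "(\<lambda>n. lam ^ n * (1 - phi (t / lam ^ n))) \<longlonglongrightarrow> t"
proof -
  have "(\<lambda>n. K * t\<^sup>2 * (1 / lam) ^ n) \<longlonglongrightarrow> K * t\<^sup>2 * 0"
    using p_pos by (intro tendsto_mult tendsto_const LIMSEQ_realpow_zero) simp_all
  then have lim: "(\<lambda>n. K * t\<^sup>2 * (1 / lam) ^ n) \<longlonglongrightarrow> 0" by simp
  have "norm (lam ^ n * (1 - phi (t / lam ^ n)) - t) \<le> K * t\<^sup>2 * (1 / lam) ^ n" for n
  proof -
    have "\<bar>phi (t / lam ^ n) - 1 + t / lam ^ n\<bar> \<le> K * (t / lam ^ n)\<^sup>2"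
      using assms p_pos by (intro phi_approx) auto
    then have 1: "lam ^ n * \<bar>phi (t / lam ^ n) - 1 + t / lam ^ n\<bar> \<le> lam ^ n * (K * (t / lam ^ n)\<^sup>2)"
      using p_pos by (intro mult_left_mono) auto
    have 2: "\<bar>L * (1 - x) - t\<bar> = L * \<bar>x - 1 + t / L\<bar>" if "0 < L" for L x
    proof -
      have "L * (1 - x) - t = - (L * (x - 1 + t / L))" using that by (simp add: algebra_simps)
      then show ?thesis using that by (simp add: abs_mult)
    qed
    have 3: "L * (K * (t / L)\<^sup>2) = K * t\<^sup>2 * (1 / L)" for L
      by (simp add: power2_eq_square)
    have "0 < lam ^ n" using p_pos by simp
    from 1 show ?thesis
      unfolding real_norm_def 2[OF \<open>0 < lam ^ n\<close>] power_one_over 3[of "lam ^ n"] .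
  qed
  from Lim_null_comparison[OF always_eventually[OF allI[OF this]] lim]
  have "(\<lambda>n. lam ^ n * (1 - phi (t / lam ^ n)) - t) \<longlonglongrightarrow> 0" .
  then show ?thesis by (rule LIM_zero_cancel)
qed

text \<open>F(y) = 0 with y >= 0 forces y = 0, so a zero of phi at t propagates to all t / lam^n and
  by continuity to 0, where phi is 1.\<close>

lemma phi_pos: assumes "0 \<le> t" shows "0 < phi t"
proof (rule ccontr)
  assume "\<not> 0 < phi t"
  then have 0: "phi t = 0" using phi_nonneg[OF assms] by simp
  have zero: "phi (t / lam ^ n) = 0" for n
  proof (induction n)
    case (Suc n)
    define y where "y = phi (t / lam ^ Suc n)"
    have "0 \<le> y" using assms p_pos by (auto simp: y_def intro!: phi_nonneg)
    have "F p y = 0"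
    proof -
      have "F p y = phi (t / lam ^ n)"
        using phi_div_lam[of "t / lam ^ n"] assms p_pos by (simp add: y_def mult.commute)
      then show ?thesis unfolding Suc.IH .
    qed
    then have "y * (1 - p + p * y) = 0" by (simp only: F_real)
    moreover have "1 - p + p * y > 0" using \<open>0 \<le> y\<close> p_pos p_less_1 by (intro add_pos_nonneg) auto
    ultimately show ?case by (simp add: y_def)
  qed (simp add: 0)
  have "(\<lambda>n. t / lam ^ n) \<longlonglongrightarrow> 0"
    using p_pos LIMSEQ_divide_realpow_zero[of lam t] by simp
  moreover have "continuous (at 0 within {0..}) phi"
    using phi_cont by (simp add: continuous_on_eq_continuous_within)
  ultimately have "(\<lambda>n. phi (t / lam ^ n)) \<longlonglongrightarrow> phi 0"
    using assms p_pos by (intro continuous_within_tendsto_compose'[of 0 "{0..}" phi]) auto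
  then show False by (simp add: zero LIMSEQ_const_iff)
qed

lemma G_pow_phi: "0 \<le> t \<Longrightarrow> (G ^^ n) (of_real (phi t)) = of_real (phi (t / lam ^ n))"
proof (induction n)
  case (Suc n)
  define y where "y = phi (t / lam ^ Suc n)"
  have "0 \<le> y" using Suc p_pos by (auto simp: y_def intro!: phi_nonneg)
  have "F p y = phi (t / lam ^ n)"
    using phi_div_lam[of "t / lam ^ n"] Suc p_pos by (simp add: y_def mult.commute)
  then have "(G ^^ Suc n) (of_real (phi t)) = G (F p (of_real y))"
    using Suc by (simp add: F_of_real)
  also have "\<dots> = of_real y"
    using \<open>0 \<le> y\<close> p_pos p_less_1 by (intro G_F) (simp add: add_pos_nonneg)
  finally show ?case by (simp add: y_def)
qed simp

lemma phi_slit: "0 \<le> t \<Longrightarrow> of_real (phi t) \<in> slit"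
  using phi_pos[of t] by (simp add: complex_nonpos_Reals_iff)

text \<open>G^n phi(t) = phi(t / lam^n) and phi(s) = 1 - s + O(s^2), so the defining limit of
  \<open>koenigs\<close> is t. In particular phi is injective.\<close>

lemma koenigs_phi: assumes "0 \<le> t" shows "koenigs (of_real (phi t)) = of_real t"
proof -
  have "(\<lambda>n. of_real (lam ^ n * (1 - phi (t / lam ^ n)))) \<longlonglongrightarrow> complex_of_real t"
    by (intro tendsto_of_real phi_scaled_limit assms)
  moreover have "(\<lambda>n. of_real lam ^ n * (1 - (G ^^ n) (of_real (phi t)))) \<longlonglongrightarrow> koenigs (of_real (phi t))"
    by (intro koenigs_tendsto phi_slit assms)
  ultimately show ?thesis
    using assms by (intro LIMSEQ_unique[of _ "koenigs (of_real (phi t))"]) (simp_all add: G_pow_phi)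
qed

lemma phi_inj: "0 \<le> s \<Longrightarrow> 0 \<le> t \<Longrightarrow> phi s = phi t \<Longrightarrow> s = t"
  by (metis koenigs_phi of_real_eq_iff)

lemma phi_less_1: "0 < t \<Longrightarrow> phi t < 1"
  using phi_inj[of t 0] phi_le_1[of t] by (auto simp: less_le)

lemma connected_slit: "connected slit"
proof -
  have "slit = - (complex_of_real ` {..0})" by (auto simp: nonpos_Reals_def)
  then show ?thesis
    by (simp only: starlike_imp_connected starlike_slotted_complex_plane_left)
qed

text \<open>G preserves the upper half plane, so the limit has Im <= 0; the open mapping theorem
  makes the inequality strict. This is what gives powers of \<open>koenigs\<close> an analytic
  branch on the upper half plane.\<close>

lemma koenigs_Im_neg: assumes "0 < Im z" shows "Im (koenigs z) < 0"
proof -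
  let ?H = "{z. 0 < Im z}"
  have H: "?H \<subseteq> slit" "open ?H" "connected ?H"
    by (auto simp: complex_nonpos_Reals_iff open_halfspace_Im_gt convex_halfspace_Im_gt intro: convex_connected)
  have le: "Im (koenigs z) \<le> 0" if z: "0 < Im z" for z
  proof -
    have "(\<lambda>n. Im (of_real lam ^ n * (1 - (G ^^ n) z))) \<longlonglongrightarrow> Im (koenigs z)"
      using H z by (intro tendsto_Im koenigs_tendsto) auto
    moreover have "Im (of_real lam ^ n * (1 - (G ^^ n) z)) \<le> 0" for n
    proof -
      have "Im (of_real lam ^ n * (1 - (G ^^ n) z)) = - (lam ^ n * Im ((G ^^ n) z))"
      proof -
        have "Im (of_real L * (1 - \<zeta>)) = - (L * Im \<zeta>)" for L \<zeta> by simp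
        then show ?thesis by (simp only: of_real_power[symmetric])
      qed
      then show ?thesis using G_pow_Im_pos[OF z, of n] p_pos by simp
    qed
    ultimately show ?thesis by (intro LIMSEQ_le_const2) auto
  qed
  have nc: "\<not> koenigs constant_on ?H"
  proof
    assume "koenigs constant_on ?H"
    then obtain c where *: "\<forall>z\<in>?H. koenigs z = c" unfolding constant_on_def by (rule exE)
    have c: "koenigs z = c" if "0 < Im z" for z using bspec[OF *, of z] that by simp
    \<comment> \<open>Were \<open>koenigs\<close> constant on the half plane, koenigs(z) = lam
      koenigs(G z) would make the constant 0, and then \<open>koenigs\<close> would vanish on the
      whole slit plane, although its value at phi(1) is 1.\<close>
    have 1: "norm (koenigs \<i>) = lam * norm (koenigs (G \<i>))"
    proof -
      have "\<i> \<in> slit" by (simp add: complex_nonpos_Reals_iff)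
      from koenigs_G[OF this] have "norm (koenigs \<i>) = norm (of_real lam * koenigs (G \<i>))" by (rule arg_cong)
      also have "\<dots> = lam * norm (koenigs (G \<i>))"
        using p_pos by (simp add: norm_mult del: of_real_add)
      finally show ?thesis .
    qed
    have 2: "koenigs \<i> = c" by (rule c) simp
    have 3: "koenigs (G \<i>) = c" by (intro c G_Im_pos) simp
    have "c = 0"
    proof (rule ccontr)
      assume "c \<noteq> 0"
      then have "norm c * 1 < norm c * lam" using p_pos by (intro mult_strict_left_mono) simp_all
      also have "norm c * lam = lam * norm c" by (rule mult.commute)
      also have "lam * norm c = norm c" using 1 unfolding 2 3 by (rule sym)
      finally show False by simp
    qed
    have "\<i> \<in> ?H" by simp
    then have ne: "?H \<noteq> {}" by (metis empty_iff)
    have slit1: "of_real (phi 1) \<in> slit" by (rule phi_slit) simp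
    have "koenigs (of_real (phi 1)) = 0"
    proof (rule analytic_continuation_open[where f = koenigs and g = "\<lambda>_. 0" and s = ?H and s' = slit])
      fix z assume "z \<in> ?H"
      then show "koenigs z = 0" using c[of z] \<open>c = 0\<close> by simp
    qed (rule H open_slit ne connected_slit holomorphic_koenigs holomorphic_on_const slit1)+
    with koenigs_phi[of 1] show False by simp
  qed
  have "koenigs holomorphic_on ?H"
    using holomorphic_koenigs H(1) by (rule holomorphic_on_subset)
  from open_mapping_thm[OF this H(2,3) H(2) order_refl nc] have op: "open (koenigs ` ?H)" .
  have zin: "koenigs z \<in> koenigs ` ?H" using assms by (intro imageI) simp
  obtain e where e: "0 < e" "ball (koenigs z) e \<subseteq> koenigs ` ?H"
    by (rule openE[OF op zin])
  \<comment> \<open>A point straight above the value at z that is still in the image, so its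
    imaginary part is also <= 0.\<close>
  have "koenigs z + \<i> * of_real (e / 2) \<in> ball (koenigs z) e"
    using e by (simp add: dist_norm norm_mult)
  with e(2) have "koenigs z + \<i> * of_real (e / 2) \<in> koenigs ` ?H" by (rule subsetD)
  then obtain y where y: "koenigs z + \<i> * of_real (e / 2) = koenigs y" "y \<in> ?H"
    by (rule imageE)
  have "Im (koenigs y) \<le> 0" using y(2) by (intro le) simp
  then have "Im (koenigs z + \<i> * of_real (e / 2)) \<le> 0" unfolding y(1) .
  then have "Im (koenigs z) + e / 2 \<le> 0" by simp
  then show ?thesis using e(1) by linarith
qed

end

section \<open>Splitting the generating series at phi(t) into a log-periodic and a holomorphic
  part\<close>

context splitting_laplace
begin

definition remainder :: "nat \<Rightarrow> real \<Rightarrow> real" where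
  "remainder j t = phi t ^ j - 1 + real j * t"

text \<open>The sum over all integers n of a^(-n) \<open>remainder\<close>(lam^n t), cut at n = 0.
  The first series converges by linear growth of the remainder and lam < a, the second by its
  quadratic order at 0 and a < lam^2. Shifting n gives \<open>periodic_part_lam\<close>, so t^(-rho)
  times this function is periodic in log t.\<close>

definition periodic_part :: "nat \<Rightarrow> real \<Rightarrow> real" where
  "periodic_part j t = (\<Sum>n. remainder j (lam ^ n * t) / apar ^ n)
     + (\<Sum>n. apar ^ Suc n * remainder j (t / lam ^ Suc n))"

lemma remainder_quadratic:
  obtains M where "0 \<le> M" "\<And>t. 0 \<le> t \<Longrightarrow> \<bar>remainder j t\<bar> \<le> M * t\<^sup>2"
proof -
  obtain c where c: "0 \<le> c"
    "\<And>d :: real. norm d \<le> 1 \<Longrightarrow> norm ((1 - d) ^ j - 1 + of_nat j * d) \<le> c * (norm d)\<^sup>2"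
    using mono_binomial_remainder[of 1 j, where 'a = real] by auto
  show ?thesis
  proof (rule that[of "c * (1 + K)\<^sup>2 + real j * K"])
    show "0 \<le> c * (1 + K)\<^sup>2 + real j * K" using c(1) K_nonneg by simp
    fix t :: real assume t: "0 \<le> t"
    define d where "d = 1 - phi t"
    have d: "0 \<le> d" "d \<le> 1" using phi_nonneg[OF t] phi_le_1[OF t] by (simp_all add: d_def)
    have td: "\<bar>t - d\<bar> \<le> K * t\<^sup>2" using phi_approx[OF t] by (simp add: d_def)
    have "d \<le> (1 + K) * t"
    proof (cases "t \<le> 1")
      case True
      have "d \<le> t + K * t\<^sup>2" using td by linarith
      also have "K * t\<^sup>2 \<le> K * t"
        using True t K_nonneg by (intro mult_left_mono) (simp_all add: power2_eq_square mult_left_le)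
      finally show ?thesis by (simp add: distrib_right)
    next
      case False
      then have "1 * 1 \<le> (1 + K) * t" using K_nonneg by (intro mult_mono) simp_all
      then show ?thesis using d by linarith
    qed
    then have "d\<^sup>2 \<le> ((1 + K) * t)\<^sup>2" using d by (intro power_mono) simp_all
    then have "c * d\<^sup>2 \<le> c * (1 + K)\<^sup>2 * t\<^sup>2"
      using c(1) by (simp add: power_mult_distrib mult.assoc mult_left_mono)
    moreover have "\<bar>(1 - d) ^ j - 1 + real j * d\<bar> \<le> c * d\<^sup>2" using c(2)[of d] d by simp
    moreover have "\<bar>real j * (t - d)\<bar> \<le> real j * K * t\<^sup>2"
      unfolding abs_mult using td by (simp add: mult.assoc mult_left_mono)
    moreover have "remainder j t = ((1 - d) ^ j - 1 + real j * d) + real j * (t - d)"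
      by (simp add: remainder_def d_def algebra_simps)
    ultimately show "\<bar>remainder j t\<bar> \<le> (c * (1 + K)\<^sup>2 + real j * K) * t\<^sup>2"
      unfolding distrib_right by linarith
  qed
qed

lemma remainder_linear: assumes "0 \<le> t" shows "\<bar>remainder j t\<bar> \<le> 1 + real j * t"
proof -
  have "0 \<le> phi t ^ j" "phi t ^ j \<le> 1"
    using phi_nonneg[OF assms] phi_le_1[OF assms] by (simp_all add: power_le_one)
  moreover have "0 \<le> real j * t" using assms by simp
  ultimately show ?thesis unfolding remainder_def by linarith
qed

lemma summable_linear: "summable (\<lambda>n. C * (lam / apar) ^ n)"
  using p_pos by (intro summable_mult summable_geometric) simp

lemma summable_up: assumes "0 \<le> t" shows "summable (\<lambda>n. remainder j (lam ^ n * t) / apar ^ n)"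
proof (rule summable_comparison_test')
  show "summable (\<lambda>n. 1 * (1 / apar) ^ n + real j * t * (lam / apar) ^ n)"
    using summable_inv_apar by (intro summable_add summable_linear summable_mult)
  fix n
  have "\<bar>remainder j (lam ^ n * t)\<bar> \<le> 1 + real j * (lam ^ n * t)"
    using assms p_pos by (intro remainder_linear) simp
  then have "\<bar>remainder j (lam ^ n * t)\<bar> / apar ^ n \<le> (1 + real j * (lam ^ n * t)) / apar ^ n"
    using p_pos by (intro divide_right_mono) simp_all
  also have "\<dots> = 1 * (1 / apar) ^ n + real j * t * (lam / apar) ^ n"
    unfolding power_divide power_one by (simp add: add_divide_distrib)
  finally show "norm (remainder j (lam ^ n * t) / apar ^ n) \<le> 1 * (1 / apar) ^ n + real j * t * (lam / apar) ^ n"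
    using p_pos by simp
qed

lemma remainder_down_bound:
  obtains M where "0 \<le> M" "\<And>t n. 0 \<le> t \<Longrightarrow>
    \<bar>apar ^ n * remainder j (t / lam ^ n)\<bar> \<le> M * t\<^sup>2 * (apar / lam\<^sup>2) ^ n"
proof -
  obtain M where M: "0 \<le> M" "\<And>t. 0 \<le> t \<Longrightarrow> \<bar>remainder j t\<bar> \<le> M * t\<^sup>2"
    by (rule remainder_quadratic[of j]) (rule that)
  show ?thesis
  proof (rule that[OF M(1)])
    fix t n assume t: "(0::real) \<le> t"
    have "\<bar>remainder j (t / lam ^ n)\<bar> \<le> M * (t / lam ^ n)\<^sup>2"
      using t p_pos by (intro M(2)) simp
    then have "apar ^ n * \<bar>remainder j (t / lam ^ n)\<bar> \<le> apar ^ n * (M * (t / lam ^ n)\<^sup>2)"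
      using p_pos by (intro mult_left_mono) simp_all
    also have "\<dots> = M * t\<^sup>2 * (apar / lam\<^sup>2) ^ n"
    proof -
      have "(lam\<^sup>2) ^ n = (lam ^ n)\<^sup>2" by (simp only: power_mult[symmetric] mult.commute)
      then show ?thesis unfolding power_divide by simp
    qed
    finally show "\<bar>apar ^ n * remainder j (t / lam ^ n)\<bar> \<le> M * t\<^sup>2 * (apar / lam\<^sup>2) ^ n"
      using p_pos by (simp add: abs_mult)
  qed
qed

lemma summable_down: assumes "0 \<le> t" shows "summable (\<lambda>n. apar ^ Suc n * remainder j (t / lam ^ Suc n))"
proof -
  obtain M where "0 \<le> M" and M: "\<And>t n. 0 \<le> t \<Longrightarrow>
    \<bar>apar ^ n * remainder j (t / lam ^ n)\<bar> \<le> M * t\<^sup>2 * (apar / lam\<^sup>2) ^ n"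
    by (rule remainder_down_bound[of j]) (rule that)
  show ?thesis
    by (rule summable_comparison_test'[OF summable_apar_lam[of "M * t\<^sup>2"]])
      (unfold real_norm_def, rule M[OF assms])
qed

text \<open>What is left of \<open>gsum\<close> at z = phi(t) after subtracting
  \<open>periodic_part\<close>: in phi(lam^n t)^j = 1 - j lam^n t + \<open>remainder\<close>, the
  first two terms sum to the two constants below (with t = koenigs z), and the negative-index half
  of \<open>periodic_part\<close>, absent from \<open>gsum\<close>, is taken off again as
  \<open>resid\<close>.\<close>

definition analytic_part :: "nat \<Rightarrow> complex \<Rightarrow> complex" where
  "analytic_part j z = of_real (\<Sum>n. (1 / apar) ^ n)
     - of_real (\<Sum>n. real j * (lam / apar) ^ n) * koenigs z - resid j z"

lemma holomorphic_analytic_part: "analytic_part j holomorphic_on slit"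
  unfolding analytic_part_def[abs_def]
  by (intro holomorphic_on_diff holomorphic_on_mult holomorphic_on_const holomorphic_koenigs holomorphic_resid)

lemma F_pow_phi: "0 \<le> t \<Longrightarrow> (F p ^^ n) (complex_of_real (phi t)) = of_real (phi (lam ^ n * t))"
proof -
  assume t: "0 \<le> t"
  have "(F p ^^ n) (complex_of_real x) = of_real ((F p ^^ n) x)" for x :: real
    by (induction n) (simp_all only: funpow.simps id_apply o_apply F_of_real)
  then show ?thesis by (simp only: phi_lam_pow[OF t])
qed

lemma phi_basin: "0 < t \<Longrightarrow> of_real (phi t) \<in> basin"
  using phi_less_1[of t] phi_nonneg[of t] by (intro basin_shift[of 0]) simp

lemma resid_phi: assumes "0 \<le> t"
  shows "resid j (of_real (phi t)) = of_real (\<Sum>n. apar ^ Suc n * remainder j (t / lam ^ Suc n))"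
proof -
  have "of_real apar ^ Suc n * ((G ^^ Suc n) (of_real (phi t)) ^ j - 1
      + of_nat j * (koenigs (of_real (phi t)) / of_real lam ^ Suc n))
      = complex_of_real (apar ^ Suc n * remainder j (t / lam ^ Suc n))" for n
    unfolding G_pow_phi[OF assms] koenigs_phi[OF assms] remainder_def by simp
  then have "resid j (of_real (phi t)) = (\<Sum>n. complex_of_real (apar ^ Suc n * remainder j (t / lam ^ Suc n)))"
    unfolding resid_def by (simp only:)
  also have "\<dots> = of_real (\<Sum>n. apar ^ Suc n * remainder j (t / lam ^ Suc n))"
    by (rule suminf_of_real[symmetric, OF summable_down[OF assms]])
  finally show ?thesis .
qed

lemma real_gsum_phi: assumes "0 < t"
  shows "(\<lambda>n. phi (lam ^ n * t) ^ j / apar ^ n) sums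
    ((\<Sum>n. remainder j (lam ^ n * t) / apar ^ n) + (\<Sum>n. (1 / apar) ^ n)
      - (\<Sum>n. real j * (lam / apar) ^ n) * t)"
proof -
  have "(\<lambda>n. remainder j (lam ^ n * t) / apar ^ n + (1 / apar) ^ n - real j * (lam / apar) ^ n * t) sums
      ((\<Sum>n. remainder j (lam ^ n * t) / apar ^ n) + (\<Sum>n. (1 / apar) ^ n)
      - (\<Sum>n. real j * (lam / apar) ^ n) * t)"
    using assms
    by (intro sums_add sums_diff sums_mult2 summable_sums summable_up summable_inv_apar summable_linear) simp
  moreover have "remainder j (lam ^ n * t) / apar ^ n + (1 / apar) ^ n - real j * (lam / apar) ^ n * t
      = phi (lam ^ n * t) ^ j / apar ^ n" for n
  proof -
    have "(P - 1 + real j * (X * t)) / A + 1 / A - real j * (X / A) * t = P / A" for P X A :: real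
      by (simp add: add_divide_distrib diff_divide_distrib)
    then show ?thesis unfolding remainder_def power_divide power_one .
  qed
  ultimately show ?thesis by (simp only:)
qed

lemma gsum_phi: assumes "0 < t"
  shows "gsum j (of_real (phi t)) = of_real (periodic_part j t) + analytic_part j (of_real (phi t))"
proof -
  have "gsum j (of_real (phi t)) = (\<Sum>n. complex_of_real (phi (lam ^ n * t) ^ j / apar ^ n))"
    unfolding gsum_def using assms by (simp add: F_pow_phi)
  also have "\<dots> = of_real (\<Sum>n. phi (lam ^ n * t) ^ j / apar ^ n)"
    by (rule suminf_of_real[symmetric, OF sums_summable[OF real_gsum_phi[OF assms]]])
  also have "\<dots> = of_real ((\<Sum>n. remainder j (lam ^ n * t) / apar ^ n) + (\<Sum>n. (1 / apar) ^ n)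
      - (\<Sum>n. real j * (lam / apar) ^ n) * t)"
    by (simp only: sums_unique[OF real_gsum_phi[OF assms]])
  finally show ?thesis
    using assms
    by (simp add: analytic_part_def resid_phi koenigs_phi periodic_part_def del: power_Suc)
qed

lemma periodic_part_lam: assumes "0 \<le> t" shows "periodic_part j (lam * t) = apar * periodic_part j t"
proof -
  define u where "u n = remainder j (lam ^ n * t) / apar ^ n" for n
  define d where "d n = apar ^ n * remainder j (t / lam ^ n)" for n
  have su: "summable u" unfolding u_def by (rule summable_up[OF assms])
  have sd: "summable (\<lambda>n. d (Suc n))" unfolding d_def by (rule summable_down[OF assms])
  have up: "remainder j (lam ^ n * (lam * t)) / apar ^ n = apar * u (Suc n)" for n
  proof -
    have "lam ^ n * (lam * t) = lam ^ Suc n * t" by simp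
    then show ?thesis unfolding u_def using p_pos by (simp only: power_Suc) simp
  qed
  have down: "apar ^ Suc n * remainder j (lam * t / lam ^ Suc n) = apar * d n" for n
    using p_pos by (simp add: d_def)
  have "periodic_part j (lam * t) = (\<Sum>n. apar * u (Suc n)) + (\<Sum>n. apar * d n)"
    unfolding periodic_part_def up down ..
  also have "(\<Sum>n. apar * u (Suc n)) = apar * ((\<Sum>n. u n) - u 0)"
    using suminf_split_head[OF su] su by (subst suminf_mult) (simp_all only: summable_Suc_iff)
  also have "(\<Sum>n. apar * d n) = apar * (d 0 + (\<Sum>n. d (Suc n)))"
  proof -
    have "summable d" using sd by (simp only: summable_Suc_iff)
    then show ?thesis using suminf_split_head[of d] by (simp add: suminf_mult)
  qed
  also have "d 0 = u 0" by (simp add: d_def u_def)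
  also have "apar * ((\<Sum>n. u n) - u 0) + apar * (u 0 + (\<Sum>n. d (Suc n)))
      = apar * ((\<Sum>n. u n) + (\<Sum>n. d (Suc n)))"
  proof -
    have "a * (x - y) + a * (y + z) = a * (x + z)" for a x y z :: real
      by (simp add: algebra_simps)
    then show ?thesis .
  qed
  finally show ?thesis unfolding periodic_part_def u_def d_def .
qed

end

section \<open>Analytic continuation to the critical line and the contradiction at its apex\<close>

context splitting_laplace
begin

text \<open>The points where the principal branch \<open>kpow\<close> of a real power of
  \<open>koenigs\<close> is holomorphic. It contains all phi(t) with t > 0 and the open upper half
  plane.\<close>

definition kdom :: "complex set" where
  "kdom = {z \<in> slit. koenigs z \<in> slit}"

definition kpow :: "real \<Rightarrow> complex \<Rightarrow> complex" where
  "kpow r z = exp (of_real r * Ln (koenigs z))"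

lemma open_kdom: "open kdom"
proof -
  have "open (slit \<inter> koenigs -` slit)"
    by (intro continuous_open_preimage open_slit holomorphic_on_imp_continuous_on holomorphic_koenigs)
  also have "slit \<inter> koenigs -` slit = kdom" unfolding kdom_def by blast
  finally show ?thesis .
qed

lemma kdom_subset: "kdom \<subseteq> slit"
  unfolding kdom_def by blast

lemma holomorphic_kpow: "kpow r holomorphic_on kdom"
proof -
  have "koenigs holomorphic_on kdom"
    using holomorphic_koenigs kdom_subset by (rule holomorphic_on_subset)
  moreover have "koenigs z \<notin> \<real>\<^sub>\<le>\<^sub>0" if "z \<in> kdom" for z
    using that unfolding kdom_def by blast
  ultimately show ?thesis
    unfolding kpow_def[abs_def]
    by (intro holomorphic_on_exp' holomorphic_on_mult holomorphic_on_const holomorphic_on_Ln')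
qed

lemma phi_kdom: "0 < t \<Longrightarrow> of_real (phi t) \<in> kdom"
  using phi_slit[of t] by (simp add: kdom_def koenigs_phi)

lemma kpow_phi: "0 < t \<Longrightarrow> kpow r (of_real (phi t)) = of_real (t powr r)"
  by (simp add: kpow_def koenigs_phi powr_def Ln_of_real exp_of_real[symmetric] del: exp_of_real)

lemma upper_kdom: assumes "0 < Im z" shows "z \<in> kdom"
  using assms koenigs_Im_neg[OF assms] by (auto simp: kdom_def complex_nonpos_Reals_iff)

text \<open>The critical point of F, that is F'(\<open>crit\<close>) = 0. F folds the vertical line
  through it onto a real ray (\<open>F_Complex_crit\<close>).\<close>

definition crit :: real where "crit = - (1 - p) / (2 * p)"
text \<open>The height at which F(\<open>crit\<close> + i v) reaches -1/p, the second preimage of 1;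
  see \<open>F_crit_apex\<close> with v = \<open>apex\<close>.\<close>

definition apex :: real where "apex = sqrt (4 - (1 - p)\<^sup>2) / (2 * p)"

lemma crit_bounds: "- 1 / p < crit" "crit < 0"
  using p_pos p_less_1 by (auto simp: crit_def field_simps)

lemma F_Complex_crit: "F p (Complex crit v) = of_real (F p crit - p * v\<^sup>2)"
proof (rule complex_eqI)
  show "Re (F p (Complex crit v)) = Re (of_real (F p crit - p * v\<^sup>2))"
    by (simp add: F_def power2_eq_square algebra_simps)
  show "Im (F p (Complex crit v)) = Im (of_real (F p crit - p * v\<^sup>2))"
    using p_pos by (simp add: Im_F crit_def)
qed

lemma apex_pos: "0 < apex"
proof -
  have "(1 - p)\<^sup>2 \<le> 1" using p_pos p_less_1 by (simp add: power_le_one)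
  then show ?thesis using p_pos by (simp add: apex_def)
qed

lemma F_crit_apex: "F p crit - p * v\<^sup>2 = - 1 / p + p * (apex\<^sup>2 - v\<^sup>2)"
proof -
  have "(1 - p)\<^sup>2 \<le> 1" using p_pos p_less_1 by (simp add: power_le_one)
  then have "apex\<^sup>2 = (4 - (1 - p)\<^sup>2) / (2 * p)\<^sup>2"
    by (simp add: apex_def power_divide)
  then have "p * apex\<^sup>2 = (4 - (1 - p)\<^sup>2) / (4 * p)"
    using p_pos by (simp add: power2_eq_square)
  moreover have "F p crit = - ((1 - p)\<^sup>2) / (4 * p)"
    using p_pos by (simp add: F_real crit_def field_simps power2_eq_square)
  moreover have "- Q / (4 * p) = - 1 / p + (4 - Q) / (4 * p)" for Q
    using p_pos by (simp add: field_simps)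
  ultimately have "F p crit = - 1 / p + p * apex\<^sup>2" by (simp only:)
  then show ?thesis by (simp add: right_diff_distrib)
qed

text \<open>One step of F moves the segment into the real interval (-1/p, 1), which lies in the
  basin.\<close>

lemma crit_segment_basin: assumes "0 \<le> v" "v < apex" shows "Complex crit v \<in> basin"
proof (rule basin_F)
  have "v\<^sup>2 < apex\<^sup>2" using assms by (intro power_strict_mono) simp_all
  then have "0 < p * (apex\<^sup>2 - v\<^sup>2)" using p_pos by simp
  then have 1: "- 1 / p < F p crit - p * v\<^sup>2" using F_crit_apex[of v] by linarith
  have "F p crit \<le> 0"
  proof -
    have "0 \<le> 1 - p + p * crit" using p_pos p_less_1 by (simp add: crit_def field_simps)
    then show ?thesis using crit_bounds by (simp add: F_real mult_nonpos_nonneg)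
  qed
  moreover have "0 \<le> p * v\<^sup>2" using p_pos by simp
  ultimately have "F p crit - p * v\<^sup>2 < 1" by linarith
  with 1 show "F p (Complex crit v) \<in> basin"
    unfolding F_Complex_crit by (rule of_real_basin)
qed

text \<open>Under the pure power assumption both sides agree at all phi(t). The identity theorem
  carries this to the critical line through a connected open set inside the basin. The negative
  reals are outside \<open>kdom\<close>, so the set leaves the real axis near phi(1) and runs just
  above it.\<close>

lemma identity_on_crit_line:
  assumes h: "\<And>t. 0 < t \<Longrightarrow> periodic_part j t = C * t powr r"
    and v: "0 < v" "v < apex"
  shows "gsum j (Complex crit v) = of_real C * kpow r (Complex crit v) + analytic_part j (Complex crit v)"
proof -
  define f where "f z = gsum j z - (of_real C * kpow r z + analytic_part j z)" for z
  have hol: "f holomorphic_on basin \<inter> kdom"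
  proof -
    have "gsum j holomorphic_on basin \<inter> kdom"
      by (rule holomorphic_on_subset[OF holomorphic_gsum]) blast
    moreover have "kpow r holomorphic_on basin \<inter> kdom"
      by (rule holomorphic_on_subset[OF holomorphic_kpow]) blast
    moreover have "analytic_part j holomorphic_on basin \<inter> kdom"
      by (rule holomorphic_on_subset[OF holomorphic_analytic_part]) (use kdom_subset in blast)
    ultimately show ?thesis
      unfolding f_def[abs_def]
      by (intro holomorphic_on_diff holomorphic_on_add holomorphic_on_mult holomorphic_on_const)
  qed
  have f_phi: "f (of_real (phi t)) = 0" if "0 < t" for t
    using gsum_phi[OF that, of j] h[OF that] kpow_phi[OF that, of r] by (simp add: f_def)
  define x where "x = phi 1"
  have x: "0 < x" "x < 1" unfolding x_def by (rule phi_pos, simp) (rule phi_less_1, simp)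
  have "of_real x \<in> basin \<inter> kdom"
    unfolding x_def using phi_basin[of 1] phi_kdom[of 1] by simp
  moreover have "open (basin \<inter> kdom)" using open_basin open_kdom by (rule open_Int)
  ultimately obtain e where e: "0 < e" "ball (of_real x) e \<subseteq> basin \<inter> kdom"
    using open_contains_ball_eq by blast
  \<comment> \<open>A height strictly between v and \<open>apex\<close>, so that v is interior to
    the vertical strip.\<close>
  define v1 where "v1 = (v + apex) / 2"
  have v1: "v < v1" "v1 < apex" "0 < v1" using v by (auto simp: v1_def)
  \<comment> \<open>An L-shaped compact set in the basin: along the real axis from phi(1) to
    \<open>crit\<close>, then up. Its distance d to the complement of the basin is the width
    available for the rectangles below.\<close>
  define S where "S = complex_of_real ` {crit..x} \<union> Complex crit ` {0..v1}"
  have "continuous_on {0..v1} (Complex crit)"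
    by (simp add: Complex_eq continuous_intros)
  then have "compact S"
    unfolding S_def
    by (intro compact_Un compact_continuous_image compact_Icc continuous_on_of_real continuous_on_id)
  moreover have "S \<subseteq> basin"
  proof -
    have "of_real y \<in> basin" if "y \<in> {crit..x}" for y
      using that crit_bounds x by (intro of_real_basin) simp_all
    moreover have "Complex crit y \<in> basin" if "y \<in> {0..v1}" for y
      using that v1 by (intro crit_segment_basin) simp_all
    ultimately show ?thesis unfolding S_def by blast
  qed
  ultimately obtain d where d: "0 < d" "(\<Union>y\<in>S. ball y d) \<subseteq> basin"
    using compact_subset_open_imp_ball_epsilon_subset[OF _ open_basin] by blast
  \<comment> \<open>\<open>R1\<close> is a thin box just above the horizontal leg and
    \<open>R2\<close> a box around the vertical leg. Both lie in the upper half plane, hence in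
    \<open>kdom\<close>; together with the ball at phi(1) they form a connected set.\<close>
  define R1 where "R1 = box (Complex crit 0) (Complex x d)"
  define R2 where "R2 = box (Complex (crit - d) 0) (Complex (crit + d) v1)"
  define O' where "O' = ball (of_real x) e \<union> (R1 \<union> R2)"
  have cx: "crit < x" using crit_bounds x by linarith
  have R1: "R1 \<subseteq> basin \<inter> kdom"
  proof
    fix z assume "z \<in> R1"
    then have z: "crit < Re z" "Re z < x" "0 < Im z" "Im z < d"
      by (auto simp: R1_def in_box_complex_iff)
    have "of_real (Re z) \<in> S" using z by (auto simp: S_def)
    moreover have "dist (of_real (Re z)) z < d"
    proof -
      have "dist (of_real (Re z)) z = \<bar>Im z\<bar>" by (simp add: dist_complex_def cmod_def)
      then show ?thesis using z by simp
    qed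
    ultimately have "z \<in> (\<Union>y\<in>S. ball y d)" unfolding mem_ball[symmetric] by (rule UN_I)
    with d(2) have "z \<in> basin" by (rule subsetD)
    then show "z \<in> basin \<inter> kdom" using upper_kdom[OF z(3)] by blast
  qed
  have R2: "R2 \<subseteq> basin \<inter> kdom"
  proof
    fix z assume "z \<in> R2"
    then have z: "crit - d < Re z" "Re z < crit + d" "0 < Im z" "Im z < v1"
      by (auto simp: R2_def in_box_complex_iff)
    have "Complex crit (Im z) \<in> S" using z by (auto simp: S_def)
    moreover have "dist (Complex crit (Im z)) z < d"
    proof -
      have "dist (Complex crit (Im z)) z = \<bar>crit - Re z\<bar>" by (simp add: dist_complex_def cmod_def)
      then show ?thesis using z by simp
    qed
    ultimately have "z \<in> (\<Union>y\<in>S. ball y d)" unfolding mem_ball[symmetric] by (rule UN_I)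
    with d(2) have "z \<in> basin" by (rule subsetD)
    then show "z \<in> basin \<inter> kdom" using upper_kdom[OF z(3)] by blast
  qed
  have O_sub: "O' \<subseteq> basin \<inter> kdom" using R1 R2 e(2) unfolding O'_def by blast
  have "open O'" unfolding O'_def R1_def R2_def by (intro open_Un open_ball open_box)
  have "connected O'"
    unfolding O'_def
  proof (intro connected_Un)
    show "connected (ball (complex_of_real x) e)" by (rule connected_ball)
    show "connected R1" "connected R2" unfolding R1_def R2_def by (simp_all add: convex_connected convex_box)
    have "0 < min d (min (x - crit) v1)" using d(1) cx v1 by simp
    from dense[OF this] obtain m where m: "0 < m" "m < d" "m < x - crit" "m < v1" by auto
    have "Complex (crit + m) m \<in> R1 \<inter> R2" using m by (simp add: R1_def R2_def in_box_complex_iff)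
    then show "R1 \<inter> R2 \<noteq> {}" by blast
    have "0 < min (e / 2) (min (x - crit) d)" using d(1) cx e(1) by simp
    from dense[OF this] obtain k where k: "0 < k" "k < e / 2" "k < x - crit" "k < d" by auto
    have "dist (of_real x) (Complex (x - k) k) \<le> \<bar>Re (of_real x - Complex (x - k) k)\<bar> + \<bar>Im (of_real x - Complex (x - k) k)\<bar>"
      unfolding dist_complex_def by (rule cmod_le)
    also have "\<dots> = 2 * k" using k by simp
    also have "\<dots> < e" using k e(1) by simp
    finally have "Complex (x - k) k \<in> ball (of_real x) e \<inter> (R1 \<union> R2)"
      using k by (simp add: R1_def in_box_complex_iff)
    then show "ball (complex_of_real x) e \<inter> (R1 \<union> R2) \<noteq> {}" by blast
  qed
  define U where "U = {z \<in> O'. \<exists>t>0. z = of_real (phi t)}"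
  have xO: "of_real x \<in> O'" using e(1) by (simp add: O'_def)
  \<comment> \<open>The points phi(1 + 1/(n+1)) tend to phi(1) and differ from it by injectivity of
    phi.\<close>
  have lim: "of_real x islimpt U"
  proof (rule islimptI)
    fix T :: "complex set" assume T: "of_real x \<in> T" "open T"
    have "(\<lambda>n. 1 + inverse (real (Suc n))) \<longlonglongrightarrow> 1 + 0"
      by (intro tendsto_add tendsto_const LIMSEQ_inverse_real_of_nat)
    moreover have "continuous (at 1 within {0..}) phi"
      using phi_cont by (simp add: continuous_on_eq_continuous_within)
    ultimately have "(\<lambda>n. phi (1 + inverse (real (Suc n)))) \<longlonglongrightarrow> phi 1"
      by (intro continuous_within_tendsto_compose'[of 1 "{0..}" phi]) simp_all
    then have "(\<lambda>n. complex_of_real (phi (1 + inverse (real (Suc n))))) \<longlonglongrightarrow> of_real x"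
      unfolding x_def by (rule tendsto_of_real)
    then have "eventually (\<lambda>n. complex_of_real (phi (1 + inverse (real (Suc n)))) \<in> T \<inter> O') sequentially"
      using T xO \<open>open O'\<close> by (intro topological_tendstoD open_Int) simp_all
    then obtain n where n: "complex_of_real (phi (1 + inverse (real (Suc n)))) \<in> T \<inter> O'"
      using eventually_happens'[OF sequentially_bot] by blast
    define t where "t = 1 + inverse (real (Suc n))"
    have t: "1 < t" by (simp add: t_def)
    then have "phi t \<noteq> phi 1" using phi_inj[of t 1] by linarith
    then have "complex_of_real (phi t) \<noteq> of_real x" by (simp add: x_def)
    moreover have "of_real (phi t) \<in> U" using n t unfolding U_def t_def[symmetric] by (intro CollectI conjI exI[of _ t]) simp_all
    moreover have "of_real (phi t) \<in> T" using n unfolding t_def[symmetric] by simp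
    ultimately show "\<exists>y\<in>U. y \<in> T \<and> y \<noteq> of_real x" by blast
  qed
  have "f (Complex crit v) = 0"
  proof (rule analytic_continuation[of f O' U "of_real x"])
    show "f holomorphic_on O'" using hol O_sub by (rule holomorphic_on_subset)
    show "Complex crit v \<in> O'" using v v1 d(1) by (simp add: O'_def R2_def in_box_complex_iff)
    show "U \<subseteq> O'" unfolding U_def by blast
    fix z assume "z \<in> U"
    then show "f z = 0" unfolding U_def using f_phi by blast
  qed (fact \<open>open O'\<close> \<open>connected O'\<close> xO lim)+
  then show ?thesis by (simp add: f_def)
qed

lemma gsum_F_twice:
  assumes "F p (F p z) \<in> basin"
  shows "gsum j z = z ^ j + F p z ^ j / of_real apar + gsum j (F p (F p z)) / (of_real apar)\<^sup>2"
  using gsum_F[OF assms, of j] gsum_F[OF basin_F[OF assms], of j]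
  by (simp add: add_divide_distrib power2_eq_square)

lemma F_sub_apex: "F p (F p (Complex crit (apex - s))) = of_real (F p (- 1 / p + p * (s * (2 * apex - s))))"
proof -
  have "apex\<^sup>2 - (apex - s)\<^sup>2 = s * (2 * apex - s)"
    by (simp add: power2_eq_square algebra_simps)
  then have "F p (Complex crit (apex - s)) = of_real (- 1 / p + p * (s * (2 * apex - s)))"
    unfolding F_Complex_crit F_crit_apex by (simp only:)
  then show ?thesis by (simp only: F_of_real)
qed

lemma phi_below_1:
  assumes "0 < t1" "phi t1 < r" "r < 1"
  obtains t where "0 < t" "t < t1" "phi t = r"
proof -
  have "continuous_on {0..t1} phi" using phi_cont by (rule continuous_on_subset) auto
  then obtain t where t: "0 \<le> t" "t \<le> t1" "phi t = r"
    using IVT2'[of phi t1 r 0] assms by auto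
  with assms have "t \<noteq> 0" "t \<noteq> t1" by auto
  with t show ?thesis by (intro that) simp_all
qed

text \<open>Two descriptions of \<open>gsum\<close> meet at y0 = \<open>crit\<close> + i
  \<open>apex\<close>. The continued identity is holomorphic there, whereas applying the functional
  equation of \<open>gsum\<close> twice moves the argument to F(F(z)) near 1, where
  \<open>gsum\<close> contains the singular term C t^r. Their comparison exhibits C t^r / a^2 as a
  function holomorphic at y0.\<close>

theorem periodic_part_not_pure_power:
  assumes h: "\<And>t. 0 < t \<Longrightarrow> periodic_part j t = C * t powr r" and r: "1 < r" "r < 2"
  shows "C = 0"
proof (rule ccontr)
  assume C: "C \<noteq> 0"
  define y0 where "y0 = Complex crit apex"
  \<comment> \<open>All terms of the comparison other than C t^r / a^2: holomorphic around y0, since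
    y0 lies in \<open>kdom\<close> and F(F(y0)) = 1 lies in the slit plane.\<close>
  define f where "f z = of_real C * kpow r z + analytic_part j z - z ^ j - F p z ^ j / of_real apar
      - analytic_part j (F p (F p z)) / (of_real apar)\<^sup>2" for z
  have y0: "y0 \<in> kdom" using apex_pos by (intro upper_kdom) (simp add: y0_def)
  have F2y0: "F p (F p y0) = 1"
  proof -
    have "F p (- 1 / p) = 1" using p_pos by (simp add: F_real)
    then show ?thesis using F_sub_apex[of 0] by (simp add: y0_def)
  qed
  define A where "A = kdom \<inter> (\<lambda>z. F p (F p z)) -` slit"
  have FF: "(\<lambda>z :: complex. F p (F p z)) = F p ^^ 2" by (simp add: numeral_2_eq_2 fun_eq_iff)
  have "open A"
    unfolding A_def FF by (intro continuous_open_preimage continuous_on_F_pow open_kdom open_slit)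
  moreover have "y0 \<in> A" using y0 F2y0 by (simp add: A_def)
  ultimately obtain e where e: "0 < e" "ball y0 e \<subseteq> A"
    using open_contains_ball_eq by blast
  have hol: "f holomorphic_on ball y0 e"
  proof -
    have F1: "F p holomorphic_on ball y0 e" using holomorphic_F_pow[of 1] by simp
    have F2: "(\<lambda>z. F p (F p z)) holomorphic_on ball y0 e" unfolding FF by (rule holomorphic_F_pow)
    have "analytic_part j \<circ> (\<lambda>z. F p (F p z)) holomorphic_on ball y0 e"
      using e(2) unfolding A_def
      by (intro holomorphic_on_compose_gen[OF F2 holomorphic_analytic_part]) blast
    moreover have "analytic_part j holomorphic_on ball y0 e"
      using holomorphic_analytic_part by (rule holomorphic_on_subset) (use e(2) kdom_subset A_def in blast)
    moreover have "kpow r holomorphic_on ball y0 e"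
      using holomorphic_kpow by (rule holomorphic_on_subset) (use e(2) A_def in blast)
    ultimately show ?thesis
      unfolding f_def[abs_def] o_def using F1 apar_nonzero
      by (intro holomorphic_on_diff holomorphic_on_add holomorphic_on_mult holomorphic_on_power
          holomorphic_on_divide holomorphic_on_const holomorphic_on_ident) simp_all
  qed
  \<comment> \<open>Below t1 one has K t <= 1/2, so 1 - phi(t) is comparable to t within a factor
    2.\<close>
  define t1 where "t1 = 1 / (2 * K + 1)"
  have t1: "0 < t1" "K * t1 \<le> 1 / 2" "t1 \<le> 1"
    using K_nonneg by (auto simp: t1_def field_simps)
  \<comment> \<open>The real value of F(F(z)) at distance s below the apex. It tends to 1 linearly:
    1 - R(s) = s g(s) with g(s) tending to L > 0.\<close>
  define R where "R s = F p (- 1 / p + p * (s * (2 * apex - s)))" for s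
  have R_eq: "1 - R s = s * ((2 * apex - s) * (p\<^sup>2 * (1 + 1 / p - p * (s * (2 * apex - s)))))" for s
  proof -
    have "1 - R s = (1 - (- 1 / p + p * (s * (2 * apex - s)))) * (1 + p * (- 1 / p + p * (s * (2 * apex - s))))"
      unfolding R_def one_minus_F by simp
    also have "1 + p * (- 1 / p + p * (s * (2 * apex - s))) = p\<^sup>2 * (s * (2 * apex - s))"
    proof -
      have "1 + p * (- 1 / p + p * X) = p\<^sup>2 * X" for X
        using p_pos by (simp add: field_simps power2_eq_square)
      then show ?thesis .
    qed
    finally show ?thesis by (simp add: mult_ac)
  qed
  define g where "g s = (2 * apex - s) * (p\<^sup>2 * (1 + 1 / p - p * (s * (2 * apex - s))))" for s
  have g: "(g \<longlongrightarrow> 2 * apex * (p\<^sup>2 * (1 + 1 / p))) (at_right 0)"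
    unfolding g_def[abs_def] by (auto intro!: tendsto_eq_intros)
  define L where "L = 2 * apex * (p\<^sup>2 * (1 + 1 / p))"
  have L: "0 < L" using apex_pos p_pos by (simp add: L_def add_pos_pos)
  have R_lim: "(R \<longlongrightarrow> 1 - 0 * L) (at_right 0)"
  proof -
    have "((\<lambda>s. 1 - s * g s) \<longlongrightarrow> 1 - 0 * L) (at_right 0)"
      using g unfolding L_def by (intro tendsto_diff tendsto_const tendsto_mult tendsto_ident_at)
    moreover have "R = (\<lambda>s. 1 - s * g s)"
    proof
      fix s show "R s = 1 - s * g s" using R_eq[of s] unfolding g_def by linarith
    qed
    ultimately show ?thesis by (simp only:)
  qed
  have "\<forall>\<^sub>F s in at_right 0. L / 2 < g s \<and> g s < 2 * L \<and> phi t1 < R s \<and> s < apex \<and> 0 < s"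
  proof (intro eventually_conj)
    show "\<forall>\<^sub>F s in at_right 0. L / 2 < g s"
      using L by (intro order_tendstoD(1)[OF g[folded L_def]]) simp
    show "\<forall>\<^sub>F s in at_right 0. g s < 2 * L"
      using L by (intro order_tendstoD(2)[OF g[folded L_def]]) simp
    show "\<forall>\<^sub>F s in at_right 0. phi t1 < R s"
      using R_lim phi_less_1[OF t1(1)] by (intro order_tendstoD(1)[OF R_lim]) simp
    show "\<forall>\<^sub>F s in at_right 0. s < apex" "\<forall>\<^sub>F s in at_right (0::real). 0 < s"
      using eventually_at_right_real[OF apex_pos] eventually_at_right_less[of "0 :: real"]
      by (auto elim: eventually_mono)
  qed
  then obtain d where d: "0 < d"
    "\<And>s. 0 < s \<Longrightarrow> s < d \<Longrightarrow> L / 2 < g s \<and> g s < 2 * L \<and> phi t1 < R s \<and> s < apex"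
    unfolding eventually_at_right[OF zero_less_one] by auto
  define c where "c = \<bar>C\<bar> / apar\<^sup>2"
  have c: "0 < c" using C p_pos by (simp add: c_def)
  have main: "\<exists>t>0. s * (L / 4) \<le> t \<and> t \<le> s * (4 * L) \<and>
      norm (f (y0 - \<i> * of_real s)) = c * t powr r" if s: "0 < s" "s < d" for s
  proof -
    have gs: "L / 2 < g s" "g s < 2 * L" "phi t1 < R s" "s < apex" using d(2)[OF s] by auto
    have R1: "1 - R s = s * g s" using R_eq[of s] by (simp only: g_def)
    have "0 < s * g s" using s gs L by simp
    then have "R s < 1" using R1 by linarith
    \<comment> \<open>R(s) lies between phi(t1) and 1, so it is a value phi(t); together with the
      linear behaviour of R this t is comparable to s.\<close>
    then obtain t where t: "0 < t" "t < t1" "phi t = R s"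
      using phi_below_1[OF t1(1) gs(3)] by blast
    have "K * t\<^sup>2 \<le> t / 2"
    proof -
      have "K * t \<le> K * t1" using t K_nonneg by (intro mult_left_mono) simp_all
      then have "K * t * t \<le> 1 / 2 * t" using t t1 by (intro mult_right_mono) simp_all
      then show ?thesis by (simp add: power2_eq_square)
    qed
    moreover have "\<bar>R s - 1 + t\<bar> \<le> K * t\<^sup>2" using phi_approx[of t] t by simp
    ultimately have "t \<le> 2 * (s * g s)" "s * g s \<le> 2 * t" using R1 t(1) by linarith+
    moreover have "s * (L / 2) \<le> s * g s" "s * g s \<le> s * (2 * L)"
      using s gs by (simp_all add: mult_left_mono)
    ultimately have tb: "s * (L / 4) \<le> t" "t \<le> s * (4 * L)" by (simp_all add: field_simps)
    define z where "z = Complex crit (apex - s)"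
    have z: "y0 - \<i> * of_real s = z" by (simp add: y0_def z_def complex_eq_iff)
    have FFz: "F p (F p z) = of_real (phi t)"
      unfolding z_def F_sub_apex t(3) R_def ..
    have 1: "gsum j z = of_real C * kpow r z + analytic_part j z"
      unfolding z_def using s gs by (intro identity_on_crit_line h) simp_all
    have 2: "gsum j z = z ^ j + F p z ^ j / of_real apar + gsum j (F p (F p z)) / (of_real apar)\<^sup>2"
      using phi_basin[OF t(1)] by (intro gsum_F_twice) (simp only: FFz)
    have 3: "gsum j (F p (F p z)) = of_real (C * t powr r) + analytic_part j (F p (F p z))"
      unfolding FFz by (simp only: gsum_phi[OF t(1)] h[OF t(1)])
    have "\<zeta> - a - b - v / q = u / q" if "\<zeta> = a + b + (u + v) / q" for \<zeta> a b u v q :: complex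
      using that by (simp add: add_divide_distrib)
    from this[OF 2[unfolded 1 3]] have "f z = of_real (C * t powr r) / (of_real apar)\<^sup>2"
      unfolding f_def .
    then have "norm (f z) = c * t powr r"
      using p_pos by (simp add: norm_divide norm_mult norm_power c_def del: of_real_add of_real_mult)
        (simp add: abs_mult)
    with t tb show ?thesis unfolding z by blast
  qed
  show False
  proof (rule holomorphic_no_fractional_order[OF hol e(1) r _ d(1)])
    show "0 < c * (L / 4) powr r" using c L by simp
    fix s assume s: "0 < s" "s < d"
    obtain t where t: "0 < t" "s * (L / 4) \<le> t" "t \<le> s * (4 * L)"
      "norm (f (y0 - \<i> * of_real s)) = c * t powr r"
      using main[OF s] by blast
    have "(s * (L / 4)) powr r \<le> t powr r"
      using t s L r by (intro powr_mono2) simp_all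
    moreover have "t powr r \<le> (s * (4 * L)) powr r"
      using t s L r by (intro powr_mono2) simp_all
    moreover have "(s * (L / 4)) powr r = (L / 4) powr r * s powr r"
      "(s * (4 * L)) powr r = (4 * L) powr r * s powr r"
      using s L by (subst powr_mult; simp)+
    ultimately have "(L / 4) powr r * s powr r \<le> t powr r" "t powr r \<le> (4 * L) powr r * s powr r"
      by (simp_all only:)
    then show "c * (L / 4) powr r * s powr r \<le> norm (f (y0 - \<i> * of_real s))"
      "norm (f (y0 - \<i> * of_real s)) \<le> c * (4 * L) powr r * s powr r"
      using c unfolding t(4) mult.assoc by (simp_all only: mult_le_cancel_left_pos)
  qed
qed

end

section \<open>The probability space and conditioning on a generation\<close>

context splitting
begin

abbreviation "M \<equiv> gw_space p"

lemma prob_space_M: "prob_space M"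
  unfolding gw_space_def by (intro prob_space_PiM measure_pmf.prob_space_axioms)

sublocale P: prob_space M
  by (rule prob_space_M)

lemma measurable_coord [measurable]: "(\<lambda>\<omega>. \<omega> c) \<in> M \<rightarrow>\<^sub>M count_space UNIV"
proof -
  have "(\<lambda>\<omega>. \<omega> c) \<in> M \<rightarrow>\<^sub>M measure_pmf (offspring p)"
    unfolding gw_space_def by (rule measurable_component_singleton) simp
  then show ?thesis by simp
qed

lemma distr_coord: "distr M (measure_pmf (offspring p)) (\<lambda>\<omega>. \<omega> c) = measure_pmf (offspring p)"
  unfolding gw_space_def
  by (rule distr_PiM_component) (simp_all add: measure_pmf.prob_space_axioms)

lemma indep_coord: "P.indep_vars (\<lambda>_. measure_pmf (offspring p)) (\<lambda>c \<omega>. \<omega> c) UNIV"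
proof -
  have "distr M (Pi\<^sub>M UNIV (\<lambda>_. measure_pmf (offspring p))) (\<lambda>x. \<lambda>i\<in>UNIV. x i)
      = Pi\<^sub>M UNIV (\<lambda>i. distr M (measure_pmf (offspring p)) (\<lambda>\<omega>. \<omega> i))"
    unfolding distr_coord restrict_UNIV by (simp add: gw_space_def distr_id2)
  then show ?thesis
    by (subst P.indep_vars_iff_distr_eq_PiM') simp_all
qed

lemma integrable_coord:
  fixes f :: "nat \<Rightarrow> 'b :: {banach, second_countable_topology}"
  shows "integrable M (\<lambda>\<omega>. f (\<omega> c))"
proof -
  have "finite (set_pmf (offspring p))" by (simp add: offspring_def)
  then have "integrable (measure_pmf (offspring p)) f" by (rule integrable_measure_pmf_finite)
  then have "integrable (distr M (measure_pmf (offspring p)) (\<lambda>\<omega>. \<omega> c)) f"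
    by (simp only: distr_coord)
  then show ?thesis by (subst (asm) integrable_distr_eq) simp_all
qed

lemma expectation_offspring:
  fixes f :: "nat \<Rightarrow> 'b :: {banach, second_countable_topology}"
  shows "measure_pmf.expectation (offspring p) f = (1 - p) *\<^sub>R f 1 + p *\<^sub>R f 2"
  using p_pos p_less_1 by (simp add: offspring_def integral_measure_pmf[of UNIV] UNIV_bool add.commute)

lemma expectation_coord:
  fixes f :: "nat \<Rightarrow> 'b :: {banach, second_countable_topology}"
  shows "P.expectation (\<lambda>\<omega>. f (\<omega> c)) = (1 - p) *\<^sub>R f 1 + p *\<^sub>R f 2"
proof -
  have "P.expectation (\<lambda>\<omega>. f (\<omega> c)) = integral\<^sup>L (distr M (measure_pmf (offspring p)) (\<lambda>\<omega>. \<omega> c)) f"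
    by (subst integral_distr) simp_all
  then show ?thesis by (simp only: distr_coord expectation_offspring)
qed

lemma indep_coord_fun:
  "P.indep_vars (\<lambda>_. borel) (\<lambda>c \<omega>. (f c (\<omega> c) :: 'b :: topological_space)) I"
proof -
  have "P.indep_vars (\<lambda>_. borel) (\<lambda>c \<omega>. f c (\<omega> c)) UNIV"
    by (rule P.indep_vars_compose2[OF indep_coord]) simp
  then show ?thesis by (rule P.indep_vars_subset) simp
qed

lemma expectation_prod_coord:
  fixes f :: "nat \<times> nat \<times> nat \<Rightarrow> nat \<Rightarrow> 'b :: {real_normed_field, banach, second_countable_topology}"
  assumes "finite I"
  shows "P.expectation (\<lambda>\<omega>. \<Prod>c\<in>I. f c (\<omega> c)) = (\<Prod>c\<in>I. P.expectation (\<lambda>\<omega>. f c (\<omega> c)))"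
    and "integrable M (\<lambda>\<omega>. \<Prod>c\<in>I. f c (\<omega> c))"
  by (intro P.indep_vars_lebesgue_integral P.indep_vars_integrable assms indep_coord_fun integrable_coord)+

text \<open>The coordinates that determine generation n. They are disjoint from \<open>row\<close>
  n, the offspring numbers of generation n itself, so the two restrictions are independent; this
  replaces conditional expectation in the arguments below.\<close>

definition past :: "nat \<Rightarrow> (nat \<times> nat \<times> nat) set" where
  "past n = {c. fst (snd c) < n}"

definition row :: "nat \<Rightarrow> (nat \<times> nat \<times> nat) set" where
  "row n = {c. fst (snd c) = n}"

abbreviation "PA n \<equiv> Pi\<^sub>M (past n) (\<lambda>_. measure_pmf (offspring p))"
abbreviation "RO n \<equiv> Pi\<^sub>M (row n) (\<lambda>_. measure_pmf (offspring p))"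

lemma split_distr:
  "distr M (PA n \<Otimes>\<^sub>M RO n) (\<lambda>\<omega>. (restrict \<omega> (past n), restrict \<omega> (row n)))
    = distr M (PA n) (\<lambda>\<omega>. restrict \<omega> (past n)) \<Otimes>\<^sub>M distr M (RO n) (\<lambda>\<omega>. restrict \<omega> (row n))"
  and measurable_past: "(\<lambda>\<omega>. restrict \<omega> (past n)) \<in> M \<rightarrow>\<^sub>M PA n"
  and measurable_row: "(\<lambda>\<omega>. restrict \<omega> (row n)) \<in> M \<rightarrow>\<^sub>M RO n"
proof -
  have "P.indep_var (PA n) (\<lambda>\<omega>. restrict (\<lambda>c. \<omega> c) (past n)) (RO n) (\<lambda>\<omega>. restrict (\<lambda>c. \<omega> c) (row n))"
    by (rule P.indep_var_restrict[OF indep_coord]) (auto simp: past_def row_def)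
  then show "distr M (PA n \<Otimes>\<^sub>M RO n) (\<lambda>\<omega>. (restrict \<omega> (past n), restrict \<omega> (row n)))
    = distr M (PA n) (\<lambda>\<omega>. restrict \<omega> (past n)) \<Otimes>\<^sub>M distr M (RO n) (\<lambda>\<omega>. restrict \<omega> (row n))"
    "(\<lambda>\<omega>. restrict \<omega> (past n)) \<in> M \<rightarrow>\<^sub>M PA n" "(\<lambda>\<omega>. restrict \<omega> (row n)) \<in> M \<rightarrow>\<^sub>M RO n"
    unfolding P.indep_var_distribution_eq by simp_all
qed

lemma nn_integral_split:
  assumes f: "f \<in> borel_measurable (PA n \<Otimes>\<^sub>M RO n)"
  shows "(\<integral>\<^sup>+\<omega>. f (restrict \<omega> (past n), restrict \<omega> (row n)) \<partial>M)
    = (\<integral>\<^sup>+\<omega>. \<integral>\<^sup>+\<omega>'. f (restrict \<omega> (past n), restrict \<omega>' (row n)) \<partial>M \<partial>M)"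
proof -
  note [measurable] = measurable_past measurable_row f
  let ?A = "distr M (PA n) (\<lambda>\<omega>. restrict \<omega> (past n))" and ?B = "distr M (RO n) (\<lambda>\<omega>. restrict \<omega> (row n))"
  interpret B: prob_space ?B by (rule P.prob_space_distr) simp
  have "(\<integral>\<^sup>+\<omega>. f (restrict \<omega> (past n), restrict \<omega> (row n)) \<partial>M)
    = (\<integral>\<^sup>+x. f x \<partial>distr M (PA n \<Otimes>\<^sub>M RO n) (\<lambda>\<omega>. (restrict \<omega> (past n), restrict \<omega> (row n))))"
    by (subst nn_integral_distr) simp_all
  also have "\<dots> = (\<integral>\<^sup>+x. \<integral>\<^sup>+y. f (x, y) \<partial>?B \<partial>?A)"
    unfolding split_distr by (rule B.nn_integral_fst[symmetric]) simp
  also have "\<dots> = (\<integral>\<^sup>+x. \<integral>\<^sup>+\<omega>'. f (x, restrict \<omega>' (row n)) \<partial>M \<partial>?A)"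
    by (intro nn_integral_cong nn_integral_distr) simp_all
  also have "\<dots> = (\<integral>\<^sup>+\<omega>. \<integral>\<^sup>+\<omega>'. f (restrict \<omega> (past n), restrict \<omega>' (row n)) \<partial>M \<partial>M)"
    by (rule nn_integral_distr) simp_all
  finally show ?thesis .
qed

lemma integral_split:
  fixes f :: "_ \<Rightarrow> 'b :: {banach, second_countable_topology}"
  assumes f: "f \<in> borel_measurable (PA n \<Otimes>\<^sub>M RO n)" and b: "\<And>x. norm (f x) \<le> B"
  shows "P.expectation (\<lambda>\<omega>. f (restrict \<omega> (past n), restrict \<omega> (row n)))
    = P.expectation (\<lambda>\<omega>. P.expectation (\<lambda>\<omega>'. f (restrict \<omega> (past n), restrict \<omega>' (row n))))"
proof -
  note [measurable] = measurable_past measurable_row f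
  let ?A = "distr M (PA n) (\<lambda>\<omega>. restrict \<omega> (past n))" and ?B = "distr M (RO n) (\<lambda>\<omega>. restrict \<omega> (row n))"
  interpret B: prob_space ?B by (rule P.prob_space_distr) simp
  interpret A: prob_space ?A by (rule P.prob_space_distr) simp
  interpret AB: pair_prob_space ?A ?B ..
  have "integrable (?A \<Otimes>\<^sub>M ?B) f"
    by (rule AB.P.integrable_const_bound[of _ B]) (simp_all add: b)
  have "P.expectation (\<lambda>\<omega>. f (restrict \<omega> (past n), restrict \<omega> (row n)))
    = integral\<^sup>L (distr M (PA n \<Otimes>\<^sub>M RO n) (\<lambda>\<omega>. (restrict \<omega> (past n), restrict \<omega> (row n)))) f"
    by (subst integral_distr) simp_all
  also have "\<dots> = integral\<^sup>L ?A (\<lambda>x. integral\<^sup>L ?B (\<lambda>y. f (x, y)))"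
    unfolding split_distr by (rule AB.integral_fst'[symmetric]) fact
  also have "\<dots> = integral\<^sup>L ?A (\<lambda>x. P.expectation (\<lambda>\<omega>'. f (x, restrict \<omega>' (row n))))"
    by (intro Bochner_Integration.integral_cong refl integral_distr) simp_all
  also have "\<dots> = P.expectation (\<lambda>\<omega>. P.expectation (\<lambda>\<omega>'. f (restrict \<omega> (past n), restrict \<omega>' (row n))))"
    by (rule integral_distr) simp_all
  finally show ?thesis .
qed

lemma D_restrict_past: "k \<le> n \<Longrightarrow> D i k (restrict \<omega> (past n)) = D i k \<omega>"
  by (induction k) (simp_all add: past_def)

lemma measurable_past_coord: "c \<in> past n \<Longrightarrow> (\<lambda>x. x c) \<in> PA n \<rightarrow>\<^sub>M count_space UNIV"
  using measurable_component_singleton[of c "past n" "\<lambda>_. measure_pmf (offspring p)"] by simp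

lemma measurable_row_coord: "c \<in> row n \<Longrightarrow> (\<lambda>x. x c) \<in> RO n \<rightarrow>\<^sub>M count_space UNIV"
  using measurable_component_singleton[of c "row n" "\<lambda>_. measure_pmf (offspring p)"] by simp

lemma measurable_D_past: "k \<le> n \<Longrightarrow> D i k \<in> PA n \<rightarrow>\<^sub>M count_space UNIV"
proof (induction k)
  case 0
  have "D i 0 = (\<lambda>_. 1)" by (rule ext) simp
  then show ?case by (simp only: measurable_const UNIV_I space_count_space)
next
  case (Suc k)
  have "(\<lambda>x. \<Sum>m<d. x (i, k, m)) \<in> PA n \<rightarrow>\<^sub>M count_space UNIV" for d
    using Suc.prems by (intro measurable_sum_nat measurable_past_coord) (simp add: past_def)
  then have "(\<lambda>x. \<Sum>m<D i k x. x (i, k, m)) \<in> PA n \<rightarrow>\<^sub>M count_space UNIV"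
    by (rule measurable_compose_countable[where f = "\<lambda>d x. \<Sum>m<d. x (i, k, m)"])
      (rule Suc.IH, use Suc.prems in linarith)
  moreover have "D i (Suc k) = (\<lambda>x. \<Sum>m<D i k x. x (i, k, m))" by (rule ext) simp
  ultimately show ?case by (simp only:)
qed

lemma measurable_D [measurable]: "D i n \<in> M \<rightarrow>\<^sub>M count_space UNIV"
proof -
  have "(\<lambda>\<omega>. D i n (restrict \<omega> (past n))) \<in> M \<rightarrow>\<^sub>M count_space UNIV"
    by (rule measurable_compose[OF measurable_past measurable_D_past]) simp
  then show ?thesis by (simp add: D_restrict_past)
qed

end

section \<open>Generating functions and moments of the generations\<close>

context splitting
begin

lemma prod_coord_Sigma:
  fixes f :: "nat \<Rightarrow> 'b :: {real_normed_field, banach, second_countable_topology}"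
  shows "P.expectation (\<lambda>\<omega>. \<Prod>i<j. \<Prod>m<d i. f (\<omega> (i, n, m)))
    = ((1 - p) *\<^sub>R f 1 + p *\<^sub>R f 2) ^ (\<Sum>i<j. d i)"
proof -
  let ?S = "Sigma {..<j} (\<lambda>i. {..<d i})" and ?e = "\<lambda>(i, m). (i :: nat, n, m :: nat)"
  have inj: "inj_on ?e ?S" by (auto simp: inj_on_def)
  have fin: "finite ?S" by (intro finite_SigmaI) simp_all
  have "(\<Prod>i<j. \<Prod>m<d i. f (\<omega> (i, n, m))) = (\<Prod>c\<in>?e ` ?S. f (\<omega> c))" for \<omega>
  proof -
    have "(\<Prod>i<j. \<Prod>m<d i. f (\<omega> (i, n, m))) = (\<Prod>(i, m)\<in>?S. f (\<omega> (i, n, m)))"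
      by (rule prod.Sigma) simp_all
    also have "\<dots> = (\<Prod>c\<in>?e ` ?S. f (\<omega> c))"
      unfolding prod.reindex[OF inj] by (intro prod.cong) auto
    finally show ?thesis .
  qed
  then have "P.expectation (\<lambda>\<omega>. \<Prod>i<j. \<Prod>m<d i. f (\<omega> (i, n, m)))
      = (\<Prod>c\<in>?e ` ?S. P.expectation (\<lambda>\<omega>. f (\<omega> c)))"
    using fin by (simp only: expectation_prod_coord(1)[of _ "\<lambda>_. f"] finite_imageI)
  also have "\<dots> = ((1 - p) *\<^sub>R f 1 + p *\<^sub>R f 2) ^ card ?S"
    unfolding expectation_coord prod_constant card_image[OF inj] ..
  also have "card ?S = (\<Sum>i<j. d i)" by (subst card_SigmaI) simp_all
  finally show ?thesis .
qed

lemma measurable_row_power: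
  "(\<lambda>x. z ^ (snd x (i, n, m))) \<in> borel_measurable (PA n \<Otimes>\<^sub>M RO n)" for z :: complex
proof -
  have "(\<lambda>x. snd x (i, n, m)) \<in> PA n \<Otimes>\<^sub>M RO n \<rightarrow>\<^sub>M count_space UNIV"
    by (rule measurable_compose[OF measurable_snd measurable_row_coord]) (simp add: row_def)
  then show ?thesis by (rule measurable_compose) simp
qed

lemma measurable_fst_D: "(\<lambda>x. D i n (fst x)) \<in> PA n \<Otimes>\<^sub>M RO n \<rightarrow>\<^sub>M count_space UNIV"
  by (rule measurable_compose[OF measurable_fst measurable_D_past]) simp

text \<open>Given the past, the size of the next generation is a sum of independent offspring
  numbers, each contributing a factor F(z). The bound on z makes the integrand bounded, as
  \<open>integral_split\<close> requires.\<close>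

lemma expectation_power_Suc:
  assumes z: "norm (z :: complex) \<le> 1"
  shows "P.expectation (\<lambda>\<omega>. z ^ (\<Sum>i<j. D i (Suc n) \<omega>))
    = P.expectation (\<lambda>\<omega>. F p z ^ (\<Sum>i<j. D i n \<omega>))"
proof -
  define f where "f x = (\<Prod>i<j. \<Prod>m<D i n (fst x). z ^ (snd x (i, n, m)))"
    for x :: "(nat \<times> nat \<times> nat \<Rightarrow> nat) \<times> (nat \<times> nat \<times> nat \<Rightarrow> nat)"
  have meas: "f \<in> borel_measurable (PA n \<Otimes>\<^sub>M RO n)"
    unfolding f_def[abs_def]
  proof (rule borel_measurable_prod)
    fix i
    show "(\<lambda>x. \<Prod>m<D i n (fst x). z ^ (snd x (i, n, m))) \<in> borel_measurable (PA n \<Otimes>\<^sub>M RO n)"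
      by (rule measurable_compose_countable[where f = "\<lambda>d x. \<Prod>m<d. z ^ (snd x (i, n, m))", OF _ measurable_fst_D])
        (intro borel_measurable_prod measurable_row_power)
  qed
  have bound: "norm (f x) \<le> 1" for x
    unfolding f_def prod_norm[symmetric] norm_power using z
    by (intro prod_le_1 conjI prod_nonneg ballI power_le_one zero_le_power norm_ge_zero)
  have split: "f (restrict \<omega> (past n), restrict \<omega>' (row n)) = (\<Prod>i<j. \<Prod>m<D i n \<omega>. z ^ \<omega>' (i, n, m))" for \<omega> \<omega>'
    unfolding f_def by (simp add: D_restrict_past row_def)
  have "z ^ (\<Sum>i<j. D i (Suc n) \<omega>) = f (restrict \<omega> (past n), restrict \<omega> (row n))" for \<omega>
    unfolding split by (simp add: power_sum)
  then have "P.expectation (\<lambda>\<omega>. z ^ (\<Sum>i<j. D i (Suc n) \<omega>))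
      = P.expectation (\<lambda>\<omega>. P.expectation (\<lambda>\<omega>'. f (restrict \<omega> (past n), restrict \<omega>' (row n))))"
    by (simp only: integral_split[OF meas bound])
  also have "\<dots> = P.expectation (\<lambda>\<omega>. F p z ^ (\<Sum>i<j. D i n \<omega>))"
    unfolding split prod_coord_Sigma[where f = "\<lambda>k. z ^ k"] by (simp add: F_def scaleR_conv_of_real)
  finally show ?thesis .
qed

lemma expectation_power:
  assumes "norm (z :: complex) \<le> 1"
  shows "P.expectation (\<lambda>\<omega>. z ^ (\<Sum>i<j. D i n \<omega>)) = ((F p ^^ n) z) ^ j"
  using assms
proof (induction n arbitrary: z)
  case 0
  then show ?case by (simp add: P.prob_space)
next
  case (Suc n)
  have "norm (F p z) \<le> 1" using F_norm_le_self[OF Suc.prems] Suc.prems by linarith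
  then show ?case
    unfolding expectation_power_Suc[OF Suc.prems] by (simp only: Suc.IH funpow_Suc_right o_apply)
qed

lemma measurable_D_real [measurable]: "(\<lambda>\<omega>. real (D i n \<omega>)) \<in> borel_measurable M"
  by (rule measurable_compose[OF measurable_D]) simp

lemma measurable_row_real:
  "(\<lambda>x. real (snd x (i, n, m))) \<in> borel_measurable (PA n \<Otimes>\<^sub>M RO n)"
proof -
  have "(\<lambda>x. snd x (i, n, m)) \<in> PA n \<Otimes>\<^sub>M RO n \<rightarrow>\<^sub>M count_space UNIV"
    by (rule measurable_compose[OF measurable_snd measurable_row_coord]) (simp add: row_def)
  then show ?thesis by (rule measurable_compose) simp
qed

lemma sum_restrict_row: "(\<Sum>m<d. real (restrict \<omega> (row n) (i, n, m))) = (\<Sum>m<d. real (\<omega> (i, n, m)))"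
  by (simp add: row_def)

lemma expectation_D: "integrable M (\<lambda>\<omega>. real (D i n \<omega>))" "P.expectation (\<lambda>\<omega>. real (D i n \<omega>)) = lam ^ n"
proof -
  \<comment> \<open>Done with nonnegative integrals, so that integrability comes out as a
    result.\<close>
  have nn: "(\<integral>\<^sup>+\<omega>. ennreal (real (D i n \<omega>)) \<partial>M) = ennreal (lam ^ n)"
  proof (induction n)
    case 0
    then show ?case by (simp add: P.emeasure_space_1)
  next
    case (Suc n)
    define f where "f x = ennreal (\<Sum>m<D i n (fst x). real (snd x (i, n, m)))"
      for x :: "(nat \<times> nat \<times> nat \<Rightarrow> nat) \<times> (nat \<times> nat \<times> nat \<Rightarrow> nat)"
    have "(\<lambda>x. \<Sum>m<D i n (fst x). real (snd x (i, n, m))) \<in> borel_measurable (PA n \<Otimes>\<^sub>M RO n)"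
      by (rule measurable_compose_countable[where f = "\<lambda>d x. \<Sum>m<d. real (snd x (i, n, m))", OF _ measurable_fst_D])
        (intro borel_measurable_sum measurable_row_real)
    then have meas: "f \<in> borel_measurable (PA n \<Otimes>\<^sub>M RO n)"
      unfolding f_def[abs_def] by (rule measurable_compose) simp
    have split: "f (restrict \<omega> (past n), restrict \<omega>' (row n)) = ennreal (\<Sum>m<D i n \<omega>. real (\<omega>' (i, n, m)))" for \<omega> \<omega>'
      unfolding f_def fst_conv snd_conv sum_restrict_row by (simp only: D_restrict_past order_refl)
    have inner: "(\<integral>\<^sup>+\<omega>'. ennreal (\<Sum>m<d. real (\<omega>' (i, n, m))) \<partial>M) = ennreal lam * ennreal (real d)" for d
    proof -
      have E: "P.expectation (\<lambda>\<omega>'. real (\<omega>' (i, n, m))) = lam" for m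
        unfolding expectation_coord[of real] by simp
      have "(\<integral>\<^sup>+\<omega>'. ennreal (\<Sum>m<d. real (\<omega>' (i, n, m))) \<partial>M)
          = ennreal (P.expectation (\<lambda>\<omega>'. \<Sum>m<d. real (\<omega>' (i, n, m))))"
        by (intro nn_integral_eq_integral Bochner_Integration.integrable_sum integrable_coord[of real] AE_I2 sum_nonneg) simp
      also have "P.expectation (\<lambda>\<omega>'. \<Sum>m<d. real (\<omega>' (i, n, m))) = lam * real d"
        by (subst Bochner_Integration.integral_sum) (simp_all only: integrable_coord[of real] E, simp)
      finally show ?thesis using p_pos by (simp add: ennreal_mult)
    qed
    have "(\<integral>\<^sup>+\<omega>. ennreal (real (D i (Suc n) \<omega>)) \<partial>M)
        = (\<integral>\<^sup>+\<omega>. f (restrict \<omega> (past n), restrict \<omega> (row n)) \<partial>M)"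
      unfolding split by simp
    also have "\<dots> = (\<integral>\<^sup>+\<omega>. \<integral>\<^sup>+\<omega>'. f (restrict \<omega> (past n), restrict \<omega>' (row n)) \<partial>M \<partial>M)"
      by (rule nn_integral_split[OF meas])
    also have "\<dots> = (\<integral>\<^sup>+\<omega>. ennreal lam * ennreal (real (D i n \<omega>)) \<partial>M)"
      unfolding split inner ..
    also have "\<dots> = ennreal lam * ennreal (lam ^ n)"
      unfolding Suc.IH[symmetric] by (rule nn_integral_cmult) measurable
    also have "\<dots> = ennreal (lam ^ Suc n)"
      using p_pos by (subst ennreal_mult[symmetric]) simp_all
    finally show ?case .
  qed
  show int: "integrable M (\<lambda>\<omega>. real (D i n \<omega>))"
    by (rule integrableI_nonneg) (simp_all add: nn ennreal_less_top del: ennreal_of_nat_eq_real_of_nat)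
  have "ennreal (P.expectation (\<lambda>\<omega>. real (D i n \<omega>))) = ennreal (lam ^ n)"
    using nn_integral_eq_integral[OF int] nn by simp
  then show "P.expectation (\<lambda>\<omega>. real (D i n \<omega>)) = lam ^ n"
    using p_pos by (subst (asm) ennreal_inj) simp_all
qed

text \<open>The centred offspring numbers are uncorrelated with variance p (1-p), so only the
  diagonal of the double sum survives.\<close>

lemma second_moment_row:
  "integrable M (\<lambda>\<omega>. (\<Sum>m<d. real (\<omega> (i, n, m)) - lam)\<^sup>2)"
  "P.expectation (\<lambda>\<omega>. (\<Sum>m<d. real (\<omega> (i, n, m)) - lam)\<^sup>2) = real d * (p * (1 - p))"
proof -
  define Y where "Y m \<omega> = real (\<omega> (i, n, m)) - lam" for m :: nat and \<omega> :: "nat \<times> nat \<times> nat \<Rightarrow> nat"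
  have Y2: "integrable M (\<lambda>\<omega>. Y m \<omega> * Y m' \<omega>)"
    "P.expectation (\<lambda>\<omega>. Y m \<omega> * Y m' \<omega>) = (if m = m' then p * (1 - p) else 0)" for m m'
  proof -
    have "integrable M (\<lambda>\<omega>. Y m \<omega> * Y m' \<omega>) \<and>
      P.expectation (\<lambda>\<omega>. Y m \<omega> * Y m' \<omega>) = (if m = m' then p * (1 - p) else 0)"
    proof (cases "m = m'")
      case True
      have "P.expectation (\<lambda>\<omega>. Y m \<omega> * Y m \<omega>) = p * (1 - p)"
        unfolding Y_def expectation_coord[of "\<lambda>k. (real k - lam) * (real k - lam)"]
        by (simp add: algebra_simps)
      moreover have "integrable M (\<lambda>\<omega>. Y m \<omega> * Y m \<omega>)"
        unfolding Y_def by (rule integrable_coord[of "\<lambda>k. (real k - lam) * (real k - lam)"])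
      ultimately show ?thesis using True by simp
    next
      case False
      let ?I = "{(i, n, m), (i, n, m')}"
      have prod: "Y m \<omega> * Y m' \<omega> = (\<Prod>c\<in>?I. real (\<omega> c) - lam)" for \<omega>
        using False by (simp add: Y_def)
      have "P.expectation (\<lambda>\<omega>. Y m \<omega> * Y m' \<omega>) = (\<Prod>c\<in>?I. P.expectation (\<lambda>\<omega>. real (\<omega> c) - lam))"
        unfolding prod by (rule expectation_prod_coord(1)[of _ "\<lambda>_ k. real k - lam"]) simp
      also have "\<dots> = 0"
        unfolding expectation_coord[of "\<lambda>k. real k - lam"] using False by (simp add: algebra_simps)
      finally have "P.expectation (\<lambda>\<omega>. Y m \<omega> * Y m' \<omega>) = 0" .
      moreover have "integrable M (\<lambda>\<omega>. Y m \<omega> * Y m' \<omega>)"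
        unfolding prod by (rule expectation_prod_coord(2)[of _ "\<lambda>_ k. real k - lam"]) simp
      ultimately show ?thesis using False by simp
    qed
    then show "integrable M (\<lambda>\<omega>. Y m \<omega> * Y m' \<omega>)"
      "P.expectation (\<lambda>\<omega>. Y m \<omega> * Y m' \<omega>) = (if m = m' then p * (1 - p) else 0)" by blast+
  qed
  have sq: "(\<Sum>m<d. Y m \<omega>)\<^sup>2 = (\<Sum>m<d. \<Sum>m'<d. Y m \<omega> * Y m' \<omega>)" for \<omega>
    by (simp only: power2_eq_square sum_product)
  show "integrable M (\<lambda>\<omega>. (\<Sum>m<d. real (\<omega> (i, n, m)) - lam)\<^sup>2)"
    unfolding Y_def[symmetric] sq by (intro Bochner_Integration.integrable_sum Y2)
  have "P.expectation (\<lambda>\<omega>. (\<Sum>m<d. Y m \<omega>)\<^sup>2) = (\<Sum>m<d. \<Sum>m'<d. if m = m' then p * (1 - p) else 0)"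
    unfolding sq by (simp only: Bochner_Integration.integral_sum Bochner_Integration.integrable_sum Y2)
  also have "\<dots> = real d * (p * (1 - p))" by simp
  finally show "P.expectation (\<lambda>\<omega>. (\<Sum>m<d. real (\<omega> (i, n, m)) - lam)\<^sup>2) = real d * (p * (1 - p))"
    unfolding Y_def .
qed

text \<open>Given the past, the difference is a centred sum with as many terms as generation n has
  members; then average with E D_n = lam^n.\<close>

lemma nn_second_moment_step:
  "(\<integral>\<^sup>+\<omega>. ennreal ((real (D i (Suc n) \<omega>) - lam * real (D i n \<omega>))\<^sup>2) \<partial>M) = ennreal (p * (1 - p) * lam ^ n)"
proof -
  define f where "f x = ennreal ((\<Sum>m<D i n (fst x). real (snd x (i, n, m)) - lam)\<^sup>2)"
    for x :: "(nat \<times> nat \<times> nat \<Rightarrow> nat) \<times> (nat \<times> nat \<times> nat \<Rightarrow> nat)"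
  have "(\<lambda>x. (\<Sum>m<D i n (fst x). real (snd x (i, n, m)) - lam)\<^sup>2) \<in> borel_measurable (PA n \<Otimes>\<^sub>M RO n)"
    by (rule measurable_compose_countable[where f = "\<lambda>d x. (\<Sum>m<d. real (snd x (i, n, m)) - lam)\<^sup>2", OF _ measurable_fst_D])
      (intro borel_measurable_power borel_measurable_sum borel_measurable_diff measurable_row_real borel_measurable_const)
  then have meas: "f \<in> borel_measurable (PA n \<Otimes>\<^sub>M RO n)"
    unfolding f_def[abs_def] by (rule measurable_compose) simp
  have split: "f (restrict \<omega> (past n), restrict \<omega>' (row n)) = ennreal ((\<Sum>m<D i n \<omega>. real (\<omega>' (i, n, m)) - lam)\<^sup>2)" for \<omega> \<omega>'
    unfolding f_def by (simp add: D_restrict_past row_def)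
  have inner: "(\<integral>\<^sup>+\<omega>'. ennreal ((\<Sum>m<d. real (\<omega>' (i, n, m)) - lam)\<^sup>2) \<partial>M) = ennreal (p * (1 - p)) * ennreal (real d)" for d
  proof -
    have "(\<integral>\<^sup>+\<omega>'. ennreal ((\<Sum>m<d. real (\<omega>' (i, n, m)) - lam)\<^sup>2) \<partial>M)
        = ennreal (P.expectation (\<lambda>\<omega>'. (\<Sum>m<d. real (\<omega>' (i, n, m)) - lam)\<^sup>2))"
      by (intro nn_integral_eq_integral second_moment_row(1) AE_I2 zero_le_power2)
    also note second_moment_row(2)
    finally show ?thesis using p_pos p_less_1 by (simp add: ennreal_mult mult.commute)
  qed
  have "(real (D i (Suc n) \<omega>) - lam * real (D i n \<omega>)) = (\<Sum>m<D i n \<omega>. real (\<omega> (i, n, m)) - lam)" for \<omega>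
    by (simp add: sum_subtractf mult.commute)
  then have "(\<integral>\<^sup>+\<omega>. ennreal ((real (D i (Suc n) \<omega>) - lam * real (D i n \<omega>))\<^sup>2) \<partial>M)
      = (\<integral>\<^sup>+\<omega>. f (restrict \<omega> (past n), restrict \<omega> (row n)) \<partial>M)"
    unfolding split by (simp only:)
  also have "\<dots> = (\<integral>\<^sup>+\<omega>. \<integral>\<^sup>+\<omega>'. f (restrict \<omega> (past n), restrict \<omega>' (row n)) \<partial>M \<partial>M)"
    by (rule nn_integral_split[OF meas])
  also have "\<dots> = (\<integral>\<^sup>+\<omega>. ennreal (p * (1 - p)) * ennreal (real (D i n \<omega>)) \<partial>M)"
    unfolding split inner ..
  also have "\<dots> = ennreal (p * (1 - p)) * (\<integral>\<^sup>+\<omega>. ennreal (real (D i n \<omega>)) \<partial>M)"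
    by (rule nn_integral_cmult) measurable
  also have "(\<integral>\<^sup>+\<omega>. ennreal (real (D i n \<omega>)) \<partial>M) = ennreal (lam ^ n)"
    using nn_integral_eq_integral[OF expectation_D(1)] by (simp add: expectation_D(2))
  finally show ?thesis using p_pos p_less_1 by (simp add: ennreal_mult)
qed

end

section \<open>The martingale limit and its Laplace transform\<close>

context splitting
begin

definition mart :: "nat \<Rightarrow> nat \<Rightarrow> (nat \<times> nat \<times> nat \<Rightarrow> nat) \<Rightarrow> real" where
  "mart i n \<omega> = real (D i n \<omega>) / lam ^ n"

definition incr :: "nat \<Rightarrow> nat \<Rightarrow> (nat \<times> nat \<times> nat \<Rightarrow> nat) \<Rightarrow> real" where
  "incr i n \<omega> = mart i (Suc n) \<omega> - mart i n \<omega>"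

abbreviation "srate \<equiv> 1 / sqrt lam"

lemma srate: "0 < srate" "srate < 1" "(srate ^ n)\<^sup>2 = 1 / lam ^ n"
proof -
  show "0 < srate" "srate < 1" using p_pos by simp_all
  have "(srate ^ n)\<^sup>2 = (srate\<^sup>2) ^ n" by (simp only: power_mult[symmetric] mult.commute)
  also have "srate\<^sup>2 = 1 / lam" using p_pos by (simp add: power_divide)
  finally show "(srate ^ n)\<^sup>2 = 1 / lam ^ n" by (simp add: power_one_over)
qed

lemma measurable_mart [measurable]: "mart i n \<in> borel_measurable M"
  unfolding mart_def[abs_def] by measurable

lemma measurable_incr [measurable]: "incr i n \<in> borel_measurable M"
  unfolding incr_def[abs_def] by measurable

lemma mart_expectation: "integrable M (mart i n)" "P.expectation (mart i n) = 1"
  unfolding mart_def[abs_def] using expectation_D[of i n] p_pos by simp_all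

text \<open>The second moment of an increment is at most lam^(-n) by
  \<open>nn_second_moment_step\<close>; this turns it into a summable first moment bound.\<close>

lemma incr_bound: "integrable M (incr i n)" "P.expectation (\<lambda>\<omega>. \<bar>incr i n \<omega>\<bar>) \<le> srate ^ n"
proof -
  let ?Q = "\<lambda>\<omega>. (real (D i (Suc n) \<omega>) - lam * real (D i n \<omega>))\<^sup>2"
  show int: "integrable M (incr i n)"
    unfolding incr_def[abs_def] by (intro Bochner_Integration.integrable_diff mart_expectation)
  have Q: "integrable M ?Q"
    by (rule integrableI_nonneg) (simp_all add: nn_second_moment_step ennreal_less_top del: D.simps)
  have "(\<integral>\<^sup>+\<omega>. ennreal (?Q \<omega>) \<partial>M) = ennreal (P.expectation ?Q)"
    by (intro nn_integral_eq_integral Q AE_I2 zero_le_power2)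
  then have "ennreal (P.expectation ?Q) = ennreal (p * (1 - p) * lam ^ n)"
    unfolding nn_second_moment_step by (rule sym)
  then have EQ: "P.expectation ?Q = p * (1 - p) * lam ^ n"
    using p_pos p_less_1 by (subst (asm) ennreal_inj) simp_all
  \<comment> \<open>The inequality 2 s |x| <= x^2 + s^2 with s = lam^(-n/2) takes the place of
    Cauchy-Schwarz; this s balances the two terms.\<close>
  define s where "s = srate ^ n"
  have s: "0 < s" "s\<^sup>2 = 1 / lam ^ n" using srate(1) srate(3)[of n] by (simp_all add: s_def)
  have point: "\<bar>incr i n \<omega>\<bar> \<le> (?Q \<omega> / (lam ^ Suc n)\<^sup>2 / s + s) / 2" for \<omega>
  proof -
    have "incr i n \<omega> = (real (D i (Suc n) \<omega>) - lam * real (D i n \<omega>)) / lam ^ Suc n"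
      using p_pos by (simp add: incr_def mart_def diff_divide_distrib del: D.simps)
    then have eq: "(incr i n \<omega>)\<^sup>2 = ?Q \<omega> / (lam ^ Suc n)\<^sup>2" by (simp only: power_divide)
    have "0 \<le> (\<bar>incr i n \<omega>\<bar> - s)\<^sup>2" by simp
    also have "\<dots> = (incr i n \<omega>)\<^sup>2 + s * s - 2 * s * \<bar>incr i n \<omega>\<bar>"
      by (simp add: power2_diff power2_eq_square[of s])
    finally have "\<bar>incr i n \<omega>\<bar> * (2 * s) \<le> (incr i n \<omega>)\<^sup>2 + s * s" by (simp add: mult_ac)
    then have "\<bar>incr i n \<omega>\<bar> \<le> ((incr i n \<omega>)\<^sup>2 + s * s) / (2 * s)" using s(1) by (simp add: pos_le_divide_eq)
    also have "\<dots> = ((incr i n \<omega>)\<^sup>2 / s + s) / 2" using s(1) by (simp add: add_divide_distrib)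
    finally show ?thesis unfolding eq .
  qed
  have "P.expectation (\<lambda>\<omega>. \<bar>incr i n \<omega>\<bar>) \<le> P.expectation (\<lambda>\<omega>. (?Q \<omega> / (lam ^ Suc n)\<^sup>2 / s + s) / 2)"
  proof (rule integral_mono)
    show "integrable M (\<lambda>\<omega>. \<bar>incr i n \<omega>\<bar>)" using int by (rule integrable_abs)
    show "integrable M (\<lambda>\<omega>. (?Q \<omega> / (lam ^ Suc n)\<^sup>2 / s + s) / 2)"
      by (intro integrable_divide_zero Bochner_Integration.integrable_add Q P.integrable_const impI)
  qed (rule point)
  also have "\<dots> = (P.expectation ?Q / (lam ^ Suc n)\<^sup>2 / s + s) / 2"
  proof -
    have "integrable M (\<lambda>\<omega>. ?Q \<omega> / (lam ^ Suc n)\<^sup>2 / s)"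
      by (intro integrable_divide_zero Q impI)
    then have "P.expectation (\<lambda>\<omega>. ?Q \<omega> / (lam ^ Suc n)\<^sup>2 / s + s) = P.expectation ?Q / (lam ^ Suc n)\<^sup>2 / s + s"
      by (simp add: P.prob_space del: D.simps power_Suc)
    then show ?thesis by (simp del: D.simps power_Suc)
  qed
  also have "P.expectation ?Q / (lam ^ Suc n)\<^sup>2 \<le> s\<^sup>2"
  proof -
    have "p * (1 - p) \<le> 1" using p_pos p_less_1 by (intro mult_le_one) simp_all
    moreover have "1 \<le> lam\<^sup>2" using p_pos by (simp add: one_le_power)
    ultimately have "p * (1 - p) \<le> lam\<^sup>2" by (rule order_trans)
    then have "p * (1 - p) * lam ^ n \<le> lam\<^sup>2 * lam ^ n"
      using p_pos by (intro mult_right_mono) simp_all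
    then have "p * (1 - p) * lam ^ n / (lam ^ Suc n)\<^sup>2 \<le> lam\<^sup>2 * lam ^ n / (lam ^ Suc n)\<^sup>2"
      by (intro divide_right_mono) simp_all
    also have "\<dots> = 1 / lam ^ n" using p_pos by (simp add: power2_eq_square)
    finally show ?thesis unfolding EQ s(2) .
  qed
  then have "(P.expectation ?Q / (lam ^ Suc n)\<^sup>2 / s + s) / 2 \<le> (s\<^sup>2 / s + s) / 2"
    using s(1) by (intro divide_right_mono add_right_mono) simp_all
  also have "\<dots> = s" by (simp add: power2_eq_square)
  finally show "P.expectation (\<lambda>\<omega>. \<bar>incr i n \<omega>\<bar>) \<le> srate ^ n" by (simp only: s_def)
qed

lemma summable_srate: "summable (\<lambda>n. srate ^ n)"
  using srate(1,2) by (intro summable_geometric) simp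

lemma AE_summable_incr: "AE \<omega> in M. summable (\<lambda>n. \<bar>incr i n \<omega>\<bar>)"
proof -
  have "(\<integral>\<^sup>+\<omega>. (\<Sum>n. ennreal \<bar>incr i n \<omega>\<bar>) \<partial>M) = (\<Sum>n. \<integral>\<^sup>+\<omega>. ennreal \<bar>incr i n \<omega>\<bar> \<partial>M)"
    by (rule nn_integral_suminf) measurable
  also have "\<dots> \<le> (\<Sum>n. ennreal (srate ^ n))"
  proof (intro suminf_le summableI)
    fix n
    have "(\<integral>\<^sup>+\<omega>. ennreal \<bar>incr i n \<omega>\<bar> \<partial>M) = ennreal (P.expectation (\<lambda>\<omega>. \<bar>incr i n \<omega>\<bar>))"
      by (intro nn_integral_eq_integral integrable_abs incr_bound(1)) simp
    then show "(\<integral>\<^sup>+\<omega>. ennreal \<bar>incr i n \<omega>\<bar> \<partial>M) \<le> ennreal (srate ^ n)"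
      using incr_bound(2)[of i n] by (simp add: ennreal_leI)
  qed
  also have "\<dots> = ennreal (\<Sum>n. srate ^ n)"
    using srate(1) by (intro suminf_ennreal2 summable_srate) simp
  finally have "(\<integral>\<^sup>+\<omega>. (\<Sum>n. ennreal \<bar>incr i n \<omega>\<bar>) \<partial>M) \<noteq> \<infinity>"
    by (auto simp: top_unique)
  then have "AE \<omega> in M. (\<Sum>n. ennreal \<bar>incr i n \<omega>\<bar>) \<noteq> \<infinity>"
    by (intro nn_integral_noteq_infinite) measurable
  then show ?thesis
    by (rule AE_mp) (intro AE_I2 impI summable_suminf_not_top, simp_all)
qed

lemma mart_telescope: "mart i n \<omega> = 1 + (\<Sum>k<n. incr i k \<omega>)"
proof -
  have "(\<Sum>k<n. incr i k \<omega>) = mart i n \<omega> - mart i 0 \<omega>"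
    unfolding incr_def by (rule sum_lessThan_telescope)
  then show ?thesis by (simp add: mart_def[of i 0])
qed

lemma W_eq: "W p i \<omega> = lim (\<lambda>n. mart i n \<omega>)"
  unfolding W_def mart_def ..

lemma AE_mart_tendsto: "AE \<omega> in M. (\<lambda>n. mart i n \<omega>) \<longlonglongrightarrow> W p i \<omega>"
  using AE_summable_incr[of i]
proof eventually_elim
  case (elim \<omega>)
  then have "(\<lambda>n. \<Sum>k<n. incr i k \<omega>) \<longlonglongrightarrow> suminf (\<lambda>n. incr i n \<omega>)"
    by (rule summable_LIMSEQ[OF summable_rabs_cancel])
  then have "(\<lambda>n. mart i n \<omega>) \<longlonglongrightarrow> 1 + suminf (\<lambda>n. incr i n \<omega>)"
    unfolding mart_telescope by (intro tendsto_add tendsto_const)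
  then show "(\<lambda>n. mart i n \<omega>) \<longlonglongrightarrow> W p i \<omega>"
    unfolding W_eq by (simp add: limI)
qed

lemma measurable_W [measurable]: "W p i \<in> borel_measurable M"
proof -
  have "(\<lambda>\<omega>. lim (\<lambda>n. mart i n \<omega>)) \<in> borel_measurable M"
    by (rule borel_measurable_lim_metric) measurable
  then show ?thesis by (simp add: W_eq[abs_def])
qed

text \<open>The partial products of the argument are dominated by 1 plus the sum of all
  |increments|, which is integrable because the first moments are summable; hence the mean 1 passes
  to the limit.\<close>

lemma W_expectation: "integrable M (W p i)" "P.expectation (W p i) = 1"
proof -
  let ?Y = "\<lambda>\<omega>. 1 + (\<Sum>k. \<bar>incr i k \<omega>\<bar>)"
  have Y: "integrable M ?Y"
  proof (intro Bochner_Integration.integrable_add P.integrable_const integrable_suminf)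
    show "integrable M (\<lambda>\<omega>. \<bar>incr i k \<omega>\<bar>)" for k by (intro integrable_abs incr_bound)
    show "AE \<omega> in M. summable (\<lambda>k. norm \<bar>incr i k \<omega>\<bar>)" using AE_summable_incr[of i] by simp
    show "summable (\<lambda>k. P.expectation (\<lambda>\<omega>. norm \<bar>incr i k \<omega>\<bar>))"
      by (rule summable_comparison_test'[OF summable_srate, of 0]) (use incr_bound(2)[of i] in simp)
  qed
  have dom: "AE \<omega> in M. norm (mart i n \<omega>) \<le> ?Y \<omega>" for n
    using AE_summable_incr[of i]
  proof eventually_elim
    case (elim \<omega>)
    note s = elim
    have "norm (mart i n \<omega>) \<le> 1 + \<bar>\<Sum>k<n. incr i k \<omega>\<bar>" unfolding mart_telescope by simp
    also have "\<bar>\<Sum>k<n. incr i k \<omega>\<bar> \<le> (\<Sum>k<n. \<bar>incr i k \<omega>\<bar>)" by (rule sum_abs)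
    also have "\<dots> \<le> (\<Sum>k. \<bar>incr i k \<omega>\<bar>)" by (rule sum_le_suminf[OF s]) simp_all
    finally show "norm (mart i n \<omega>) \<le> ?Y \<omega>" by simp
  qed
  show "integrable M (W p i)"
  proof (rule integrable_dominated_convergence[where s = "mart i" and w = ?Y])
    show "AE \<omega> in M. (\<lambda>n. mart i n \<omega>) \<longlonglongrightarrow> W p i \<omega>" by (rule AE_mart_tendsto)
    show "AE \<omega> in M. norm (mart i n \<omega>) \<le> ?Y \<omega>" for n by (rule dom)
  qed (rule Y measurable_W measurable_mart)+
  have "(\<lambda>n. P.expectation (mart i n)) \<longlonglongrightarrow> P.expectation (W p i)"
  proof (rule integral_dominated_convergence[where w = ?Y])
    show "AE \<omega> in M. (\<lambda>n. mart i n \<omega>) \<longlonglongrightarrow> W p i \<omega>" by (rule AE_mart_tendsto)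
    show "AE \<omega> in M. norm (mart i n \<omega>) \<le> ?Y \<omega>" for n by (rule dom)
  qed (rule Y measurable_W measurable_mart)+
  then have "(\<lambda>n::nat. 1 :: real) \<longlonglongrightarrow> P.expectation (W p i)" by (simp only: mart_expectation)
  then show "P.expectation (W p i) = 1" by (simp add: LIMSEQ_const_iff)
qed

lemma measurable_V [measurable]: "V p j \<in> borel_measurable M"
  unfolding V_def[abs_def] by measurable

lemma V_expectation: "integrable M (V p j)" "P.expectation (V p j) = real j"
  unfolding V_def[abs_def] by (simp_all add: W_expectation Bochner_Integration.integral_sum)

lemma AE_V_tendsto: "AE \<omega> in M. (\<lambda>n. real (\<Sum>i<j. D i n \<omega>) / lam ^ n) \<longlonglongrightarrow> V p j \<omega>"
proof -
  have "AE \<omega> in M. \<forall>i. (\<lambda>n. mart i n \<omega>) \<longlonglongrightarrow> W p i \<omega>"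
    unfolding AE_all_countable using AE_mart_tendsto by blast
  then show ?thesis
  proof eventually_elim
    case (elim \<omega>)
    then have "(\<lambda>n. \<Sum>i<j. mart i n \<omega>) \<longlonglongrightarrow> V p j \<omega>"
      unfolding V_def by (intro tendsto_sum) blast
    then show "(\<lambda>n. real (\<Sum>i<j. D i n \<omega>) / lam ^ n) \<longlonglongrightarrow> V p j \<omega>"
      by (simp add: mart_def sum_divide_distrib)
  qed
qed

lemma AE_V_nonneg: "AE \<omega> in M. 0 \<le> V p j \<omega>"
  using AE_V_tendsto[of j]
proof eventually_elim
  case (elim \<omega>)
  then show "0 \<le> V p j \<omega>"
    using p_pos by (elim LIMSEQ_le_const) (simp add: sum_nonneg)
qed

text \<open>For Re z >= 0 this is the Laplace transform of D_n / lam^n at z, by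
  \<open>expectation_power\<close>.\<close>

definition iter :: "nat \<Rightarrow> complex \<Rightarrow> complex" where
  "iter n z = (F p ^^ n) (exp (- z / of_real lam ^ n))"

lemma iter_Suc: "iter (Suc n) z = F p (iter n (z / of_real lam))"
  unfolding iter_def by simp

definition Phi :: "complex \<Rightarrow> complex" where
  "Phi z = P.expectation (\<lambda>\<omega>. exp (- z * of_real (V p 1 \<omega>)))"

lemma norm_exp_scaled: assumes "0 \<le> Re z" shows "norm (exp (- z / of_real lam ^ n)) \<le> 1"
proof -
  have "Re (- z / of_real (lam ^ n)) \<le> 0"
    unfolding Re_divide_of_real using assms p_pos by simp
  then show ?thesis by simp
qed

text \<open>Bounded convergence applied to the transforms of the generation sizes. The j-th power on
  the left shows that the transform of V_j is the j-th power of that of W, with no separate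
  independence argument for the W_i (see \<open>Laplace_V\<close>).\<close>

lemma Laplace_limit:
  assumes "0 \<le> Re z"
  shows "(\<lambda>n. iter n z ^ j) \<longlonglongrightarrow> P.expectation (\<lambda>\<omega>. exp (- z * of_real (V p j \<omega>)))"
proof -
  define f where "f n \<omega> = exp (- z / of_real lam ^ n) ^ (\<Sum>i<j. D i n \<omega>)" for n \<omega>
  have f_eq: "f n \<omega> = exp (- z * of_real (real (\<Sum>i<j. D i n \<omega>) / lam ^ n))" for n \<omega>
    unfolding f_def exp_of_nat_mult[symmetric] by (simp add: field_simps)
  have "(\<lambda>n. P.expectation (f n)) \<longlonglongrightarrow> P.expectation (\<lambda>\<omega>. exp (- z * of_real (V p j \<omega>)))"
  proof (rule integral_dominated_convergence)
    show "(\<lambda>\<omega>. exp (- z * of_real (V p j \<omega>))) \<in> borel_measurable M" by measurable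
    show "f n \<in> borel_measurable M" for n
    proof -
      have "(\<lambda>\<omega>. \<Sum>i<j. D i n \<omega>) \<in> M \<rightarrow>\<^sub>M count_space UNIV"
        by (intro measurable_sum_nat measurable_D)
      then show ?thesis unfolding f_def[abs_def] by (rule measurable_compose) simp
    qed
    show "integrable M (\<lambda>_. 1 :: real)" by (rule P.integrable_const)
    show "AE \<omega> in M. norm (f n \<omega>) \<le> 1" for n
      unfolding f_def norm_power using norm_exp_scaled[OF assms, of n]
      by (intro AE_I2 power_le_one norm_ge_zero)
    show "AE \<omega> in M. (\<lambda>n. f n \<omega>) \<longlonglongrightarrow> exp (- z * of_real (V p j \<omega>))"
      using AE_V_tendsto[of j]
    proof eventually_elim
      case (elim \<omega>)
      from tendsto_exp[OF tendsto_mult[OF tendsto_const tendsto_of_real[OF elim]], of "- z"]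
      show "(\<lambda>n. f n \<omega>) \<longlonglongrightarrow> exp (- z * of_real (V p j \<omega>))"
        unfolding f_eq .
    qed
  qed
  moreover have "P.expectation (f n) = iter n z ^ j" for n
    unfolding f_def iter_def by (rule expectation_power[OF norm_exp_scaled[OF assms]])
  ultimately show ?thesis by (simp only:)
qed

lemma iter_tendsto: "0 \<le> Re z \<Longrightarrow> (\<lambda>n. iter n z) \<longlonglongrightarrow> Phi z"
  using Laplace_limit[of z 1] by (simp add: Phi_def)

lemma Laplace_V: assumes "0 \<le> Re z"
  shows "P.expectation (\<lambda>\<omega>. exp (- z * of_real (V p j \<omega>))) = Phi z ^ j"
  by (rule LIMSEQ_unique[OF Laplace_limit[OF assms] tendsto_power[OF iter_tendsto[OF assms]]])

lemma Phi_lam: assumes "0 \<le> Re z" shows "Phi (of_real lam * z) = F p (Phi z)"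
proof -
  have "0 \<le> Re (of_real lam * z)" using assms p_pos by simp
  from LIMSEQ_Suc[OF iter_tendsto[OF this]]
  have "(\<lambda>n. F p (iter n z)) \<longlonglongrightarrow> Phi (of_real lam * z)"
    unfolding iter_Suc using lam_nonzero by (simp del: of_real_add)
  moreover have "(\<lambda>n. F p (iter n z)) \<longlonglongrightarrow> F p (Phi z)"
    unfolding F_def
    by (rule tendsto_add[OF tendsto_mult[OF tendsto_const iter_tendsto[OF assms]]
          tendsto_mult[OF tendsto_const tendsto_power[OF iter_tendsto[OF assms]]]])
  ultimately show ?thesis by (rule LIMSEQ_unique)
qed

lemma norm_Phi_le: assumes "0 \<le> Re z" shows "norm (Phi z) \<le> 1"
proof (rule LIMSEQ_le_const2[OF tendsto_norm[OF iter_tendsto[OF assms]]])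
  have "norm (iter n z) \<le> 1" for n
    unfolding iter_def using F_pow_norm_le[of "exp (- z / of_real lam ^ n)" n] norm_exp_scaled[OF assms, of n]
    by linarith
  then show "\<exists>N. \<forall>n\<ge>N. norm (iter n z) \<le> 1" by (intro exI allI impI)
qed

text \<open>The bounds |1 - Phi(w)| <= |w| and |Phi(w) - 1 + w| <= |w|^2/lam are preserved by one
  step of F, since lam (|w|^2/lam) + p |w|^2 = |lam w|^2/lam. So it suffices that exp(-w) satisfies
  them on the ray through z, which is supplied separately for real and for imaginary
  arguments.\<close>

lemma Phi_quadratic:
  assumes z: "0 \<le> Re z"
    and base: "\<And>L. 0 < L \<Longrightarrow> norm (1 - exp (- (z / of_real L))) \<le> norm (z / of_real L)"
      "\<And>L. 0 < L \<Longrightarrow> norm (exp (- (z / of_real L)) - 1 + z / of_real L) \<le> (norm (z / of_real L))\<^sup>2 / lam"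
  shows "norm (Phi z - 1 + z) \<le> (norm z)\<^sup>2 / lam"
proof -
  \<comment> \<open>Stated for every scale L, because a step of the iteration rescales the argument
    by lam.\<close>
  have "norm (1 - iter n (z / of_real L)) \<le> norm (z / of_real L) \<and>
      norm (iter n (z / of_real L) - 1 + z / of_real L) \<le> (norm (z / of_real L))\<^sup>2 / lam" if "0 < L" for n L
    using that
  proof (induction n arbitrary: L)
    case 0
    have iter_0: "iter 0 w = exp (- w)" for w by (simp add: iter_def)
    show ?case unfolding iter_0 using base[OF 0] by (intro conjI)
  next
    case (Suc n)
    define w where "w = z / of_real (L * lam)"
    define d where "d = 1 - iter n w"
    have zw: "z / of_real L = of_real lam * w" using p_pos by (simp add: w_def del: of_real_add)
    have zw': "z / of_real L / of_real lam = w" by (simp add: w_def)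
    have IH: "norm d \<le> norm w" "norm (w - d) \<le> (norm w)\<^sup>2 / lam"
    proof -
      have "0 < L * lam" using Suc.prems p_pos by simp
      note IH0 = Suc.IH[OF this, folded w_def]
      show "norm d \<le> norm w" unfolding d_def by (rule conjunct1[OF IH0])
      have "w - d = iter n w - 1 + w" by (simp add: d_def)
      then show "norm (w - d) \<le> (norm w)\<^sup>2 / lam" using conjunct2[OF IH0] by (simp only:)
    qed
    have wRe: "0 \<le> Re w" unfolding w_def Re_divide_of_real using z Suc.prems p_pos by simp
    have "norm (iter n w) \<le> 1"
      unfolding iter_def using F_pow_norm_le[of "exp (- w / of_real lam ^ n)" n] norm_exp_scaled[OF wRe, of n]
      by linarith
    then have "norm (1 - d) \<le> 1" by (simp add: d_def)
    have F: "iter (Suc n) (z / of_real L) = F p (1 - d)" unfolding iter_Suc zw' by (simp add: d_def)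
    have "1 - iter (Suc n) (z / of_real L) = d * (1 + of_real p * (1 - d))"
      unfolding F one_minus_F by simp
    moreover have "norm (1 + of_real p * (1 - d)) \<le> 1 + p * 1"
      using p_pos \<open>norm (1 - d) \<le> 1\<close> by (intro norm_triangle_le add_mono) (simp_all add: norm_mult)
    ultimately have "norm (1 - iter (Suc n) (z / of_real L)) \<le> norm d * (1 + p * 1)"
      by (simp only: norm_mult mult_left_mono norm_ge_zero)
    also have "\<dots> \<le> norm w * (1 + p * 1)" using IH p_pos by (intro mult_right_mono) simp_all
    also have "\<dots> = norm (z / of_real L)" unfolding zw using p_pos by (simp add: norm_mult del: of_real_add)
    finally have 1: "norm (1 - iter (Suc n) (z / of_real L)) \<le> norm (z / of_real L)" .
    have "iter (Suc n) (z / of_real L) - 1 + z / of_real L = of_real lam * (w - d) + of_real p * d\<^sup>2"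
      unfolding F unfolding zw by (simp add: F_def power2_eq_square algebra_simps)
    also have "norm \<dots> \<le> lam * norm (w - d) + p * (norm d)\<^sup>2"
      using p_pos by (intro order_trans[OF norm_triangle_ineq]) (simp add: norm_mult norm_power del: of_real_add)
    also have "\<dots> \<le> lam * ((norm w)\<^sup>2 / lam) + p * (norm w)\<^sup>2"
      using IH p_pos by (intro add_mono mult_left_mono power_mono) simp_all
    also have "\<dots> = (norm (z / of_real L))\<^sup>2 / lam"
    proof -
      have nz: "norm (z / of_real L) = lam * norm w"
        unfolding zw using p_pos by (simp add: norm_mult del: of_real_add)
      have "l * (x\<^sup>2 / l) + (l - 1) * x\<^sup>2 = (l * x)\<^sup>2 / l" if "0 < l" for l x :: real
        using that by (simp add: power2_eq_square left_diff_distrib)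
      from this[of lam "norm w"] show ?thesis unfolding nz using p_pos by simp
    qed
    finally show ?case using 1 by blast
  qed
  from this[of 1] have bound: "norm (iter n z - 1 + z) \<le> (norm z)\<^sup>2 / lam" for n by simp
  have "(\<lambda>n. norm (iter n z - 1 + z)) \<longlonglongrightarrow> norm (Phi z - 1 + z)"
    by (rule tendsto_norm[OF tendsto_add[OF tendsto_diff[OF iter_tendsto[OF z] tendsto_const] tendsto_const]])
  then show ?thesis
    by (rule LIMSEQ_le_const2) (intro exI allI impI bound)
qed

end

section \<open>Fourier inversion for an integrable characteristic function\<close>

context real_distribution
begin

lemma non_atom_between:
  assumes "u < v"
  obtains x where "u < x" "x < v" "measure M {x} = 0"
proof -
  have "\<not> {u<..<v} \<subseteq> {x. measure M {x} > 0}"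
    using countable_atoms countable_subset uncountable_open_interval[of u v] assms by blast
  then obtain x where "x \<in> {u<..<v}" "\<not> measure M {x} > 0" by blast
  then show ?thesis using that[of x] measure_nonneg[of M "{x}"] by simp
qed

definition inv_density :: "real \<Rightarrow> real" where
  "inv_density x = Re (1 / (2 * pi) * (CLBINT t. iexp (- (t * x)) * char M t))"

lemma norm_iexp: "norm (iexp x) = 1"
  by simp

context
  assumes int: "integrable lborel (char M)"
begin

lemma integrable_inversion: "integrable lborel (\<lambda>t. iexp (- (t * x)) * char M t)"
proof (rule Bochner_Integration.integrable_bound[OF int])
  show "(\<lambda>t. iexp (- (t * x)) * char M t) \<in> borel_measurable lborel"
    using borel_measurable_integrable[OF int] by measurable
  show "AE t in lborel. norm (iexp (- (t * x)) * char M t) \<le> norm (char M t)"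
    by (simp add: norm_mult)
qed

lemma continuous_inv_density: "continuous_on UNIV inv_density"
proof (rule continuous_on_sequentiallyI)
  fix u :: "nat \<Rightarrow> real" and x assume u: "u \<longlonglongrightarrow> x"
  have "(\<lambda>n. CLBINT t. iexp (- (t * u n)) * char M t) \<longlonglongrightarrow> (CLBINT t. iexp (- (t * x)) * char M t)"
  proof (rule integral_dominated_convergence[where w = "\<lambda>t. norm (char M t)"])
    show "(\<lambda>t. iexp (- (t * x)) * char M t) \<in> borel_measurable lborel"
      by (rule borel_measurable_integrable[OF integrable_inversion])
    show "(\<lambda>t. iexp (- (t * u n)) * char M t) \<in> borel_measurable lborel" for n
      by (rule borel_measurable_integrable[OF integrable_inversion])
    show "integrable lborel (\<lambda>t. norm (char M t))" using int by (rule integrable_norm)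
    show "AE t in lborel. (\<lambda>n. iexp (- (t * u n)) * char M t) \<longlonglongrightarrow> iexp (- (t * x)) * char M t"
      by (intro AE_I2 tendsto_mult tendsto_const tendsto_exp tendsto_of_real tendsto_minus u)
    show "AE t in lborel. norm (iexp (- (t * u n)) * char M t) \<le> norm (char M t)" for n
      by (simp add: norm_mult)
  qed
  then show "(\<lambda>n. inv_density (u n)) \<longlonglongrightarrow> inv_density x"
    unfolding inv_density_def by (rule tendsto_Re[OF tendsto_mult[OF tendsto_const]])
qed

lemma borel_inv_density [measurable]: "inv_density \<in> borel_measurable borel"
  using continuous_inv_density by (rule borel_measurable_continuous_onI)

lemma inv_density_bounded: "\<bar>inv_density x\<bar> \<le> (LBINT t. norm (char M t))"
proof -
  have "\<bar>inv_density x\<bar> \<le> norm (1 / (2 * pi) * (CLBINT t. iexp (- (t * x)) * char M t))"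
    unfolding inv_density_def by (rule abs_Re_le_cmod)
  also have "\<dots> = 1 / (2 * pi) * norm (CLBINT t. iexp (- (t * x)) * char M t)"
    by (simp add: norm_mult norm_divide)
  also have "\<dots> \<le> 1 * norm (CLBINT t. iexp (- (t * x)) * char M t)"
    using pi_gt3 by (intro mult_right_mono) simp_all
  also have "\<dots> \<le> 1 * (LBINT t. norm (iexp (- (t * x)) * char M t))"
    by (intro mult_left_mono integral_norm_bound) simp
  finally show ?thesis by (simp add: norm_mult)
qed

lemma set_integrable_inv_density: "integrable lborel (\<lambda>x. indicator {a..b} x *\<^sub>R inv_density x)"
  by (rule borel_integrable_compact) (auto intro: continuous_on_subset[OF continuous_inv_density])

text \<open>In Levy's inversion formula the kernel (e^(-ita) - e^(-itb))/(it) is the integral H(t)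
  of e^(-itx) over [a,b]. Integrability of the characteristic function removes the cutoff by
  dominated convergence and allows Fubini to exchange the two integrals.\<close>

lemma measure_Ioc_inversion:
  assumes ab: "a \<le> b" and atoms: "measure M {a} = 0" "measure M {b} = 0"
  shows "measure M {a<..b} = (LBINT x. indicator {a..b} x *\<^sub>R inv_density x)"
proof -
  define H where "H t = (CLBINT x. indicator {a..b} x *\<^sub>R iexp (- (t * x)))" for t
  have H_eq: "H t = (iexp (- (t * a)) - iexp (- (t * b))) / (\<i> * t)" if "t \<noteq> 0" for t
  proof -
    define P where "P x = iexp (- (t * x)) / (- (\<i> * t))" for x
    have "(P has_vector_derivative iexp (- (t * x))) (at x within {a..b})" for x
    proof -
      have "((\<lambda>z. exp (- (\<i> * of_real t) * z) / (- (\<i> * of_real t))) has_field_derivative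
          exp (- (\<i> * of_real t) * of_real x) * (- (\<i> * of_real t)) / (- (\<i> * of_real t))) (at (of_real x))"
        using that by (auto intro!: derivative_eq_intros)
      from has_vector_derivative_real_field[OF this]
      show ?thesis
        using that unfolding P_def[abs_def]
        by (simp add: o_def mult.assoc has_vector_derivative_at_within)
    qed
    moreover have "continuous_on {a..b} (\<lambda>x. iexp (- (t * x)))" by (intro continuous_intros)
    ultimately have "H t = P b - P a"
      unfolding H_def using ab by (intro integral_FTC_Icc) auto
    then show ?thesis using that by (simp add: P_def field_simps)
  qed
  have H_bound: "norm (H t) \<le> b - a" for t
  proof -
    have "norm (H t) \<le> (LBINT x. norm (indicator {a..b} x *\<^sub>R iexp (- (t * x))))"
      unfolding H_def by (rule integral_norm_bound)
    also have "\<dots> = (LBINT x. indicator {a..b} x)" by simp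
    also have "\<dots> = b - a" using ab by simp
    finally show ?thesis .
  qed
  have pair: "integrable (lborel \<Otimes>\<^sub>M lborel) (\<lambda>(t, x). indicator {a..b} x *\<^sub>R (iexp (- (t * x)) * char M t))"
  proof (rule lborel_pair.Fubini_integrable)
    have [measurable]: "char M \<in> borel_measurable borel" using borel_measurable_integrable[OF int] by simp
    show "(\<lambda>(t, x). indicator {a..b} x *\<^sub>R (iexp (- (t * x)) * char M t)) \<in> borel_measurable (lborel \<Otimes>\<^sub>M lborel)"
      by measurable
    have "(LBINT x. norm (indicator {a..b} x *\<^sub>R (iexp (- (t * x)) * char M t))) = (b - a) * norm (char M t)" for t
      using ab by (simp add: norm_mult)
    then show "integrable lborel (\<lambda>t. LBINT x. norm (case (t, x) of (t, x) \<Rightarrow> indicator {a..b} x *\<^sub>R (iexp (- (t * x)) * char M t)))"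
      using int by simp
    show "AE t in lborel. integrable lborel (\<lambda>x. case (t, x) of (t, x) \<Rightarrow> indicator {a..b} x *\<^sub>R (iexp (- (t * x)) * char M t))"
      unfolding prod.case by (intro AE_I2 borel_integrable_compact compact_Icc continuous_intros)
  qed
  have Hc: "(CLBINT x. indicator {a..b} x *\<^sub>R (iexp (- (t * x)) * char M t)) = H t * char M t" for t
  proof -
    have "(CLBINT x. indicator {a..b} x *\<^sub>R (iexp (- (t * x)) * char M t))
        = (CLBINT x. (indicator {a..b} x *\<^sub>R iexp (- (t * x))) * char M t)" by simp
    also have "\<dots> = H t * char M t" unfolding H_def by (rule integral_mult_left_zero)
    finally show ?thesis .
  qed
  have intH: "integrable lborel (\<lambda>t. H t * char M t)"
    using lborel_pair.integrable_fst'[OF pair] unfolding prod.case Hc .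
  have swap: "(CLBINT t. H t * char M t)
      = (CLBINT x. indicator {a..b} x *\<^sub>R (CLBINT t. iexp (- (t * x)) * char M t))"
  proof -
    have pull: "(CLBINT t. indicator {a..b} x *\<^sub>R (iexp (- (t * x)) * char M t))
        = indicator {a..b} x *\<^sub>R (CLBINT t. iexp (- (t * x)) * char M t)" for x
      by (rule integral_scaleR_right)
    from lborel_pair.Fubini_integral[OF pair] show ?thesis
      unfolding prod.case Hc pull ..
  qed
  have "(\<lambda>n. 1 / (2 * pi) * (CLBINT t=-real n..real n. (iexp (-(t * a)) - iexp (-(t * b))) / (\<i> * t) * char M t))
      \<longlonglongrightarrow> complex_of_real (measure M {a<..b})"
    using Levy_Inversion[OF ab atoms] by (simp only: of_int_minus of_int_of_nat_eq)
  moreover have "(CLBINT t=-real n..real n. (iexp (-(t * a)) - iexp (-(t * b))) / (\<i> * t) * char M t)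
      = (CLBINT t. indicator {-real n<..<real n} t *\<^sub>R (H t * char M t))" for n
  proof -
    have "(CLBINT t=-real n..real n. (iexp (-(t * a)) - iexp (-(t * b))) / (\<i> * t) * char M t)
      = (CLBINT t. indicator {-real n<..<real n} t *\<^sub>R ((iexp (-(t * a)) - iexp (-(t * b))) / (\<i> * t) * char M t))"
      by (simp add: interval_lebesgue_integral_def set_lebesgue_integral_def)
    also have "\<dots> = (CLBINT t. indicator {-real n<..<real n} t *\<^sub>R (H t * char M t))"
    proof (rule integral_cong_AE)
      show "AE t in lborel. indicator {-real n<..<real n} t *\<^sub>R ((iexp (-(t * a)) - iexp (-(t * b))) / (\<i> * t) * char M t)
          = indicator {-real n<..<real n} t *\<^sub>R (H t * char M t)"
        \<comment> \<open>The two kernels differ only at t = 0, where division by zero gives 0 in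
          place of b - a.\<close>
        using AE_lborel_singleton[of 0] by eventually_elim (simp add: H_eq)
      have [measurable]: "char M \<in> borel_measurable borel" using borel_measurable_integrable[OF int] by simp
      show "(\<lambda>t. indicator {-real n<..<real n} t *\<^sub>R ((iexp (-(t * a)) - iexp (-(t * b))) / (\<i> * t) * char M t)) \<in> borel_measurable lborel"
        by measurable
      show "(\<lambda>t. indicator {-real n<..<real n} t *\<^sub>R (H t * char M t)) \<in> borel_measurable lborel"
        using borel_measurable_integrable[OF intH] by measurable
    qed
    finally show ?thesis .
  qed
  ultimately have lim1: "(\<lambda>n. 1 / (2 * pi) * (CLBINT t. indicator {-real n<..<real n} t *\<^sub>R (H t * char M t)))
      \<longlonglongrightarrow> complex_of_real (measure M {a<..b})" by (simp only:)
  have "(\<lambda>n. CLBINT t. indicator {-real n<..<real n} t *\<^sub>R (H t * char M t)) \<longlonglongrightarrow> (CLBINT t. H t * char M t)"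
  proof (rule integral_dominated_convergence[where w = "\<lambda>t. norm (H t * char M t)"])
    show "(\<lambda>t. H t * char M t) \<in> borel_measurable lborel" by (rule borel_measurable_integrable[OF intH])
    show "(\<lambda>t. indicator {-real n<..<real n} t *\<^sub>R (H t * char M t)) \<in> borel_measurable lborel" for n
      using borel_measurable_integrable[OF intH] by measurable
    show "integrable lborel (\<lambda>t. norm (H t * char M t))" using intH by (rule integrable_norm)
    show "AE t in lborel. (\<lambda>n. indicator {-real n<..<real n} t *\<^sub>R (H t * char M t)) \<longlonglongrightarrow> H t * char M t"
    proof (intro AE_I2 tendsto_eventually)
      fix t :: real
      obtain N where N: "\<bar>t\<bar> < real N" using reals_Archimedean2 by blast
      show "\<forall>\<^sub>F n in sequentially. indicator {-real n<..<real n} t *\<^sub>R (H t * char M t) = H t * char M t"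
        using eventually_ge_at_top[of N] by (rule eventually_mono) (use N in \<open>simp add: indicator_def abs_less_iff\<close>)
    qed
    show "AE t in lborel. norm (indicator {-real n<..<real n} t *\<^sub>R (H t * char M t)) \<le> norm (H t * char M t)" for n
      by (simp add: indicator_def)
  qed
  then have "(\<lambda>n. 1 / (2 * pi) * (CLBINT t. indicator {-real n<..<real n} t *\<^sub>R (H t * char M t)))
      \<longlonglongrightarrow> complex_of_real (1 / (2 * pi)) * (CLBINT t. H t * char M t)"
    by (intro tendsto_mult tendsto_const) simp
  from LIMSEQ_unique[OF lim1 this]
  have "complex_of_real (measure M {a<..b}) = of_real (1 / (2 * pi)) * (CLBINT t. H t * char M t)" .
  also have "\<dots> = (CLBINT x. of_real (1 / (2 * pi)) * (indicator {a..b} x *\<^sub>R (CLBINT t. iexp (- (t * x)) * char M t)))"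
    unfolding swap by (rule integral_mult_right_zero[symmetric])
  finally have 1: "complex_of_real (measure M {a<..b})
      = (CLBINT x. of_real (1 / (2 * pi)) * (indicator {a..b} x *\<^sub>R (CLBINT t. iexp (- (t * x)) * char M t)))" .
  have "integrable lborel (\<lambda>x. indicator {a..b} x *\<^sub>R (CLBINT t. iexp (- (t * x)) * char M t))"
    using lborel_pair.integrable_snd[OF pair] by simp
  then have "Re (CLBINT x. of_real (1 / (2 * pi)) * (indicator {a..b} x *\<^sub>R (CLBINT t. iexp (- (t * x)) * char M t)))
      = (LBINT x. Re (of_real (1 / (2 * pi)) * (indicator {a..b} x *\<^sub>R (CLBINT t. iexp (- (t * x)) * char M t))))"
    by (intro integral_Re[symmetric] integrable_mult_right) 
  moreover have "Re (of_real (1 / (2 * pi)) * (indicator {a..b} x *\<^sub>R (CLBINT t. iexp (- (t * x)) * char M t)))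
      = indicator {a..b} x *\<^sub>R inv_density x" for x
    by (simp add: inv_density_def)
  ultimately show ?thesis using arg_cong[OF 1, of Re] by (simp only: Re_complex_of_real)
qed

text \<open>A negative value would persist on an interval by continuity; choosing the endpoints
  among the non-atoms, the inversion formula gives that interval negative measure.\<close>

lemma inv_density_nonneg: "0 \<le> inv_density x"
proof (rule ccontr)
  assume "\<not> 0 \<le> inv_density x"
  then have neg: "inv_density x / 2 < 0" "inv_density x < inv_density x / 2" by simp_all
  have "isCont inv_density x" using continuous_inv_density by (simp add: continuous_on_eq_continuous_at)
  then have "(inv_density \<longlongrightarrow> inv_density x) (nhds x)" by (simp add: continuous_at_imp_continuous_at_within isCont_def tendsto_nhds_iff)
  from order_tendstoD(2)[OF this neg(2)] obtain d where d: "0 < d"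
    "\<And>y. dist y x < d \<Longrightarrow> inv_density y < inv_density x / 2"
    unfolding eventually_nhds_metric by blast
  have "x - d < x" "x < x + d" using d(1) by simp_all
  from non_atom_between[OF this(1)] non_atom_between[OF this(2)]
  obtain a b where a: "x - d < a" "a < x" "measure M {a} = 0" and b: "x < b" "b < x + d" "measure M {b} = 0"
    by metis
  have "(LBINT y. indicator {a..b} y *\<^sub>R inv_density y) \<le> (LBINT y. indicator {a..b} y *\<^sub>R (inv_density x / 2))"
  proof (rule integral_mono[OF set_integrable_inv_density])
    show "integrable lborel (\<lambda>y. indicator {a..b} y *\<^sub>R (inv_density x / 2))"
      by (rule borel_integrable_compact) (auto intro!: continuous_intros)
    fix y show "indicator {a..b} y *\<^sub>R inv_density y \<le> indicator {a..b} y *\<^sub>R (inv_density x / 2)"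
      using d(2)[of y] a b by (auto simp: indicator_def dist_real_def less_imp_le)
  qed
  also have "\<dots> = (b - a) * (inv_density x / 2)" using a b by simp
  also have "\<dots> < 0" using a b neg(1) by (intro mult_pos_neg) simp_all
  finally show False
    using measure_Ioc_inversion[of a b] a b measure_nonneg[of M "{a<..b}"] by simp
qed

text \<open>By inversion, an interval around x with non-atomic endpoints has measure at most its
  length times a bound for the density. This frees the inversion formula from its condition on
  endpoints.\<close>

lemma no_atoms: "measure M {x} = 0"
proof -
  define B where "B = (LBINT t. norm (char M t))"
  have le: "measure M {x} \<le> B * (2 * d)" if d: "0 < d" for d
  proof -
    have "x - d < x" "x < x + d" using d by simp_all
    from non_atom_between[OF this(1)] non_atom_between[OF this(2)]
    obtain a b where a: "x - d < a" "a < x" "measure M {a} = 0" and b: "x < b" "b < x + d" "measure M {b} = 0"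
      by metis
    have "measure M {x} \<le> measure M {a<..b}"
      using a b by (intro finite_measure_mono) auto
    also have "\<dots> = (LBINT y. indicator {a..b} y *\<^sub>R inv_density y)"
      using a b by (intro measure_Ioc_inversion) auto
    also have "\<dots> \<le> (LBINT y. indicator {a..b} y *\<^sub>R B)"
    proof (rule integral_mono[OF set_integrable_inv_density])
      show "integrable lborel (\<lambda>y. indicator {a..b} y *\<^sub>R B)"
        by (rule borel_integrable_compact) (auto intro!: continuous_intros)
      fix y show "indicator {a..b} y *\<^sub>R inv_density y \<le> indicator {a..b} y *\<^sub>R B"
        using inv_density_bounded[of y] by (auto simp: indicator_def B_def)
    qed
    also have "\<dots> = (b - a) * B" using a b by simp
    also have "\<dots> \<le> (2 * d) * B" using a b by (intro mult_right_mono) (auto simp: B_def)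
    finally show ?thesis by (simp add: mult.commute)
  qed
  have "measure M {x} \<le> B * (2 * 0)"
  proof (rule tendsto_lowerbound[of "\<lambda>d. B * (2 * d)" _ "at_right (0::real)"])
    show "((\<lambda>d. B * (2 * d)) \<longlongrightarrow> B * (2 * 0)) (at_right 0)"
      by (intro tendsto_mult tendsto_const tendsto_ident_at)
    show "\<forall>\<^sub>F d in at_right (0::real). measure M {x} \<le> B * (2 * d)"
      using eventually_at_right_less[of "0 :: real"] by (rule eventually_mono) (rule le)
  qed simp
  then show ?thesis using measure_nonneg[of M "{x}"] by simp
qed

lemma eq_density: "M = density lborel (\<lambda>x. ennreal (inv_density x))"
proof (rule measure_eqI_lessThan)
  have Ioc: "emeasure M {x<..y} = emeasure (density lborel (\<lambda>x. ennreal (inv_density x))) {x<..y}" if "x \<le> y" for x y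
  proof -
    have "emeasure (density lborel (\<lambda>x. ennreal (inv_density x))) {x<..y}
        = (\<integral>\<^sup>+z. ennreal (inv_density z) * indicator {x<..y} z \<partial>lborel)"
      by (rule emeasure_density) simp_all
    also have "\<dots> = (\<integral>\<^sup>+z. ennreal (indicator {x..y} z *\<^sub>R inv_density z) \<partial>lborel)"
      by (rule nn_integral_cong_AE, use AE_lborel_singleton[of x] in eventually_elim) (auto simp: indicator_def)
    also have "\<dots> = ennreal (LBINT z. indicator {x..y} z *\<^sub>R inv_density z)"
      by (rule nn_integral_eq_integral[OF set_integrable_inv_density]) (simp add: inv_density_nonneg)
    also have "\<dots> = emeasure M {x<..y}"
      using measure_Ioc_inversion[OF that no_atoms no_atoms] by (simp add: emeasure_eq_measure)
    finally show ?thesis by (rule sym)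
  qed
  fix x :: real
  have Un: "{x<..} = (\<Union>n. {x<..x + real n})"
  proof -
    have "\<exists>n. y \<le> x + real n" for y using real_arch_simple[of "y - x"] by (auto simp: algebra_simps)
    then show ?thesis by auto
  qed
  have inc: "incseq (\<lambda>n. {x<..x + real n})" by (auto simp: incseq_def)
  have "emeasure M {x<..} = (SUP n. emeasure M {x<..x + real n})"
    unfolding Un by (rule SUP_emeasure_incseq[symmetric]) (use inc in auto)
  also have "\<dots> = (SUP n. emeasure (density lborel (\<lambda>x. ennreal (inv_density x))) {x<..x + real n})"
    by (intro SUP_cong refl Ioc) simp
  also have "\<dots> = emeasure (density lborel (\<lambda>x. ennreal (inv_density x))) {x<..}"
    unfolding Un by (rule SUP_emeasure_incseq) (use inc in auto)
  finally show "emeasure M {x<..} = emeasure (density lborel (\<lambda>x. ennreal (inv_density x))) {x<..}" .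
  show "emeasure M {x<..} < \<infinity>" using emeasure_finite[of "{x<..}"] by (simp add: less_top[symmetric])
qed simp_all

end
end

text \<open>The upper bound follows from the Taylor bound for exp x and (1 - x + x^2/2)(1 + x +
  x^2/2) = 1 + x^4/4 >= 1.\<close>

lemma exp_minus_quadratic:
  fixes x :: real
  assumes "0 \<le> x"
  shows "0 \<le> exp (- x) - 1 + x" "exp (- x) - 1 + x \<le> x\<^sup>2 / 2"
proof -
  show "0 \<le> exp (- x) - 1 + x" using exp_ge_add_one_self[of "- x"] by simp
  have "1 + x + x\<^sup>2 / 2 \<le> exp x" by (rule exp_lower_Taylor_quadratic[OF assms])
  have "0 \<le> 1 - x + x\<^sup>2 / 2"
  proof -
    have eq: "1 - x + x\<^sup>2 / 2 = ((1 - x)\<^sup>2 + 1) / 2" by (simp add: power2_eq_square field_simps)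
    show ?thesis unfolding eq by (intro divide_nonneg_nonneg add_nonneg_nonneg) simp_all
  qed
  then have "(1 - x + x\<^sup>2 / 2) * (1 + x + x\<^sup>2 / 2) \<le> (1 - x + x\<^sup>2 / 2) * exp x"
    using \<open>1 + x + x\<^sup>2 / 2 \<le> exp x\<close> by (rule mult_left_mono[rotated])
  moreover have "(1 - x + x\<^sup>2 / 2) * (1 + x + x\<^sup>2 / 2) = 1 + (x\<^sup>2)\<^sup>2 / 4"
    by (simp add: power2_eq_square field_simps)
  ultimately have "1 \<le> (1 - x + x\<^sup>2 / 2) * exp x"
    using zero_le_power2[of "x\<^sup>2"] by linarith
  then have "1 * exp (- x) \<le> (1 - x + x\<^sup>2 / 2) * exp x * exp (- x)"
    by (intro mult_right_mono) simp_all
  then show "exp (- x) - 1 + x \<le> x\<^sup>2 / 2" by (simp add: mult.assoc exp_minus)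
qed

text \<open>Densities agree almost everywhere, and two continuous functions that differ at a point
  differ on an interval of positive length.\<close>

lemma continuous_density_unique:
  fixes f g :: "real \<Rightarrow> real"
  assumes cont: "continuous_on UNIV f" "continuous_on UNIV g" and nonneg: "\<And>x. 0 \<le> f x" "\<And>x. 0 \<le> g x"
    and eq: "density lborel (\<lambda>x. ennreal (f x)) = density lborel (\<lambda>x. ennreal (g x))"
    and fin: "finite_measure (density lborel (\<lambda>x. ennreal (g x)))"
  shows "f = g"
proof (rule ext, rule ccontr)
  fix x assume ne: "f x \<noteq> g x"
  have [measurable]: "f \<in> borel_measurable borel" "g \<in> borel_measurable borel"
    using cont by (simp_all add: borel_measurable_continuous_onI)
  have "AE x in lborel. ennreal (f x) = ennreal (g x)"
  proof (rule sigma_finite_measure.density_unique)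
    show "sigma_finite_measure lborel" by (rule sigma_finite_lborel)
  qed (simp_all add: eq)
  then have ae: "AE x in lborel. f x = g x"
    by eventually_elim (use nonneg in \<open>simp add: ennreal_inj\<close>)
  have "open {x. f x \<noteq> g x}"
    using cont by (rule open_Collect_neq)
  then obtain e where e: "0 < e" "ball x e \<subseteq> {x. f x \<noteq> g x}"
    using ne by (auto simp: open_contains_ball)
  have "AE y in lborel. y \<notin> {x - e<..<x + e}"
    using ae
  proof eventually_elim
    case (elim y)
    show ?case
    proof
      assume "y \<in> {x - e<..<x + e}"
      then have "y \<in> ball x e" by (auto simp: dist_real_def abs_less_iff)
      with e(2) elim show False by blast
    qed
  qed
  then have "{x - e<..<x + e} \<in> null_sets lborel"
    by (subst AE_iff_null_sets) simp_all
  then show False using e(1) by (auto simp: null_sets_def)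
qed

section \<open>Decay of the characteristic function and the continuous density of V_j\<close>

context splitting
begin

lemma Phi_quadratic_real: assumes "0 \<le> t" shows "norm (Phi (of_real t) - 1 + of_real t) \<le> t\<^sup>2 / lam"
proof -
  have 1: "norm (1 - exp (- (of_real t / of_real L :: complex))) \<le> norm (of_real t / of_real L :: complex)"
    and 2: "norm (exp (- (of_real t / of_real L :: complex)) - 1 + of_real t / of_real L) \<le> (norm (of_real t / of_real L :: complex))\<^sup>2 / lam"
    if "0 < L" for L
  proof -
    define x where "x = t / L"
    have x: "0 \<le> x" using assms that by (simp add: x_def)
    have cx: "of_real t / of_real L = complex_of_real x" by (simp add: x_def)
    have e: "exp (- complex_of_real x) = of_real (exp (- x))" by (simp add: exp_of_real[symmetric] del: exp_of_real)
    have "1 - exp (- complex_of_real x) = of_real (1 - exp (- x))" unfolding e by simp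
    moreover have "\<bar>1 - exp (- x)\<bar> \<le> x" using exp_minus_quadratic(1)[OF x] x by simp
    ultimately show "norm (1 - exp (- (of_real t / of_real L :: complex))) \<le> norm (of_real t / of_real L :: complex)"
      unfolding cx norm_of_real using x by (simp only: norm_of_real abs_of_nonneg)
    have "exp (- complex_of_real x) - 1 + of_real x = of_real (exp (- x) - 1 + x)" unfolding e by simp
    moreover have "\<bar>exp (- x) - 1 + x\<bar> \<le> x\<^sup>2 / 2" using exp_minus_quadratic[OF x] by simp
    moreover have "x\<^sup>2 / 2 \<le> x\<^sup>2 / lam" using p_pos p_less_1 by (intro divide_left_mono) simp_all
    ultimately show "norm (exp (- (of_real t / of_real L :: complex)) - 1 + of_real t / of_real L) \<le> (norm (of_real t / of_real L :: complex))\<^sup>2 / lam"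
      unfolding cx norm_of_real using x by (simp only: norm_of_real abs_of_nonneg)
  qed
  have "0 \<le> Re (of_real t)" using assms by simp
  from Phi_quadratic[OF this 1 2] show ?thesis by simp
qed

lemma Phi_quadratic_imag: "norm (Phi (- \<i> * of_real t) - 1 + (- \<i> * of_real t)) \<le> t\<^sup>2 / lam"
proof -
  have 1: "norm (1 - exp (- ((- \<i> * of_real t) / of_real L))) \<le> norm ((- \<i> * of_real t) / of_real L :: complex)"
    and 2: "norm (exp (- ((- \<i> * of_real t) / of_real L)) - 1 + (- \<i> * of_real t) / of_real L) \<le> (norm ((- \<i> * of_real t) / of_real L :: complex))\<^sup>2 / lam"
    if "0 < L" for L
  proof -
    define x where "x = t / L"
    have cx: "(- \<i> * of_real t) / of_real L = - (\<i> * complex_of_real x)" by (simp add: x_def)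
    have nx: "norm (- (\<i> * complex_of_real x)) = \<bar>x\<bar>" by (simp add: norm_mult)
    have "norm (iexp x - 1) \<le> \<bar>x\<bar>" using iexp_approx1[of x 0] by simp
    then show "norm (1 - exp (- ((- \<i> * of_real t) / of_real L))) \<le> norm ((- \<i> * of_real t) / of_real L :: complex)"
      unfolding cx nx by (simp add: norm_minus_commute)
    have "norm (iexp x - (1 + \<i> * x)) \<le> \<bar>x\<bar>\<^sup>2 / 2" using iexp_approx1[of x 1] by (simp add: power2_eq_square)
    also have "\<dots> \<le> \<bar>x\<bar>\<^sup>2 / lam" using p_pos p_less_1 by (intro divide_left_mono) simp_all
    finally show "norm (exp (- ((- \<i> * of_real t) / of_real L)) - 1 + (- \<i> * of_real t) / of_real L) \<le> (norm ((- \<i> * of_real t) / of_real L :: complex))\<^sup>2 / lam"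
      unfolding cx nx by (simp add: diff_diff_eq)
  qed
  have "0 \<le> Re (- \<i> * of_real t)" by simp
  from Phi_quadratic[OF this 1 2] show ?thesis by (simp add: norm_mult)
qed

lemma continuous_Phi:
  assumes "\<And>n. 0 \<le> Re (u n)" "0 \<le> Re z" "u \<longlonglongrightarrow> z"
  shows "(\<lambda>n. Phi (u n)) \<longlonglongrightarrow> Phi z"
  unfolding Phi_def
proof (rule integral_dominated_convergence[where w = "\<lambda>_. 1"])
  show "AE \<omega> in M. (\<lambda>n. exp (- u n * complex_of_real (V p 1 \<omega>))) \<longlonglongrightarrow> exp (- z * of_real (V p 1 \<omega>))"
    by (intro AE_I2 tendsto_exp tendsto_mult tendsto_minus assms(3) tendsto_const)
  show "AE \<omega> in M. norm (exp (- u n * complex_of_real (V p 1 \<omega>))) \<le> 1" for n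
    using AE_V_nonneg[of 1] by eventually_elim (use assms(1)[of n] in simp)
  show "(\<lambda>\<omega>. exp (- u n * complex_of_real (V p 1 \<omega>))) \<in> borel_measurable M" for n by measurable
  show "(\<lambda>\<omega>. exp (- z * complex_of_real (V p 1 \<omega>))) \<in> borel_measurable M" by measurable
  show "integrable M (\<lambda>_. 1 :: real)" by (rule P.integrable_const)
qed

definition bmod :: "real \<Rightarrow> real" where
  "bmod t = norm (Phi (- \<i> * of_real t))"

lemma bmod_le_1: "0 \<le> bmod t" "bmod t \<le> 1"
  unfolding bmod_def by (simp_all add: norm_Phi_le)

lemma Phi_imag_lam: "Phi (- \<i> * of_real (lam * t)) = F p (Phi (- \<i> * of_real t))"
  using Phi_lam[of "- \<i> * of_real t"] by (simp add: algebra_simps)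

lemma bmod_lam: "bmod (lam * t) \<le> bmod t * (1 - p + p * bmod t)"
  unfolding bmod_def Phi_imag_lam by (rule F_norm_le)

text \<open>Equality in |w| |1-p + p w| <= 1 for |w| <= 1 forces Re w = 1, since p (1-p) > 0, and
  hence w = 1.\<close>

lemma bmod_eq_1: assumes "bmod (lam * t) = 1" shows "Phi (- \<i> * of_real t) = 1"
proof -
  define w where "w = Phi (- \<i> * of_real t)"
  have w1: "norm w \<le> 1" unfolding w_def by (rule norm_Phi_le) simp
  have "F p w = w * (of_real (1 - p) + of_real p * w)"
    by (simp add: F_def power2_eq_square algebra_simps)
  then have "1 = norm w * norm (of_real (1 - p) + of_real p * w)"
    using assms unfolding bmod_def Phi_imag_lam w_def by (simp only: norm_mult)
  also have "\<dots> \<le> 1 * norm (of_real (1 - p) + of_real p * w)" using w1 by (intro mult_right_mono) simp_all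
  finally have "1 \<le> (norm (of_real (1 - p) + of_real p * w))\<^sup>2" by (simp add: one_le_power)
  also have "\<dots> = (1 - p)\<^sup>2 + 2 * (p * (1 - p)) * Re w + p\<^sup>2 * (norm w)\<^sup>2"
    unfolding cmod_power2 by (simp add: power2_eq_square algebra_simps)
  also have "\<dots> \<le> (1 - p)\<^sup>2 + 2 * (p * (1 - p)) * Re w + p\<^sup>2 * 1"
    using w1 by (intro add_left_mono mult_left_mono) (simp_all add: power_le_one)
  finally have "2 * (p * (1 - p)) * 1 \<le> 2 * (p * (1 - p)) * Re w"
    by (simp add: power2_eq_square algebra_simps)
  then have "1 \<le> Re w" using p_pos p_less_1 by (subst (asm) mult_le_cancel_left_pos) simp_all
  moreover have "Re w \<le> norm w" by (rule complex_Re_le_cmod)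
  ultimately have Re: "Re w = 1" "norm w = 1" using w1 by linarith+
  have "(norm w)\<^sup>2 = (Re w)\<^sup>2 + (Im w)\<^sup>2" by (rule cmod_power2)
  then have "Im w = 0" using Re by simp
  then show ?thesis using Re by (simp add: w_def complex_eq_iff)
qed

text \<open>Otherwise the transform equals 1 at all t / lam^(n+1), which contradicts its first order
  expansion at small arguments.\<close>

lemma bmod_less_1: assumes "t \<noteq> 0" shows "bmod t < 1"
proof (rule ccontr)
  assume "\<not> bmod t < 1"
  then have b: "bmod t = 1" using bmod_le_1[of t] by simp
  have one: "Phi (- \<i> * of_real (t / lam ^ Suc n)) = 1" for n
  proof (induction n)
    case 0
    show ?case by (rule bmod_eq_1) (use b p_pos in simp)
  next
    case (Suc n)
    have "lam * (t / lam ^ Suc (Suc n)) = t / lam ^ Suc n" using p_pos by simp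
    then have "bmod (lam * (t / lam ^ Suc (Suc n))) = 1" unfolding bmod_def by (simp only: Suc norm_one)
    then show ?case by (rule bmod_eq_1)
  qed
  obtain n where n: "\<bar>t\<bar> < lam ^ n" using real_arch_pow[of lam "\<bar>t\<bar>"] p_pos by auto
  define y where "y = t / lam ^ Suc n"
  have one_y: "Phi (- \<i> * of_real y) = 1" unfolding y_def by (rule one)
  have "norm (1 - 1 + (- \<i> * complex_of_real y)) \<le> y\<^sup>2 / lam"
    using Phi_quadratic_imag[of y] unfolding one_y .
  then have "\<bar>y\<bar> \<le> \<bar>y\<bar> * \<bar>y\<bar> / lam" by (simp add: norm_mult power2_eq_square)
  then have "\<bar>y\<bar> * lam \<le> \<bar>y\<bar> * \<bar>y\<bar>" using p_pos by (simp add: pos_le_divide_eq)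
  moreover have "0 < \<bar>y\<bar>" using assms p_pos by (simp add: y_def)
  ultimately have "lam \<le> \<bar>y\<bar>" by (simp only: mult_le_cancel_left_pos)
  moreover have "\<bar>y\<bar> < 1"
  proof -
    have "lam ^ n \<le> lam ^ Suc n" using p_pos by (intro power_increasing) simp_all
    with n have "\<bar>t\<bar> < lam ^ Suc n" by (rule less_le_trans)
    moreover have "0 < lam ^ Suc n" using p_pos by simp
    ultimately show ?thesis unfolding y_def abs_divide by (simp only: abs_of_pos pos_divide_less_eq mult_1_left)
  qed
  ultimately show False using p_pos by simp
qed

lemma continuous_Phi_imag: "continuous_on A (\<lambda>t. Phi (- \<i> * of_real t))"
proof (rule continuous_on_sequentiallyI)
  fix u :: "nat \<Rightarrow> real" and t assume u: "u \<longlonglongrightarrow> t"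
  show "(\<lambda>n. Phi (- \<i> * of_real (u n))) \<longlonglongrightarrow> Phi (- \<i> * of_real t)"
  proof (rule continuous_Phi)
    show "(\<lambda>n. - \<i> * complex_of_real (u n)) \<longlonglongrightarrow> - \<i> * of_real t"
      by (rule tendsto_mult[OF tendsto_const tendsto_of_real[OF u]])
  qed simp_all
qed

text \<open>On the fundamental domain 1 <= |t| <= lam the modulus is at most some m < 1; the
  recursion v -> v (1-p + p v) propagates this to all scales. First v tends to 0; then its ratio
  approaches 1-p, which beats the growth lam of the scale because lam (1-p) = 1 - p^2 < 1.\<close>

lemma bmod_summable:
  obtains v :: "nat \<Rightarrow> real" where "\<And>n. 0 \<le> v n" "summable (\<lambda>n. v n * lam ^ n)"
    "\<And>n t. 1 \<le> \<bar>t\<bar> \<Longrightarrow> \<bar>t\<bar> \<le> lam \<Longrightarrow> bmod (lam ^ n * t) \<le> v n"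
proof -
  let ?K = "{- lam..- 1} \<union> {1..lam}"
  have cont: "continuous_on ?K bmod"
    unfolding bmod_def by (intro continuous_on_norm continuous_Phi_imag)
  have comp: "compact ?K" by (intro compact_Un compact_Icc)
  have "1 \<in> ?K" using p_pos by simp
  then have ne: "?K \<noteq> {}" by (metis empty_iff)
  from continuous_attains_sup[OF comp ne cont]
  obtain t0 where t0: "t0 \<in> ?K" "\<forall>t\<in>?K. bmod t \<le> bmod t0" by (elim bexE) (rule that)
  define m where "m = bmod t0"
  have m: "0 \<le> m" "m < 1" unfolding m_def using t0(1) by (auto intro: bmod_le_1 bmod_less_1)
  define v where "v n = rec_nat m (\<lambda>_ x. x * (1 - p + p * x)) n" for n
  have v_0: "v 0 = m" and v_Suc: "v (Suc n) = v n * (1 - p + p * v n)" for n by (simp_all add: v_def)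
  define s where "s = 1 - p + p * m"
  have s: "0 \<le> s" "s < 1" using m p_pos p_less_1 by (simp_all add: s_def)
  have vb: "0 \<le> v n \<and> v n \<le> m * s ^ n" for n
  proof (induction n)
    case (Suc n)
    have "m * s ^ n \<le> m * 1" using m s by (intro mult_left_mono power_le_one) simp_all
    then have "v n \<le> m" using Suc by linarith
    then have "1 - p + p * v n \<le> s" "0 \<le> 1 - p + p * v n"
      using p_pos p_less_1 Suc by (simp_all add: s_def add_nonneg_nonneg)
    then have "v n * (1 - p + p * v n) \<le> (m * s ^ n) * s" "0 \<le> v n * (1 - p + p * v n)"
      using Suc m s by (intro mult_mono, simp_all)
    then show ?case unfolding v_Suc by (simp add: mult.commute mult.left_commute)
  qed (simp add: v_0 m)
  have "(\<lambda>n. m * s ^ n) \<longlonglongrightarrow> m * 0" using s by (intro tendsto_mult tendsto_const LIMSEQ_realpow_zero)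
  then have lim: "(\<lambda>n. m * s ^ n) \<longlonglongrightarrow> 0" by simp
  have "0 < p / 2" using p_pos by simp
  from order_tendstoD(2)[OF lim this] have "eventually (\<lambda>n. m * s ^ n < p / 2) sequentially" .
  then obtain N where N: "\<And>n. n \<ge> N \<Longrightarrow> m * s ^ n < p / 2" unfolding eventually_sequentially by blast
  show ?thesis
  proof (rule that[of v])
    show "0 \<le> v n" for n using vb[of n] by blast
    show "summable (\<lambda>n. v n * lam ^ n)"
    proof (rule summable_ratio_test)
      \<comment> \<open>The threshold v <= p/2, in force from N on, is small enough for the ratio
        test: the product is 1 - p^2 (1-p)/2.\<close>
      show "lam * (1 - p + p * (p / 2)) < 1"
      proof -
        have "lam * (1 - p + p * (p / 2)) = 1 - p\<^sup>2 * ((1 - p) / 2)"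
          by (simp add: power2_eq_square field_simps)
        then show ?thesis using p_pos p_less_1 by simp
      qed
      fix n assume n: "n \<ge> N"
      have "v n \<le> p / 2" using vb[of n] N[OF n] by linarith
      then have "v n * (1 - p + p * v n) \<le> v n * (1 - p + p * (p / 2))"
        using vb[of n] p_pos by (intro mult_left_mono add_left_mono) simp_all
      then have "v (Suc n) * lam ^ Suc n \<le> v n * (1 - p + p * (p / 2)) * lam ^ Suc n"
        unfolding v_Suc using p_pos by (intro mult_right_mono) simp_all
      also have "\<dots> = lam * (1 - p + p * (p / 2)) * (v n * lam ^ n)" by (simp only: power_Suc mult_ac)
      finally show "norm (v (Suc n) * lam ^ Suc n) \<le> lam * (1 - p + p * (p / 2)) * norm (v n * lam ^ n)"
        using vb[of n] vb[of "Suc n"] p_pos by (simp add: abs_mult del: power_Suc)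
    qed
    fix n t assume t: "1 \<le> \<bar>t\<bar>" "\<bar>t\<bar> \<le> lam"
    show "bmod (lam ^ n * t) \<le> v n"
    proof (induction n)
      case 0
      have "t \<in> ?K" using t by (auto simp: abs_if split: if_splits)
      with t0(2) have "bmod t \<le> bmod t0" by (rule bspec)
      then show ?case by (simp add: v_0 m_def)
    next
      case (Suc n)
      have "bmod (lam * (lam ^ n * t)) \<le> bmod (lam ^ n * t) * (1 - p + p * bmod (lam ^ n * t))"
        by (rule bmod_lam)
      also have "\<dots> \<le> v n * (1 - p + p * v n)"
        using Suc bmod_le_1(1)[of "lam ^ n * t"] p_pos p_less_1
        by (intro mult_mono add_left_mono mult_left_mono) (simp_all add: add_nonneg_nonneg)
      finally show ?case unfolding v_Suc by (simp add: mult.assoc)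
    qed
  qed
qed

text \<open>Outside [-1,1] the line is covered by the shells lam^n <= |t| <= lam^(n+1). On the n-th
  one the modulus is at most v_n, and its length is at most 2 lam^(n+1).\<close>

lemma integrable_bmod: "(\<integral>\<^sup>+t. ennreal (bmod t) \<partial>lborel) < \<infinity>"
proof -
  obtain v where v: "\<And>n. 0 \<le> v n" "summable (\<lambda>n. v n * lam ^ n)"
    "\<And>n t. 1 \<le> \<bar>t\<bar> \<Longrightarrow> \<bar>t\<bar> \<le> lam \<Longrightarrow> bmod (lam ^ n * t) \<le> v n"
    by (rule bmod_summable) (rule that)
  let ?I = "\<lambda>n. {- (lam ^ Suc n)..lam ^ Suc n}"
  have "ennreal (bmod t) \<le> indicator {-1..1} t + (\<Sum>n. ennreal (v n) * indicator (?I n) t)" for t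
  proof (cases "\<bar>t\<bar> \<le> 1")
    case True
    then have "ennreal (bmod t) \<le> indicator {-1..1} t"
      using bmod_le_1[of t] by (auto simp: indicator_def abs_le_iff ennreal_le_1)
    then show ?thesis by (rule order_trans) simp
  next
    case False
    obtain N where "\<bar>t\<bar> < lam ^ N" using real_arch_pow[of lam "\<bar>t\<bar>"] p_pos by auto
    also have "lam ^ N \<le> lam ^ Suc N" using p_pos by (intro power_increasing) simp_all
    finally have ex: "\<bar>t\<bar> < lam ^ Suc N" .
    define n where "n = (LEAST k. \<bar>t\<bar> < lam ^ Suc k)"
    have n1: "\<bar>t\<bar> < lam ^ Suc n" unfolding n_def by (rule LeastI[of _ N]) (rule ex)
    have n2: "lam ^ n \<le> \<bar>t\<bar>"
    proof (cases n)
      case 0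
      then show ?thesis using False by simp
    next
      case (Suc k)
      then have "k < n" by simp
      then have "\<not> \<bar>t\<bar> < lam ^ Suc k" unfolding n_def by (rule not_less_Least)
      then show ?thesis using Suc by simp
    qed
    have L: "0 < lam ^ n" using p_pos by simp
    have "bmod (lam ^ n * (t / lam ^ n)) \<le> v n"
    proof (rule v(3))
      show "1 \<le> \<bar>t / lam ^ n\<bar>" "\<bar>t / lam ^ n\<bar> \<le> lam"
        using n1 n2 L by (simp_all add: abs_divide pos_le_divide_eq pos_divide_le_eq)
    qed
    moreover have "x * (t / x) = t" if "x \<noteq> 0" for x using that by simp
    ultimately have "bmod t \<le> v n" using L by (metis less_irrefl)
    then have "ennreal (bmod t) \<le> ennreal (v n) * indicator (?I n) t"
      using n1 by (auto simp: indicator_def abs_less_iff ennreal_leI)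
    also have "\<dots> \<le> (\<Sum>k. ennreal (v k) * indicator (?I k) t)"
    proof -
      have "g n \<le> suminf g" for g :: "nat \<Rightarrow> ennreal"
        using sum_le_suminf[of g "{n}"] by simp
      then show ?thesis .
    qed
    finally show ?thesis by (rule order_trans) simp
  qed
  then have "(\<integral>\<^sup>+t. ennreal (bmod t) \<partial>lborel)
      \<le> (\<integral>\<^sup>+t. indicator {-1..1} t + (\<Sum>n. ennreal (v n) * indicator (?I n) t) \<partial>lborel)"
    by (intro nn_integral_mono)
  also have "\<dots> = (\<integral>\<^sup>+t. indicator {-1..1::real} t \<partial>lborel)
      + (\<Sum>n. \<integral>\<^sup>+t. ennreal (v n) * indicator (?I n) t \<partial>lborel)"
    by (subst nn_integral_add) (simp_all add: nn_integral_suminf)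
  also have "(\<integral>\<^sup>+t. indicator {-1..1::real} t \<partial>lborel) = ennreal 2" by simp
  also have "(\<lambda>n. \<integral>\<^sup>+t. ennreal (v n) * indicator (?I n) t \<partial>lborel) = (\<lambda>n. ennreal (2 * lam * (v n * lam ^ n)))"
  proof
    fix n
    have "0 < lam ^ Suc n" using p_pos by simp
    then have "(\<integral>\<^sup>+t. ennreal (v n) * indicator (?I n) t \<partial>lborel) = ennreal (v n) * ennreal (2 * lam ^ Suc n)"
      by (simp add: nn_integral_cmult_indicator del: power_Suc)
    also have "\<dots> = ennreal (2 * lam * (v n * lam ^ n))"
      using v(1)[of n] p_pos by (subst ennreal_mult[symmetric]) (simp_all add: mult_ac)
    finally show "(\<integral>\<^sup>+t. ennreal (v n) * indicator (?I n) t \<partial>lborel) = ennreal (2 * lam * (v n * lam ^ n))" .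
  qed
  also have "(\<Sum>n. ennreal (2 * lam * (v n * lam ^ n))) = ennreal (\<Sum>n. 2 * lam * (v n * lam ^ n))"
    using v p_pos by (intro suminf_ennreal2 summable_mult) simp_all
  finally show ?thesis by (simp add: ennreal_less_top le_less_trans ennreal_plus[symmetric] del: ennreal_plus)
qed

abbreviation "law j \<equiv> distr M borel (V p j)"

lemma real_distribution_law: "real_distribution (law j)"
  by (rule P.real_distribution_distr) measurable

lemma char_law: "char (law j) t = Phi (- \<i> * of_real t) ^ j"
proof -
  have "char (law j) t = P.expectation (\<lambda>\<omega>. exp (- (- \<i> * of_real t) * of_real (V p j \<omega>)))"
    unfolding char_def by (subst integral_distr) (simp_all add: mult_ac)
  also have "\<dots> = Phi (- \<i> * of_real t) ^ j" by (rule Laplace_V) simp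
  finally show ?thesis .
qed

lemma integrable_char_law: assumes "1 \<le> j" shows "integrable lborel (char (law j))"
proof (rule integrableI_bounded)
  interpret R: real_distribution "law j" by (rule real_distribution_law)
  have "continuous_on UNIV (\<lambda>t. Phi (- \<i> * of_real t) ^ j)"
    by (intro continuous_on_power continuous_Phi_imag)
  then have "continuous_on UNIV (char (law j))" by (simp only: char_law[abs_def])
  then show "char (law j) \<in> borel_measurable lborel" by (simp add: borel_measurable_continuous_onI)
  have "norm (char (law j) t) \<le> bmod t" for t
  proof -
    have "norm (char (law j) t) = bmod t ^ j" by (simp add: char_law norm_power bmod_def)
    also have "\<dots> \<le> bmod t ^ 1" using assms bmod_le_1[of t] by (intro power_decreasing) simp_all
    finally show ?thesis by simp
  qed
  then have "(\<integral>\<^sup>+t. ennreal (norm (char (law j) t)) \<partial>lborel) \<le> (\<integral>\<^sup>+t. ennreal (bmod t) \<partial>lborel)"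
    by (intro nn_integral_mono ennreal_leI)
  then show "(\<integral>\<^sup>+t. ennreal (norm (char (law j) t)) \<partial>lborel) < \<infinity>"
    using integrable_bmod by (rule le_less_trans)
qed

text \<open>The description defining \<open>w\<close> picks out a unique function: the Fourier
  inversion density exists because the characteristic function is integrable, and continuity makes
  it unique.\<close>

lemma w_density:
  assumes "1 \<le> j"
  shows "continuous_on UNIV (w p j)" "\<And>y. 0 \<le> w p j y" "law j = density lborel (\<lambda>y. ennreal (w p j y))"
proof -
  interpret R: real_distribution "law j" by (rule real_distribution_law)
  note int = integrable_char_law[OF assms]
  let ?P = "\<lambda>f. continuous_on UNIV f \<and> (\<forall>y. 0 \<le> f y) \<and> distributed M lborel (V p j) (\<lambda>y. ennreal (f y))"
  have V: "distr M lborel (V p j) = law j" by (rule distr_cong) simp_all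
  have "?P R.inv_density"
    using R.continuous_inv_density[OF int] R.inv_density_nonneg[OF int] R.eq_density[OF int] R.borel_inv_density[OF int]
    unfolding distributed_def V by simp
  moreover have "f = R.inv_density" if f: "?P f" for f
  proof (rule continuous_density_unique)
    show "density lborel (\<lambda>x. ennreal (f x)) = density lborel (\<lambda>x. ennreal (R.inv_density x))"
      using f R.eq_density[OF int] unfolding distributed_def V by simp
    show "finite_measure (density lborel (\<lambda>x. ennreal (R.inv_density x)))"
      using R.finite_measure_axioms R.eq_density[OF int] by simp
  qed (use f R.continuous_inv_density[OF int] R.inv_density_nonneg[OF int] in simp_all)
  ultimately have "\<exists>!f. ?P f" by (rule ex1I)
  from theI'[OF this] have "?P (w p j)" unfolding w_def .
  then show "continuous_on UNIV (w p j)" "\<And>y. 0 \<le> w p j y" "law j = density lborel (\<lambda>y. ennreal (w p j y))"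
    unfolding distributed_def V by simp_all
qed

end

lemma infsum_int_split:
  fixes f :: "int \<Rightarrow> real"
  assumes "\<And>l. 0 \<le> f l" "summable (\<lambda>n. f (int n))" "summable (\<lambda>n. f (- int (Suc n)))"
  shows "infsum f UNIV = (\<Sum>n. f (int n)) + (\<Sum>n. f (- int (Suc n)))"
proof -
  let ?g = "\<lambda>n. - int (Suc n)"
  have "((f \<circ> int) has_sum (\<Sum>n. f (int n))) UNIV"
    unfolding o_def using assms by (intro norm_summable_imp_has_sum summable_sums) simp_all
  then have 1: "(f has_sum (\<Sum>n. f (int n))) (range int)"
    by (subst has_sum_reindex) simp_all
  have "((f \<circ> ?g) has_sum (\<Sum>n. f (?g n))) UNIV"
    unfolding o_def using assms by (intro norm_summable_imp_has_sum summable_sums) simp_all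
  then have 2: "(f has_sum (\<Sum>n. f (?g n))) (range ?g)"
    by (subst has_sum_reindex) (simp_all add: inj_on_def)
  have un: "range int \<union> range ?g = UNIV"
  proof -
    have "l \<in> range int \<union> range ?g" for l
    proof (cases "0 \<le> l")
      case True
      then have "l = int (nat l)" by simp
      then show ?thesis by blast
    next
      case False
      then have "l = ?g (nat (- l - 1))" by simp
      then show ?thesis by blast
    qed
    then show ?thesis by blast
  qed
  have "range int \<inter> range ?g = {}" by auto
  from has_sum_Un_disjoint[OF 1 2 this] show ?thesis unfolding un by (rule infsumI)
qed

section \<open>Constant Psi makes the periodic part a pure power\<close>

context splitting
begin

definition rphi :: "real \<Rightarrow> real" where
  "rphi t = P.expectation (\<lambda>\<omega>. exp (- t * V p 1 \<omega>))"

lemma Laplace_V_real: assumes "0 \<le> t"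
  shows "Phi (of_real t) = of_real (rphi t)" "P.expectation (\<lambda>\<omega>. exp (- t * V p j \<omega>)) = rphi t ^ j"
    "integrable M (\<lambda>\<omega>. exp (- t * V p j \<omega>))"
proof -
  have E: "P.expectation (\<lambda>\<omega>. exp (- of_real t * complex_of_real (V p j \<omega>)))
      = of_real (P.expectation (\<lambda>\<omega>. exp (- t * V p j \<omega>)))" for j
  proof -
    have "exp (- of_real t * complex_of_real (V p j \<omega>)) = of_real (exp (- t * V p j \<omega>))" for \<omega>
      by (simp add: exp_of_real[symmetric] del: exp_of_real)
    then show ?thesis by (simp only: integral_complex_of_real)
  qed
  show 1: "Phi (of_real t) = of_real (rphi t)" unfolding Phi_def rphi_def by (rule E)
  have "0 \<le> Re (of_real t)" using assms by simp
  from Laplace_V[OF this, of j] have "complex_of_real (P.expectation (\<lambda>\<omega>. exp (- t * V p j \<omega>))) = of_real (rphi t ^ j)"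
    unfolding E 1 by simp
  then show "P.expectation (\<lambda>\<omega>. exp (- t * V p j \<omega>)) = rphi t ^ j" by (simp only: of_real_eq_iff)
  show "integrable M (\<lambda>\<omega>. exp (- t * V p j \<omega>))"
  proof (rule P.integrable_const_bound[of _ 1])
    show "AE \<omega> in M. norm (exp (- t * V p j \<omega>)) \<le> 1"
      using AE_V_nonneg[of j] by eventually_elim (use assms in simp)
  qed measurable
qed

text \<open>The Laplace transform of W satisfies the assumptions of the analytic development, with
  the constant 1/lam coming from \<open>Phi_quadratic_real\<close>; all results on
  \<open>periodic_part\<close> apply to it.\<close>

sublocale L: splitting_laplace p rphi "1 / lam"
proof unfold_locales
  fix t :: real assume t: "0 \<le> t"
  have lt: "0 \<le> lam * t" using t p_pos by simp
  have Re: "0 \<le> Re (of_real t)" using t by simp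
  have "complex_of_real (rphi (lam * t)) = of_real (F p (rphi t))"
    using Phi_lam[OF Re] unfolding of_real_mult[symmetric] Laplace_V_real(1)[OF lt] Laplace_V_real(1)[OF t] F_of_real .
  then show "rphi (lam * t) = F p (rphi t)" by (simp only: of_real_eq_iff)
  show "0 \<le> rphi t" unfolding rphi_def by simp
  show "rphi t \<le> 1" using norm_Phi_le[OF Re] unfolding Laplace_V_real(1)[OF t] by simp
  have "complex_of_real (rphi t) - 1 + of_real t = of_real (rphi t - 1 + t)" by simp
  then show "\<bar>rphi t - 1 + t\<bar> \<le> 1 / lam * t\<^sup>2"
    using Phi_quadratic_real[OF t] unfolding Laplace_V_real(1)[OF t] by (simp only: norm_of_real) simp
next
  have "continuous_on {0..} (\<lambda>t. Phi (of_real t))"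
  proof (rule continuous_on_sequentiallyI)
    fix u :: "nat \<Rightarrow> real" and t assume u: "\<forall>n. u n \<in> {0..}" "t \<in> {0..}" "u \<longlonglongrightarrow> t"
    show "(\<lambda>n. Phi (of_real (u n))) \<longlonglongrightarrow> Phi (of_real t)"
      by (rule continuous_Phi) (use u in \<open>simp_all add: tendsto_of_real\<close>)
  qed
  then have "continuous_on {0..} (\<lambda>t. Re (Phi (of_real t)))" by (rule continuous_on_Re)
  then show "continuous_on {0..} rphi"
    by (rule continuous_on_eq) (simp add: Laplace_V_real(1))
qed

abbreviation "psi u \<equiv> exp (- u) - 1 + (u :: real)"

lemma psi_nonneg: "0 \<le> u \<Longrightarrow> 0 \<le> psi u"
  by (rule exp_minus_quadratic)

lemma psi_pos: assumes "0 < u" shows "0 < psi u"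
proof -
  have "1 - u < exp (- u)"
  proof (cases "u < 2")
    case True
    have "1 - u < (1 - u / 2)\<^sup>2" using assms by (simp add: power2_eq_square field_simps)
    also have "\<dots> \<le> (exp (- u / 2))\<^sup>2"
      using True exp_ge_add_one_self[of "- u / 2"] by (intro power_mono) simp_all
    also have "\<dots> = exp (- u)" by (simp add: power2_eq_square exp_add[symmetric])
    finally show ?thesis .
  next
    case False
    then have "1 - u < 0" by simp
    then show ?thesis using exp_gt_zero[of "- u"] by linarith
  qed
  then show ?thesis by simp
qed

lemma remainder_expectation: assumes "0 \<le> t"
  shows "L.remainder j t = P.expectation (\<lambda>\<omega>. psi (t * V p j \<omega>))" "integrable M (\<lambda>\<omega>. psi (t * V p j \<omega>))"
proof -
  note int = Laplace_V_real(3)[OF assms, of j]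
  show "integrable M (\<lambda>\<omega>. psi (t * V p j \<omega>))"
    using int V_expectation(1)[of j] by simp
  have "P.expectation (\<lambda>\<omega>. psi (t * V p j \<omega>)) = P.expectation (\<lambda>\<omega>. exp (- t * V p j \<omega>)) - 1 + t * P.expectation (V p j)"
    using int V_expectation(1)[of j] by (simp add: P.prob_space)
  then show "L.remainder j t = P.expectation (\<lambda>\<omega>. psi (t * V p j \<omega>))"
    unfolding Laplace_V_real(2)[OF assms] V_expectation(2) L.remainder_def by (simp add: mult.commute)
qed

lemma remainder_nonneg: assumes "0 \<le> t" shows "0 \<le> L.remainder j t"
  unfolding remainder_expectation(1)[OF assms]
proof (rule integral_nonneg_AE)
  show "AE \<omega> in M. 0 \<le> psi (t * V p j \<omega>)"
    using AE_V_nonneg[of j] by eventually_elim (intro psi_nonneg mult_nonneg_nonneg assms)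
qed

text \<open>As E V_j = j, the remainder is the mean of psi(t V_j). Restricting to y > 0 loses
  nothing: V_j >= 0 almost surely and psi(0) = 0.\<close>

lemma remainder_density:
  assumes t: "0 \<le> t" and j: "1 \<le> j"
  shows "ennreal (L.remainder j t) = (\<integral>\<^sup>+y. ennreal (psi (t * y)) * ennreal (w p j y) * indicator {0<..} y \<partial>lborel)"
proof -
  have wm: "w p j \<in> borel_measurable borel"
    using w_density(1)[OF j] by (rule borel_measurable_continuous_onI)
  have "ennreal (L.remainder j t) = (\<integral>\<^sup>+\<omega>. ennreal (psi (t * V p j \<omega>)) \<partial>M)"
    unfolding remainder_expectation(1)[OF t]
  proof (rule nn_integral_eq_integral[symmetric, OF remainder_expectation(2)[OF t]])
    show "AE \<omega> in M. 0 \<le> psi (t * V p j \<omega>)"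
      using AE_V_nonneg[of j] by eventually_elim (intro psi_nonneg mult_nonneg_nonneg t)
  qed
  also have "\<dots> = (\<integral>\<^sup>+\<omega>. ennreal (psi (t * V p j \<omega>)) * indicator {0<..} (V p j \<omega>) \<partial>M)"
  proof (rule nn_integral_cong_AE)
    show "AE \<omega> in M. ennreal (psi (t * V p j \<omega>)) = ennreal (psi (t * V p j \<omega>)) * indicator {0<..} (V p j \<omega>)"
      using AE_V_nonneg[of j] by eventually_elim (auto simp: indicator_def)
  qed
  also have "\<dots> = (\<integral>\<^sup>+y. ennreal (psi (t * y)) * indicator {0<..} y \<partial>law j)"
    by (rule nn_integral_distr[symmetric]) measurable
  also have "\<dots> = (\<integral>\<^sup>+y. ennreal (w p j y) * (ennreal (psi (t * y)) * indicator {0<..} y) \<partial>lborel)"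
    unfolding w_density(3)[OF j] by (rule nn_integral_density) (use wm in measurable)
  finally show ?thesis by (simp only: mult_ac)
qed

lemma rho_bounds: "1 < rho p" "rho p < 2" "lam powr rho p = apar"
proof -
  have l: "0 < ln lam" using p_pos by simp
  show "1 < rho p" unfolding rho_def using l p_pos by (simp add: pos_less_divide_eq)
  have "ln apar < ln (lam\<^sup>2)" using p_pos apar_less_lam_squared by (subst ln_less_cancel_iff) simp_all
  also have "ln (lam\<^sup>2) = 2 * ln lam" using p_pos by (simp add: ln_realpow)
  finally show "rho p < 2" unfolding rho_def using l by (simp add: pos_divide_less_eq)
  show "lam powr rho p = apar" unfolding rho_def powr_def using l p_pos by simp
qed

text \<open>The exponent rho lies in (1,2), so only C = 0 remains. That is excluded because every
  term of the two-sided sum is nonnegative and the term n = 0 at t = 2 is at least 2j - 1 >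
  0.\<close>

lemma periodic_part_not_power:
  assumes j: "1 \<le> j"
  shows "\<not> (\<exists>C. \<forall>t>0. L.periodic_part j t = C * t powr rho p)"
proof
  assume "\<exists>C. \<forall>t>0. L.periodic_part j t = C * t powr rho p"
  then obtain C where C: "\<And>t. 0 < t \<Longrightarrow> L.periodic_part j t = C * t powr rho p" by blast
  have "C = 0" by (rule L.periodic_part_not_pure_power[OF C rho_bounds(1,2)])
  then have zero: "L.periodic_part j 2 = 0" using C[of 2] by simp
  have nn: "0 \<le> L.remainder j (lam ^ n * 2) / apar ^ n" "0 \<le> apar ^ Suc n * L.remainder j (2 / lam ^ Suc n)" for n
    using p_pos by (intro divide_nonneg_nonneg mult_nonneg_nonneg remainder_nonneg; simp)+
  have "L.remainder j (lam ^ 0 * 2) / apar ^ 0 \<le> (\<Sum>n. L.remainder j (lam ^ n * 2) / apar ^ n)"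
    using sum_le_suminf[OF L.summable_up[of 2 j], of "{0}"] nn(1) by simp
  moreover have "0 \<le> (\<Sum>n. apar ^ Suc n * L.remainder j (2 / lam ^ Suc n))"
    by (rule suminf_nonneg[OF L.summable_down nn(2)]) simp
  ultimately have "L.remainder j 2 \<le> 0" using zero unfolding L.periodic_part_def by simp
  moreover have "0 \<le> rphi 2 ^ j" using L.phi_nonneg[of 2] by simp
  ultimately have "real j * 2 \<le> 1" unfolding L.remainder_def by linarith
  then show False using j by simp
qed

lemma nn_integral_scale:
  fixes f :: "real \<Rightarrow> ennreal"
  assumes c: "0 < c" and f: "f \<in> borel_measurable borel"
  shows "(\<integral>\<^sup>+x. f x * indicator {0<..} x \<partial>lborel) = ennreal c * (\<integral>\<^sup>+x. f (c * x) * indicator {0<..} x \<partial>lborel)"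
proof -
  have "(\<integral>\<^sup>+x. f x * indicator {0<..} x \<partial>lborel)
      = ennreal \<bar>c\<bar> * (\<integral>\<^sup>+x. f (0 + c * x) * indicator {0<..} (0 + c * x) \<partial>lborel)"
    using f c by (intro nn_integral_real_affine) simp_all
  also have "\<dots> = ennreal c * (\<integral>\<^sup>+x. f (c * x) * indicator {0<..} x \<partial>lborel)"
    using c by (simp add: indicator_def zero_less_mult_iff)
  finally show ?thesis .
qed

abbreviation "ker t z \<equiv> ennreal (psi (t * z)) * ennreal (z powr (- 1 - rho p))"

lemma borel_w: "1 \<le> j \<Longrightarrow> w p j \<in> borel_measurable borel"
  using w_density(1) by (rule borel_measurable_continuous_onI)

text \<open>Substitute z = c y: the factor y^(rho+1) in eta cancels the power in the kernel and
  leaves the density w. For c = lam^n and c = 1/lam^n the right-hand side is a term of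
  \<open>periodic_part\<close>, since lam^rho = a.\<close>

lemma kernel_eta:
  assumes c: "0 < c" and t: "0 \<le> t" and j: "1 \<le> j"
  shows "(\<integral>\<^sup>+z. ker t z * ennreal (eta p j (z / c)) * indicator {0<..} z \<partial>lborel)
    = ennreal (c powr (- rho p)) * ennreal (L.remainder j (c * t))"
proof -
  note [measurable] = borel_w[OF j]
  have "(\<integral>\<^sup>+z. ker t z * ennreal (eta p j (z / c)) * indicator {0<..} z \<partial>lborel)
      = ennreal c * (\<integral>\<^sup>+y. ker t (c * y) * ennreal (eta p j (c * y / c)) * indicator {0<..} y \<partial>lborel)"
    unfolding eta_def by (rule nn_integral_scale[OF c]) measurable
  also have "(\<integral>\<^sup>+y. ker t (c * y) * ennreal (eta p j (c * y / c)) * indicator {0<..} y \<partial>lborel)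
      = (\<integral>\<^sup>+y. ennreal (c powr (- 1 - rho p)) * (ennreal (psi (c * t * y)) * ennreal (w p j y) * indicator {0<..} y) \<partial>lborel)"
  proof (rule nn_integral_cong)
    fix y
    show "ker t (c * y) * ennreal (eta p j (c * y / c)) * indicator {0<..} y
        = ennreal (c powr (- 1 - rho p)) * (ennreal (psi (c * t * y)) * ennreal (w p j y) * indicator {0<..} y)"
    proof (cases "0 < y")
      case True
      have e2: "c * y / c = y" and e3: "t * (c * y) = c * t * y" using c by simp_all
      have "(c * y) powr (- 1 - rho p) * eta p j y = c powr (- 1 - rho p) * w p j y"
      proof -
        have 1: "y powr (- 1 - rho p) * y powr (rho p + 1) = 1"
          using True by (simp add: powr_add[symmetric])
        have 2: "(c * y) powr (- 1 - rho p) = c powr (- 1 - rho p) * y powr (- 1 - rho p)"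
          using c True by (intro powr_mult)
        have "A * B * (Y * x) = A * (B * Y) * x" for A B Y x :: real by (simp only: mult_ac)
        then show ?thesis unfolding eta_def 2 by (simp only: 1 mult_1_right)
      qed
      then have "ennreal ((c * y) powr (- 1 - rho p)) * ennreal (eta p j y) = ennreal (c powr (- 1 - rho p)) * ennreal (w p j y)"
        by (simp add: ennreal_mult'[symmetric])
      moreover have "A * B * E * I = C * (A * X * I)" if "B * E = C * X" for A B E I C X :: ennreal
      proof -
        have "A * B * E * I = A * (B * E) * I" by (simp only: mult.assoc)
        then show ?thesis unfolding that by (simp only: mult_ac)
      qed
      ultimately show ?thesis unfolding e2 e3 by blast
    qed simp
  qed
  also have "\<dots> = ennreal (c powr (- 1 - rho p)) * ennreal (L.remainder j (c * t))"
    unfolding remainder_density[OF mult_nonneg_nonneg[OF less_imp_le[OF c] t] j]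
    by (rule nn_integral_cmult) measurable
  also have "ennreal c * (ennreal (c powr (- 1 - rho p)) * ennreal (L.remainder j (c * t)))
      = ennreal (c powr (- rho p)) * ennreal (L.remainder j (c * t))"
  proof -
    have "c * c powr (- 1 - rho p) = c powr (- rho p)"
      using c powr_add[of c 1 "- 1 - rho p"] by simp
    then show ?thesis using c by (simp add: mult.assoc[symmetric] ennreal_mult[symmetric])
  qed
  finally show ?thesis .
qed

lemma lam_pow_powr: "(lam ^ n) powr (- rho p) = 1 / apar ^ n" "(1 / lam ^ n) powr (- rho p) = apar ^ n"
proof -
  have "(lam ^ n) powr rho p = apar ^ n"
  proof -
    have "(lam ^ n) powr rho p = (lam powr real n) powr rho p" using p_pos by (simp add: powr_realpow)
    also have "\<dots> = (lam powr rho p) powr real n" by (simp only: powr_powr mult.commute)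
    also have "\<dots> = apar powr real n" by (simp only: rho_bounds(3))
    also have "\<dots> = apar ^ n" using p_pos by (intro powr_realpow) simp
    finally show ?thesis .
  qed
  moreover have "x powr (- rho p) = 1 / x powr rho p" "(1 / x) powr (- rho p) = x powr rho p" if "0 < x" for x
    using that by (simp_all add: powr_minus_divide powr_divide)
  ultimately show "(lam ^ n) powr (- rho p) = 1 / apar ^ n" "(1 / lam ^ n) powr (- rho p) = apar ^ n"
    using p_pos by simp_all
qed

text \<open>Summing \<open>kernel_eta\<close> over all powers of lam writes
  \<open>periodic_part\<close> as a Mellin type convolution with the function sum of eta(z
  lam^(-l)), which is Psi at log_lam z up to the factor 2p/a. Extended nonnegative sums avoid any
  question of convergence at individual z.\<close>

lemma periodic_part_integral:
  assumes t: "0 < t" and j: "1 \<le> j"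
  shows "ennreal (L.periodic_part j t) = (\<integral>\<^sup>+z. ker t z * ((\<Sum>n. ennreal (eta p j (z / lam ^ n)))
      + (\<Sum>n. ennreal (eta p j (z / (1 / lam ^ Suc n))))) * indicator {0<..} z \<partial>lborel)"
proof -
  note [measurable] = borel_w[OF j]
  have meas: "(\<lambda>z. ker t z * ennreal (eta p j (z / c)) * indicator {0<..} z) \<in> borel_measurable lborel" for c
    unfolding eta_def by measurable
  have t0: "0 \<le> t" using t by simp
  have lpos: "0 < lam ^ n" for n using p_pos by simp
  have up: "(\<integral>\<^sup>+z. ker t z * ennreal (eta p j (z / lam ^ n)) * indicator {0<..} z \<partial>lborel)
      = ennreal (L.remainder j (lam ^ n * t) / apar ^ n)" for n
    unfolding kernel_eta[OF lpos t0 j] lam_pow_powr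
    using p_pos lpos[of n] t0 by (subst ennreal_mult[symmetric]) (simp_all add: remainder_nonneg)
  have down: "(\<integral>\<^sup>+z. ker t z * ennreal (eta p j (z / (1 / lam ^ Suc n))) * indicator {0<..} z \<partial>lborel)
      = ennreal (apar ^ Suc n * L.remainder j (t / lam ^ Suc n))" for n
  proof -
    have "0 < 1 / lam ^ Suc n" using lpos[of "Suc n"] by (intro divide_pos_pos) simp_all
    from kernel_eta[OF this t0 j] show ?thesis
      unfolding lam_pow_powr
      using p_pos lpos[of "Suc n"] t0 by (subst ennreal_mult) (simp_all add: remainder_nonneg del: power_Suc)
  qed
  have "(\<integral>\<^sup>+z. ker t z * ((\<Sum>n. ennreal (eta p j (z / lam ^ n)))
      + (\<Sum>n. ennreal (eta p j (z / (1 / lam ^ Suc n))))) * indicator {0<..} z \<partial>lborel)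
    = (\<integral>\<^sup>+z. (\<Sum>n. ker t z * ennreal (eta p j (z / lam ^ n)) * indicator {0<..} z)
      + (\<Sum>n. ker t z * ennreal (eta p j (z / (1 / lam ^ Suc n))) * indicator {0<..} z) \<partial>lborel)"
    by (simp only: distrib_left distrib_right ennreal_suminf_cmult ennreal_suminf_multc)
  also have "\<dots> = (\<Sum>n. \<integral>\<^sup>+z. ker t z * ennreal (eta p j (z / lam ^ n)) * indicator {0<..} z \<partial>lborel)
      + (\<Sum>n. \<integral>\<^sup>+z. ker t z * ennreal (eta p j (z / (1 / lam ^ Suc n))) * indicator {0<..} z \<partial>lborel)"
    using meas by (subst nn_integral_add) (simp_all only: nn_integral_suminf borel_measurable_suminf_order)
  also have "\<dots> = (\<Sum>n. ennreal (L.remainder j (lam ^ n * t) / apar ^ n))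
      + (\<Sum>n. ennreal (apar ^ Suc n * L.remainder j (t / lam ^ Suc n)))"
    unfolding up down ..
  also have "\<dots> = ennreal (\<Sum>n. L.remainder j (lam ^ n * t) / apar ^ n)
      + ennreal (\<Sum>n. apar ^ Suc n * L.remainder j (t / lam ^ Suc n))"
    using t0 p_pos by (subst (1 2) suminf_ennreal2)
      (simp_all add: remainder_nonneg L.summable_up L.summable_down del: power_Suc)
  also have "\<dots> = ennreal (L.periodic_part j t)"
    unfolding L.periodic_part_def using t0 p_pos
    by (intro ennreal_plus[symmetric] suminf_nonneg L.summable_up L.summable_down)
      (simp_all add: remainder_nonneg del: power_Suc)
  finally show ?thesis by (rule sym)
qed

text \<open>With constant Psi the kernel is integrated against a constant, and homogeneity of the
  kernel under z -> z/t leaves a pure power of t.\<close>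

theorem Psi_not_constant:
  assumes j: "1 \<le> j"
  shows "\<not> Psi p j constant_on UNIV"
proof
  assume "Psi p j constant_on UNIV"
  then obtain c0 where c0: "\<And>u. Psi p j u = c0" unfolding constant_on_def by blast
  define c where "c = c0 / (2 * p / apar)"
  have eta_nonneg: "0 \<le> eta p j y" for y unfolding eta_def using w_density(2)[OF j] by simp
  have const: "(\<Sum>\<^sub>\<infinity>l\<in>(UNIV :: int set). eta p j (z * lam powr (- of_int l))) = c" if "0 < z" for z
  proof -
    have "lam powr (log lam z - of_int l) = z * lam powr (- of_int l)" for l :: int
      using that p_pos powr_add[of lam "log lam z" "- of_int l"] by simp
    then have "2 * p / apar * (\<Sum>\<^sub>\<infinity>l\<in>(UNIV :: int set). eta p j (z * lam powr (- of_int l))) = c0"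
      using c0[of "log lam z"] unfolding Psi_def by simp
    then show ?thesis using p_pos by (simp add: c_def field_simps)
  qed
  have up: "z * lam powr (- of_int (int n)) = z / lam ^ n" for z n
    using p_pos by (simp add: powr_minus_divide powr_realpow)
  have down: "z * lam powr (- of_int (- int (Suc n))) = z / (1 / lam ^ Suc n)" for z n
  proof -
    have "lam powr (- of_int (- int (Suc n))) = lam powr (real (Suc n))" by (simp only: of_int_minus of_int_of_nat_eq minus_minus)
    also have "\<dots> = lam ^ Suc n" using p_pos by (intro powr_realpow) simp
    finally show ?thesis by simp
  qed
  let ?S = "\<lambda>z. (\<Sum>n. ennreal (eta p j (z / lam ^ n))) + (\<Sum>n. ennreal (eta p j (z / (1 / lam ^ Suc n))))"
  \<comment> \<open>An infinite sum over the integers has the default value 0 when it diverges, so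
    it is compared with the extended sum only where the latter is finite.\<close>
  have S_const: "?S z = ennreal c" if z: "0 < z" and fin: "?S z \<noteq> \<infinity>" for z
  proof -
    have "(\<Sum>n. ennreal (eta p j (z / lam ^ n))) \<noteq> top" "(\<Sum>n. ennreal (eta p j (z / (1 / lam ^ Suc n)))) \<noteq> top"
      using fin by (auto simp: ennreal_add_eq_top)
    then have s: "summable (\<lambda>n. eta p j (z / lam ^ n))" "summable (\<lambda>n. eta p j (z / (1 / lam ^ Suc n)))"
      using eta_nonneg by (auto intro!: summable_suminf_not_top)
    then have "c = (\<Sum>n. eta p j (z / lam ^ n)) + (\<Sum>n. eta p j (z / (1 / lam ^ Suc n)))"
      using infsum_int_split[of "\<lambda>l. eta p j (z * lam powr (- of_int l))", unfolded up down, OF eta_nonneg s] const[OF z]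
      by (simp only:)
    moreover have "?S z = ennreal (\<Sum>n. eta p j (z / lam ^ n)) + ennreal (\<Sum>n. eta p j (z / (1 / lam ^ Suc n)))"
      by (simp only: suminf_ennreal2[OF eta_nonneg s(1)] suminf_ennreal2[OF eta_nonneg s(2)])
    moreover have "\<dots> = ennreal ((\<Sum>n. eta p j (z / lam ^ n)) + (\<Sum>n. eta p j (z / (1 / lam ^ Suc n))))"
      by (intro ennreal_plus[symmetric] suminf_nonneg s eta_nonneg)
    ultimately show ?thesis by (simp only:)
  qed
  note [measurable] = borel_w[OF j]
  have h: "ennreal (L.periodic_part j t) = (\<integral>\<^sup>+z. ker t z * ennreal c * indicator {0<..} z \<partial>lborel)" if t: "0 < t" for t
  proof -
    have fin: "(\<integral>\<^sup>+z. ker t z * ?S z * indicator {0<..} z \<partial>lborel) \<noteq> \<infinity>"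
      unfolding periodic_part_integral[OF t j, symmetric] by simp
    have "(\<lambda>z. ker t z * ?S z * indicator {0<..} z) \<in> borel_measurable lborel"
      unfolding eta_def by measurable
    \<comment> \<open>The integral is finite and the kernel is positive for z > 0, so the extended
      sum is finite for almost every z > 0, and there it equals c.\<close>
    from nn_integral_noteq_infinite[OF this fin]
    have "AE z in lborel. ker t z * ?S z * indicator {0<..} z = ker t z * ennreal c * indicator {0<..} z"
    proof eventually_elim
      case (elim z)
      show ?case
      proof (cases "0 < z")
        case True
        have "0 < psi (t * z)" using True t by (intro psi_pos) simp
        then have "ker t z \<noteq> 0" using True by (simp add: ennreal_mult[symmetric])
        then have "?S z \<noteq> \<infinity>" using elim True by (auto simp: ennreal_mult_eq_top_iff)
        then show ?thesis using S_const[OF True] by simp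
      qed simp
    qed
    from nn_integral_cong_AE[OF this] show ?thesis unfolding periodic_part_integral[OF t j] .
  qed
  have "L.periodic_part j t = L.periodic_part j 1 * t powr rho p" if t: "0 < t" for t
  proof -
    have nn: "0 \<le> L.periodic_part j s" if "0 < s" for s
    proof -
      have s0: "0 \<le> s" using that by simp
      show ?thesis unfolding L.periodic_part_def using s0 p_pos
        by (intro add_nonneg_nonneg suminf_nonneg L.summable_up L.summable_down)
          (simp_all add: remainder_nonneg del: power_Suc)
    qed
    have it: "0 < 1 / t" using t by simp
    \<comment> \<open>The substitution z -> z/t produces t^(1+rho) from the kernel and 1/t from the
      measure.\<close>
    have "ennreal (L.periodic_part j t) = ennreal (1 / t) * (\<integral>\<^sup>+z. ker t (1 / t * z) * ennreal c * indicator {0<..} z \<partial>lborel)"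
      unfolding h[OF t] by (rule nn_integral_scale[OF it]) measurable
    also have "(\<integral>\<^sup>+z. ker t (1 / t * z) * ennreal c * indicator {0<..} z \<partial>lborel)
        = (\<integral>\<^sup>+z. ennreal (t powr (1 + rho p)) * (ker 1 z * ennreal c * indicator {0<..} z) \<partial>lborel)"
    proof (rule nn_integral_cong)
      fix z
      show "ker t (1 / t * z) * ennreal c * indicator {0<..} z
          = ennreal (t powr (1 + rho p)) * (ker 1 z * ennreal c * indicator {0<..} z)"
      proof (cases "0 < z")
        case True
        have "(1 / t * z) powr (- 1 - rho p) = (1 / t) powr (- 1 - rho p) * z powr (- 1 - rho p)"
          using t True by (intro powr_mult)
        also have "(1 / t) powr (- 1 - rho p) = t powr (1 + rho p)"
          using t by (simp add: powr_divide powr_minus_divide[symmetric] add.commute)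
        finally have "ennreal ((1 / t * z) powr (- 1 - rho p)) = ennreal (t powr (1 + rho p)) * ennreal (z powr (- 1 - rho p))"
          by (simp add: ennreal_mult)
        moreover have "t * (1 / t * z) = 1 * z" using t by simp
        ultimately show ?thesis by (simp only: mult_ac)
      qed simp
    qed
    also have "\<dots> = ennreal (t powr (1 + rho p)) * ennreal (L.periodic_part j 1)"
      unfolding h[OF zero_less_one] by (rule nn_integral_cmult) measurable
    also have "ennreal (1 / t) * (ennreal (t powr (1 + rho p)) * ennreal (L.periodic_part j 1))
        = ennreal (L.periodic_part j 1 * t powr rho p)"
    proof -
      have "1 / t * (t powr (1 + rho p) * x) = x * t powr rho p" for x
        using t by (simp add: powr_add)
      then show ?thesis using t nn[of 1] by (simp add: ennreal_mult[symmetric])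
    qed
    finally show ?thesis using nn[OF t] nn[of 1] by (subst (asm) ennreal_inj) simp_all
  qed
  then show False using periodic_part_not_power[OF j] by blast
qed

end

section \<open>An Abelian limit for sequences of order k^(-1-r)\<close>

lemma powr_envelope_integrable:
  assumes "1 < r" "r < (2::real)"
  shows "integrable lborel (\<lambda>u. indicator {0..1} u * u powr (1 - r) + indicator {1..} u * u powr (- r))"
proof (rule Bochner_Integration.integrable_add)
  have "(\<integral>\<^sup>+u. ennreal (indicator {0..1} u * u powr (1 - r)) \<partial>lborel) = ennreal (1 powr (1 - r + 1) / (1 - r + 1))"
    using assms by (intro nn_integral_has_integral_lebesgue has_integral_powr_from_0) simp_all
  then show "integrable lborel (\<lambda>u. indicator {0..1} u * u powr (1 - r))"
    by (intro integrableI_nonneg) simp_all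
  have "(\<integral>\<^sup>+u. ennreal (indicator {1..} u * u powr (- r)) \<partial>lborel) = ennreal (- (1 powr (- r + 1)) / (- r + 1))"
    using assms by (intro nn_integral_has_integral_lebesgue has_integral_powr_to_inf) simp_all
  then show "integrable lborel (\<lambda>u. indicator {1..} u * u powr (- r))"
    by (intro integrableI_nonneg) simp_all
qed

text \<open>With psi(v) at most v^2 and at most v, the kernel lies below v^(1-r) and below v^(-r).
  Both decrease in v, so u may replace v, and each is used on the side of 1 where it is
  integrable.\<close>

lemma kernel_envelope:
  fixes u v r :: real
  assumes "0 < u" "u \<le> v" "1 < r"
  shows "(exp (- v) - 1 + v) * v powr (- 1 - r) \<le> indicator {0..1} u * u powr (1 - r) + indicator {1..} u * u powr (- r)"
proof -
  have v: "0 < v" using assms by simp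
  have sq: "exp (- v) - 1 + v \<le> v\<^sup>2" using exp_minus_quadratic(2)[of v] v zero_le_power2[of v] by linarith
  have lin: "exp (- v) - 1 + v \<le> v" using v by simp
  have p1: "v\<^sup>2 * v powr (- 1 - r) = v powr (1 - r)"
    using v powr_add[of v 2 "- 1 - r"] by (simp add: powr_numeral)
  have p2: "v * v powr (- 1 - r) = v powr (- r)"
    using v powr_add[of v 1 "- 1 - r"] by simp
  have b1: "(exp (- v) - 1 + v) * v powr (- 1 - r) \<le> v powr (1 - r)"
    unfolding p1[symmetric] using sq by (rule mult_right_mono) simp
  have b2: "(exp (- v) - 1 + v) * v powr (- 1 - r) \<le> v powr (- r)"
    unfolding p2[symmetric] using lin by (rule mult_right_mono) simp
  show ?thesis
  proof (cases "u \<le> 1")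
    case True
    have "v powr (1 - r) \<le> u powr (1 - r)" using assms by (intro powr_mono2') simp_all
    with b1 have "(exp (- v) - 1 + v) * v powr (- 1 - r) \<le> u powr (1 - r)" by (rule order_trans)
    then show ?thesis using True assms by (simp add: indicator_def add_increasing2)
  next
    case False
    have "v powr (- r) \<le> u powr (- r)" using assms by (intro powr_mono2') simp_all
    with b2 have "(exp (- v) - 1 + v) * v powr (- 1 - r) \<le> u powr (- r)" by (rule order_trans)
    then show ?thesis using False by (simp add: indicator_def)
  qed
qed

text \<open>With P(k) = C(k) k^(-1-r) and C(k) -> c, the scaled sum is a Riemann sum of mesh s_n for
  the integral of C psi(u) u^(-1-r). Written as the integral of a step function, it converges by
  dominated convergence.\<close>

lemma abelian_limit:
  fixes P :: "nat \<Rightarrow> real" and s :: "nat \<Rightarrow> real" and r c :: real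
  assumes r: "1 < r" "r < 2" and P: "\<And>k. 0 \<le> P k"
    and lim: "(\<lambda>k. P k * real k powr (1 + r)) \<longlonglongrightarrow> c"
    and s: "\<And>n. 0 < s n" "s \<longlonglongrightarrow> 0"
  defines "J \<equiv> (LBINT u. indicator {0<..} u * (c * ((exp (- u) - 1 + u) * u powr (- 1 - r))))"
  shows "(\<lambda>n. (\<Sum>k. P (Suc k) * (exp (- (s n * real (Suc k))) - 1 + s n * real (Suc k))) / s n powr r) \<longlonglongrightarrow> J"
proof -
  define ch where "ch v = (exp (- v) - 1 + v) * v powr (- 1 - r)" for v :: real
  define C where "C k = P k * real k powr (1 + r)" for k
  define g where "g u = indicator {0..1} u * u powr (1 - r) + indicator {1..} u * u powr (- r)" for u :: real
  have C0: "0 \<le> C k" for k using P by (simp add: C_def)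
  have ch0: "0 \<le> ch v" if "0 \<le> v" for v unfolding ch_def using exp_minus_quadratic(1)[OF that] by simp
  obtain B where B: "0 < B" "\<And>k. C k \<le> B"
  proof -
    have "Bseq C" using lim unfolding C_def[symmetric] by (intro convergent_imp_Bseq convergentI)
    then obtain B where "0 < B" "\<And>k. norm (C k) \<le> B" by (auto elim: BseqE)
    then show ?thesis using that[of B] by (auto simp: abs_le_iff)
  qed
  \<comment> \<open>The cell index of u: rounding up makes the sample point s K at least u, as
    \<open>kernel_envelope\<close> needs, and keeps the index at least 1.\<close>
  define K where "K n u = nat \<lceil>u / s n\<rceil>" for n u
  have K: "u \<le> s n * real (K n u)" "s n * real (K n u) < u + s n" "1 \<le> K n u" if "0 < u" for n u
  proof -
    have x: "0 < u / s n" using that s(1)[of n] by simp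
    then have "real (K n u) = of_int \<lceil>u / s n\<rceil>" unfolding K_def by simp
    then have "u / s n \<le> real (K n u)" "real (K n u) < u / s n + 1" by linarith+
    then show "u \<le> s n * real (K n u)" "s n * real (K n u) < u + s n"
      using s(1)[of n] by (simp_all add: field_simps)
    have "0 < \<lceil>u / s n\<rceil>" using x by simp
    then show "1 \<le> K n u" unfolding K_def by (simp only: One_nat_def Suc_le_eq zero_less_nat_eq)
  qed
  define f where "f n u = indicator {0<..} u * (C (K n u) * ch (s n * real (K n u)))" for n and u :: real
  have f0: "0 \<le> f n u" for n u
    unfolding f_def using C0 ch0 s(1)[of n] by (simp add: less_imp_le)
  have fg: "f n u \<le> B * g u" for n u
  proof (cases "0 < u")
    case True
    have "ch (s n * real (K n u)) \<le> g u"
      unfolding ch_def g_def by (rule kernel_envelope[OF True K(1)[OF True] r(1)])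
    then have "C (K n u) * ch (s n * real (K n u)) \<le> B * g u"
      using B C0 ch0 s(1)[of n] by (intro mult_mono) (simp_all add: less_imp_le)
    then show ?thesis using True by (simp add: f_def)
  next
    case False
    then show ?thesis using B by (simp add: f_def g_def)
  qed
  have intg: "integrable lborel (\<lambda>u. B * g u)"
    unfolding g_def by (intro integrable_mult_right powr_envelope_integrable r)
  have meas: "f n \<in> borel_measurable lborel" for n
  proof -
    have "(\<lambda>u. nat \<lceil>u / s n\<rceil>) \<in> borel \<rightarrow>\<^sub>M count_space UNIV" by measurable
    then have 1: "(\<lambda>u. C (K n u)) \<in> borel_measurable borel" "(\<lambda>u. ch (s n * real (K n u))) \<in> borel_measurable borel"
      unfolding K_def by (auto intro: measurable_compose)
    show ?thesis unfolding f_def[abs_def] using 1 by measurable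
  qed
  have conv: "(\<lambda>n. f n u) \<longlonglongrightarrow> indicator {0<..} u * (c * ch u)" for u
  proof (cases "0 < u")
    case True
    have "(\<lambda>n. u + s n) \<longlonglongrightarrow> u + 0" by (intro tendsto_add tendsto_const s(2))
    then have upper: "(\<lambda>n. u + s n) \<longlonglongrightarrow> u" by simp
    have sK: "(\<lambda>n. s n * real (K n u)) \<longlonglongrightarrow> u"
      by (rule tendsto_sandwich[OF _ _ tendsto_const upper])
        (use K[OF True] in \<open>auto intro!: always_eventually less_imp_le\<close>)
    have "isCont ch u" unfolding ch_def using True by (intro continuous_intros) simp_all
    from isCont_tendsto_compose[OF this sK] have 1: "(\<lambda>n. ch (s n * real (K n u))) \<longlonglongrightarrow> ch u" .
    have "filterlim (\<lambda>n. inverse (s n)) at_top sequentially"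
      using s by (intro filterlim_inverse_at_top) simp_all
    then have "filterlim (\<lambda>n. u * inverse (s n)) at_top sequentially"
      by (rule filterlim_tendsto_pos_mult_at_top[OF tendsto_const True])
    then have top: "filterlim (\<lambda>n. u / s n) at_top sequentially" by (simp only: divide_inverse)
    have "filterlim (\<lambda>n. K n u) sequentially sequentially"
      unfolding filterlim_at_top
    proof
      fix Z :: nat
      from top have "eventually (\<lambda>n. real Z \<le> u / s n) sequentially" unfolding filterlim_at_top by blast
      then show "eventually (\<lambda>n. Z \<le> K n u) sequentially"
      proof eventually_elim
        case (elim n)
        then have "real Z \<le> real (K n u)" unfolding K_def using of_nat_ceiling[of "u / s n"] by linarith
        then show ?case by simp
      qed
    qed
    from filterlim_compose[OF lim this] have 2: "(\<lambda>n. C (K n u)) \<longlonglongrightarrow> c" unfolding C_def .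
    show ?thesis unfolding f_def using tendsto_mult[OF 2 1] True by simp
  qed (simp add: f_def)
  have DCT: "(\<lambda>n. LBINT u. f n u) \<longlonglongrightarrow> (LBINT u. indicator {0<..} u * (c * ch u))"
  proof (rule integral_dominated_convergence[where w = "\<lambda>u. B * g u"])
    show "(\<lambda>u. indicator {0<..} u * (c * ch u)) \<in> borel_measurable lborel" unfolding ch_def by measurable
    show "AE u in lborel. norm (f n u) \<le> B * g u" for n using f0 fg by simp
  qed (use meas intg conv in simp_all)
  have integral_eq: "(LBINT u. f n u) = (\<Sum>k. P (Suc k) * (exp (- (s n * real (Suc k))) - 1 + s n * real (Suc k))) / s n powr r" for n
  proof -
    define t where "t = s n"
    have t: "0 < t" using s(1) by (simp add: t_def)
    define a where "a k = C (Suc k) * ch (t * real (Suc k))" for k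
    define A where "A k = {t * real k<..t * real (Suc k)}" for k
    have a0: "0 \<le> a k" for k unfolding a_def using C0 ch0 t by simp
    have KA: "u \<in> A k \<longleftrightarrow> K n u = Suc k" if "0 < u" for u k
    proof -
      have "u \<in> A k \<longleftrightarrow> real k < u / t \<and> u / t \<le> real k + 1"
        unfolding A_def using t by (simp add: field_simps)
      also have "\<dots> \<longleftrightarrow> \<lceil>u / t\<rceil> = int k + 1" by (simp add: ceiling_eq_iff)
      also have "\<dots> \<longleftrightarrow> K n u = Suc k" unfolding K_def t_def[symmetric] by auto
      finally show ?thesis .
    qed
    \<comment> \<open>The step function as a sum over the cells (t k, t (k+1)]; exactly one of them
      contains a given u > 0.\<close>
    have point: "ennreal (f n u) = (\<Sum>k. ennreal (a k) * indicator (A k) u)" for u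
    proof (cases "0 < u")
      case True
      obtain m where m: "K n u = Suc m" using K(3)[OF True, of n] by (cases "K n u") auto
      have "(\<Sum>k. ennreal (a k) * indicator (A k) u) = (\<Sum>k\<in>{m}. ennreal (a k) * indicator (A k) u)"
        by (rule suminf_finite) (use KA[OF True] m in simp_all)
      also have "\<dots> = ennreal (a m)" using KA[OF True, of m] m by simp
      also have "a m = f n u" unfolding f_def a_def m t_def using True by simp
      finally show ?thesis by (rule sym)
    next
      case False
      have "u \<notin> A k" for k
      proof -
        have "0 \<le> t * real k" using t by simp
        then show ?thesis using False unfolding A_def by auto
      qed
      then show ?thesis using False by (simp add: f_def)
    qed
    have int_f: "integrable lborel (f n)"
      by (rule Bochner_Integration.integrable_bound[OF intg meas]) (use f0 fg in \<open>simp add: order_trans[OF fg abs_ge_self]\<close>)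
    have "ennreal (LBINT u. f n u) = (\<integral>\<^sup>+u. ennreal (f n u) \<partial>lborel)"
      by (rule nn_integral_eq_integral[symmetric, OF int_f]) (simp add: f0)
    also have "\<dots> = (\<Sum>k. \<integral>\<^sup>+u. ennreal (a k) * indicator (A k) u \<partial>lborel)"
      unfolding point by (rule nn_integral_suminf) (simp add: A_def)
    also have "(\<lambda>k. \<integral>\<^sup>+u. ennreal (a k) * indicator (A k) u \<partial>lborel) = (\<lambda>k. ennreal (a k * t))"
    proof
      fix k
      have "t * real k \<le> t * real (Suc k)" using t by simp
      then have "emeasure lborel (A k) = ennreal (t * real (Suc k) - t * real k)"
        unfolding A_def by (rule emeasure_lborel_Ioc)
      also have "t * real (Suc k) - t * real k = t" by (simp add: distrib_left)
      finally have "emeasure lborel (A k) = ennreal t" .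
      then show "(\<integral>\<^sup>+u. ennreal (a k) * indicator (A k) u \<partial>lborel) = ennreal (a k * t)"
        using a0[of k] t by (subst nn_integral_cmult_indicator) (simp_all add: A_def ennreal_mult)
    qed
    finally have eq: "ennreal (LBINT u. f n u) = (\<Sum>k. ennreal (a k * t))" .
    have at0: "0 \<le> a k * t" for k using a0 t by simp
    have "(\<Sum>k. ennreal (a k * t)) \<noteq> top" unfolding eq[symmetric] by simp
    then have sum: "summable (\<lambda>k. a k * t)" by (rule summable_suminf_not_top[OF at0])
    have "ennreal (LBINT u. f n u) = ennreal (\<Sum>k. a k * t)"
      unfolding eq by (rule suminf_ennreal2[OF at0 sum])
    then have main: "(LBINT u. f n u) = (\<Sum>k. a k * t)"
      using f0 by (subst (asm) ennreal_inj) (auto intro!: integral_nonneg suminf_nonneg sum at0)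
    define q where "q k = P (Suc k) * (exp (- (t * real (Suc k))) - 1 + t * real (Suc k))" for k
    have q: "a k * t = q k / t powr r" for k
    proof -
      define m where "m = real (Suc k)"
      have m: "0 < m" by (simp add: m_def)
      have "(t * m) powr (- 1 - r) = t powr (- 1 - r) * m powr (- 1 - r)" by (rule powr_mult)
      then have "a k * t = P (Suc k) * (exp (- (t * m)) - 1 + t * m) * (m powr (1 + r) * m powr (- 1 - r)) * (t powr (- 1 - r) * t)"
        unfolding a_def C_def ch_def m_def[symmetric] by (simp only: mult_ac)
      also have "m powr (1 + r) * m powr (- 1 - r) = 1" using m by (simp add: powr_add[symmetric])
      also have "t powr (- 1 - r) * t = 1 / t powr r"
        using t powr_add[of t "- 1 - r" 1] by (simp add: powr_minus_divide)
      finally show ?thesis unfolding q_def m_def[symmetric] by simp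
    qed
    have "q = (\<lambda>k. t powr r * (a k * t))" unfolding q using t by simp
    then have "summable q" using summable_mult[OF sum, of "t powr r"] by (simp only:)
    then have "(\<Sum>k. a k * t) = (\<Sum>k. q k) / t powr r" unfolding q by (rule suminf_divide)
    with main show ?thesis unfolding t_def q_def by (simp only:)
  qed
  show ?thesis using DCT unfolding integral_eq J_def ch_def .
qed

section \<open>Identification of p_k as a geometric mixture\<close>

primrec gw_pmf :: "real \<Rightarrow> nat \<Rightarrow> nat \<Rightarrow> nat pmf" where
  "gw_pmf p j 0 = return_pmf j"
| "gw_pmf p j (Suc n) = bind_pmf (gw_pmf p j n) (\<lambda>d. map_pmf ((+) d) (binomial_pmf d p))"

lemma pmf_power_summable:
  fixes x :: real
  assumes "\<bar>x\<bar> \<le> 1" shows "summable (\<lambda>k. pmf P k * x ^ k)"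
proof (rule summable_comparison_test')
  have "(\<Sum>k. ennreal (pmf P k)) = (\<integral>\<^sup>+k. 1 \<partial>measure_pmf P)"
    by (simp only: nn_integral_measure_pmf nn_integral_count_space_nat mult_1_right)
  then have "(\<Sum>k. ennreal (pmf P k)) \<noteq> top" by simp
  then show "summable (pmf P)" by (rule summable_suminf_not_top[rotated]) simp
  show "norm (pmf P n * x ^ n) \<le> pmf P n" for n
    using assms by (simp add: abs_mult power_abs mult_left_le power_le_one)
qed

lemma ennreal_pgf:
  assumes "0 \<le> x" "x \<le> 1"
  shows "ennreal (pgf P x) = (\<integral>\<^sup>+k. ennreal (x ^ k) \<partial>measure_pmf P)"
proof -
  have "(\<integral>\<^sup>+k. ennreal (x ^ k) \<partial>measure_pmf P) = (\<Sum>k. ennreal (pmf P k * x ^ k))"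
    using assms by (simp add: nn_integral_measure_pmf nn_integral_count_space_nat ennreal_mult)
  also have "\<dots> = ennreal (pgf P x)"
    unfolding pgf_def using assms by (intro suminf_ennreal2 pmf_power_summable) simp_all
  finally show ?thesis by (rule sym)
qed

lemma pgf_bounds: assumes "0 \<le> x" "x \<le> 1" shows "0 \<le> pgf P x" "pgf P x \<le> 1"
proof -
  show 0: "0 \<le> pgf P x"
    unfolding pgf_def using assms by (intro suminf_nonneg pmf_power_summable) simp_all
  have "ennreal (pgf P x) \<le> (\<integral>\<^sup>+k. 1 \<partial>measure_pmf P)"
    unfolding ennreal_pgf[OF assms] using assms
    by (intro nn_integral_mono) (simp add: power_le_one ennreal_le_1)
  then show "pgf P x \<le> 1" using 0 by (simp add: ennreal_le_1)
qed

text \<open>Zeros of a nonzero power series are isolated, while the difference of the two series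
  vanishes on all of [0,1].\<close>

lemma pmf_eq_if_pgf_eq:
  assumes "\<And>x. 0 \<le> x \<Longrightarrow> x \<le> 1 \<Longrightarrow> pgf P x = pgf Q x"
  shows "P = Q"
proof (rule pmf_eqI)
  define c where "c k = pmf P k - pmf Q k" for k
  define f where "f x = pgf P x - pgf Q x" for x
  have sums: "(\<lambda>k. c k * (x - 0) ^ k) sums f x" if "norm (x - 0) < 1" for x :: real
  proof -
    have "(\<lambda>k. pmf P k * x ^ k - pmf Q k * x ^ k) sums f x"
      unfolding f_def pgf_def using that by (intro sums_diff summable_sums pmf_power_summable) simp_all
    then show ?thesis by (simp add: c_def left_diff_distrib)
  qed
  have f0: "f x = 0" if "0 \<le> x" "x \<le> 1" for x using assms[OF that] by (simp add: f_def)
  have c0: "c 0 = 0"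
  proof -
    have "(\<lambda>k. c k * 0 ^ k) sums f 0" using sums[of 0] by simp
    then have "f 0 = c 0" using powser_sums_zero[of c] sums_unique2 by blast
    then show ?thesis using f0[of 0] by simp
  qed
  fix i
  have "c i = 0"
  proof (rule ccontr)
    assume ne: "c i \<noteq> 0"
    then have "0 < i" using c0 by (cases i) auto
    have "f 0 = 0" using f0[of 0] by simp
    from powser_0_nonzero[of 1 0 c f i, OF zero_less_one sums this ne \<open>0 < i\<close>]
    obtain e where e: "0 < e" "\<And>z. z \<in> cball 0 e - {0} \<Longrightarrow> f z \<noteq> 0" by blast
    have "f (min e 1) \<noteq> 0" using e(1) by (intro e(2)) (simp add: dist_real_def)
    then show False using f0[of "min e 1"] e(1) by simp
  qed
  then show "pmf P i = pmf Q i" by (simp add: c_def)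
qed

context splitting
begin

lemma F_unit: assumes "0 \<le> x" "x \<le> (1 :: real)" shows "0 \<le> F p x" "F p x \<le> 1"
proof -
  have a: "0 \<le> 1 - p + p * x" "1 - p + p * x \<le> 1"
    using assms p_pos p_less_1 by (simp_all add: mult_left_le)
  show "0 \<le> F p x" unfolding F_real using assms a by simp
  show "F p x \<le> 1" unfolding F_real using assms a by (intro mult_le_one)
qed

lemma F_pow_unit: assumes "0 \<le> x" "x \<le> (1 :: real)" shows "0 \<le> (F p ^^ n) x \<and> (F p ^^ n) x \<le> 1"
proof (induction n)
  case (Suc n)
  then show ?case using F_unit[of "(F p ^^ n) x"] by simp
qed (use assms in simp)

text \<open>If a Binomial(d,p) number of the d individuals split, each individual has 1 or 2
  children with probability 1-p or p; the binomial theorem gives F(x)^d.\<close>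

lemma binomial_step:
  assumes "0 \<le> x" "x \<le> 1"
  shows "(\<integral>\<^sup>+k. ennreal (x ^ k) \<partial>measure_pmf (map_pmf ((+) d) (binomial_pmf d p))) = ennreal (F p x ^ d)"
proof -
  have "(\<integral>\<^sup>+k. ennreal (x ^ k) \<partial>measure_pmf (map_pmf ((+) d) (binomial_pmf d p)))
      = (\<integral>\<^sup>+b. ennreal (x ^ (d + b)) \<partial>measure_pmf (binomial_pmf d p))" by simp
  also have "\<dots> = ennreal (measure_pmf.expectation (binomial_pmf d p) (\<lambda>b. x ^ (d + b)))"
    using assms p_pos p_less_1
    by (intro nn_integral_eq_integral integrable_measure_pmf_finite finite_set_pmf_binomial_pmf AE_I2) simp_all
  also have "measure_pmf.expectation (binomial_pmf d p) (\<lambda>b. x ^ (d + b))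
      = (\<Sum>b\<in>{..d}. pmf (binomial_pmf d p) b *\<^sub>R x ^ (d + b))"
    using p_pos p_less_1 by (intro integral_measure_pmf) simp_all
  also have "\<dots> = x ^ d * (\<Sum>b\<le>d. real (d choose b) * (p * x) ^ b * (1 - p) ^ (d - b))"
    using p_pos p_less_1 unfolding sum_distrib_left
    by (intro sum.cong refl) (simp add: power_add power_mult_distrib mult_ac)
  also have "\<dots> = x ^ d * (p * x + (1 - p)) ^ d" by (simp only: binomial_ring)
  also have "\<dots> = F p x ^ d" unfolding F_real by (simp add: power_mult_distrib add.commute)
  finally show ?thesis .
qed

lemma gw_pmf_power:
  assumes "0 \<le> x" "x \<le> 1"
  shows "(\<integral>\<^sup>+k. ennreal (x ^ k) \<partial>measure_pmf (gw_pmf p j n)) = ennreal (((F p ^^ n) x) ^ j)"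
  using assms
proof (induction n arbitrary: x)
  case (Suc n)
  have "(\<integral>\<^sup>+k. ennreal (x ^ k) \<partial>measure_pmf (gw_pmf p j (Suc n)))
      = (\<integral>\<^sup>+d. ennreal (F p x ^ d) \<partial>measure_pmf (gw_pmf p j n))"
    unfolding gw_pmf.simps nn_integral_bind_pmf binomial_step[OF Suc.prems] ..
  also have "\<dots> = ennreal (((F p ^^ n) (F p x)) ^ j)"
    by (rule Suc.IH) (rule F_unit[OF Suc.prems])+
  finally show ?case by (simp only: funpow_Suc_right o_apply)
qed simp

definition gser :: "nat \<Rightarrow> real \<Rightarrow> real" where
  "gser j x = (\<Sum>n. ((F p ^^ n) x) ^ j / apar ^ n)"

lemma summable_gser: assumes "0 \<le> x" "x \<le> 1" shows "summable (\<lambda>n. ((F p ^^ n) x) ^ j / apar ^ n)"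
proof (rule summable_comparison_test'[OF summable_inv_apar])
  fix n
  have "((F p ^^ n) x) ^ j \<le> 1" "0 \<le> ((F p ^^ n) x) ^ j"
    using F_pow_unit[OF assms, of n] by (simp_all add: power_le_one)
  then show "norm (((F p ^^ n) x) ^ j / apar ^ n) \<le> (1 / apar) ^ n"
    using p_pos by (simp add: power_one_over divide_right_mono)
qed

lemma gser_F: assumes "0 \<le> x" "x \<le> 1" shows "apar * gser j x = apar * x ^ j + gser j (F p x)"
proof -
  have "(\<Sum>n. ((F p ^^ Suc n) x) ^ j / apar ^ Suc n) = gser j x - x ^ j"
    unfolding gser_def using suminf_split_head[OF summable_gser[OF assms, of j]] by simp
  moreover have "((F p ^^ Suc n) x) ^ j / apar ^ Suc n = ((F p ^^ n) (F p x)) ^ j / apar ^ n / apar" for n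
    by (simp only: funpow_Suc_right o_apply power_Suc divide_divide_eq_left mult.commute)
  moreover have "(\<Sum>n. ((F p ^^ n) (F p x)) ^ j / apar ^ n / apar) = gser j (F p x) / apar"
    unfolding gser_def by (rule suminf_divide[OF summable_gser[OF F_unit[OF assms]]])
  ultimately have "gser j (F p x) / apar = gser j x - x ^ j" by (simp only:)
  then show ?thesis using p_pos by (simp add: field_simps)
qed

abbreviation "mix_par \<equiv> 2 * p / apar"

text \<open>The process started from j and observed at an independent geometric time, whose weights
  are (2p/a) a^(-n).\<close>

definition mix_pmf :: "nat \<Rightarrow> nat pmf" where
  "mix_pmf j = bind_pmf (geometric_pmf mix_par) (gw_pmf p j)"

lemma mix_pgf: assumes "0 \<le> x" "x \<le> 1" shows "pgf (mix_pmf j) x = mix_par * gser j x"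
proof -
  have q: "0 < mix_par" "mix_par \<le> 1" "1 - mix_par = 1 / apar" using p_pos by (simp_all add: field_simps)
  have "ennreal (pgf (mix_pmf j) x) = (\<integral>\<^sup>+n. ennreal (((F p ^^ n) x) ^ j) \<partial>measure_pmf (geometric_pmf mix_par))"
    unfolding ennreal_pgf[OF assms] mix_pmf_def nn_integral_bind_pmf gw_pmf_power[OF assms] ..
  also have "\<dots> = (\<Sum>n. ennreal (mix_par * (((F p ^^ n) x) ^ j / apar ^ n)))"
  proof -
    have "ennreal (pmf (geometric_pmf mix_par) n) * ennreal (((F p ^^ n) x) ^ j)
        = ennreal (mix_par * (((F p ^^ n) x) ^ j / apar ^ n))" for n
      unfolding pmf_geometric[OF q(1,2)] q(3) using q(1) F_pow_unit[OF assms, of n] p_pos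
      by (subst ennreal_mult[symmetric]) (simp_all add: power_one_over)
    then show ?thesis by (simp only: nn_integral_measure_pmf nn_integral_count_space_nat)
  qed
  also have "\<dots> = ennreal (\<Sum>n. mix_par * (((F p ^^ n) x) ^ j / apar ^ n))"
    using F_pow_unit[OF assms] p_pos
    by (intro suminf_ennreal2 summable_mult summable_gser assms) simp_all
  also have "(\<Sum>n. mix_par * (((F p ^^ n) x) ^ j / apar ^ n)) = mix_par * gser j x"
    unfolding gser_def by (rule suminf_mult[OF summable_gser[OF assms]])
  finally have "ennreal (pgf (mix_pmf j) x) = ennreal (mix_par * gser j x)" .
  moreover have "0 \<le> mix_par * gser j x"
    unfolding gser_def using F_pow_unit[OF assms] p_pos
    by (intro mult_nonneg_nonneg suminf_nonneg summable_gser assms) simp_all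
  ultimately show ?thesis using pgf_bounds(1)[OF assms] by (subst (asm) ennreal_inj) simp_all
qed

lemma F_alt: "x - p * x + p * x\<^sup>2 = F p (x :: real)"
  by (simp add: F_def algebra_simps)

text \<open>The mixture solves the functional equation because its generating function is (2p/a)
  times the series \<open>gser\<close>. It is the only solution: the difference u of two solutions
  satisfies a^n u(x) = u(F^n(x)), which is bounded, so u = 0.\<close>

lemma pk_pmf_eq: "pk_pmf p j = mix_pmf j"
  unfolding pk_pmf_def
proof (rule the_equality)
  show "\<forall>x\<in>{0..1}. (1 + 2 * p) * pgf (mix_pmf j) x = 2 * p * x ^ j + pgf (mix_pmf j) (x - p * x + p * x\<^sup>2)"
  proof
    fix x :: real assume "x \<in> {0..1}"
    then have x: "0 \<le> x" "x \<le> 1" by simp_all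
    have "apar * (mix_par * gser j x) = mix_par * (apar * gser j x)" by (simp only: mult.left_commute)
    also have "\<dots> = 2 * p * x ^ j + mix_par * gser j (F p x)"
      unfolding gser_F[OF x] using p_pos by (simp add: distrib_left)
    finally show "(1 + 2 * p) * pgf (mix_pmf j) x = 2 * p * x ^ j + pgf (mix_pmf j) (x - p * x + p * x\<^sup>2)"
      unfolding F_alt mix_pgf[OF x] mix_pgf[OF F_unit[OF x]] .
  qed
  fix P assume P: "\<forall>x\<in>{0..1}. (1 + 2 * p) * pgf P x = 2 * p * x ^ j + pgf P (x - p * x + p * x\<^sup>2)"
  show "P = mix_pmf j"
  proof (rule pmf_eq_if_pgf_eq)
    fix x :: real assume x: "0 \<le> x" "x \<le> 1"
    define u where "u y = pgf P y - pgf (mix_pmf j) y" for y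
    have step: "apar * u y = u (F p y)" if y: "0 \<le> y" "y \<le> 1" for y
    proof -
      have "apar * pgf P y = 2 * p * y ^ j + pgf P (F p y)" using P y unfolding F_alt by simp
      moreover have "apar * pgf (mix_pmf j) y = 2 * p * y ^ j + pgf (mix_pmf j) (F p y)"
      proof -
        have "apar * (mix_par * gser j y) = mix_par * (apar * gser j y)" by (simp only: mult.left_commute)
        also have "\<dots> = 2 * p * y ^ j + mix_par * gser j (F p y)"
          unfolding gser_F[OF y] using p_pos by (simp add: distrib_left)
        finally show ?thesis unfolding mix_pgf[OF y] mix_pgf[OF F_unit[OF y]] .
      qed
      ultimately show ?thesis unfolding u_def right_diff_distrib by linarith
    qed
    have iter: "apar ^ n * u x = u ((F p ^^ n) x)" for n
    proof (induction n)
      case (Suc n)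
      have "apar ^ Suc n * u x = apar * (apar ^ n * u x)" by (simp only: power_Suc mult.assoc)
      also have "\<dots> = u (F p ((F p ^^ n) x))" unfolding Suc using F_pow_unit[OF x, of n] by (intro step) simp_all
      finally show ?case by simp
    qed simp
    have "\<bar>u x\<bar> \<le> 1 * (1 / apar) ^ n" for n
    proof -
      have "\<bar>u ((F p ^^ n) x)\<bar> \<le> 1"
        using pgf_bounds[of "(F p ^^ n) x" P] pgf_bounds[of "(F p ^^ n) x" "mix_pmf j"] F_pow_unit[OF x, of n]
        unfolding u_def by linarith
      then have "apar ^ n * \<bar>u x\<bar> \<le> 1" unfolding iter[symmetric] abs_mult using p_pos by simp
      then show ?thesis using p_pos by (simp add: power_one_over field_simps)
    qed
    moreover have "(\<lambda>n. 1 * (1 / apar) ^ n) \<longlonglongrightarrow> 1 * 0"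
      using p_pos by (intro tendsto_mult tendsto_const LIMSEQ_realpow_zero) simp_all
    ultimately have "\<bar>u x\<bar> \<le> 1 * 0" by (intro LIMSEQ_le_const[of _ "1 * 0"]) blast+
    then show "pgf P x = pgf (mix_pmf j) x" by (simp add: u_def)
  qed
qed

end

section \<open>Regular variation of p_k makes the periodic part a pure power\<close>

lemma asymp_equiv_power_limit:
  fixes P :: "nat \<Rightarrow> real"
  assumes "P \<sim>[at_top] (\<lambda>k. c * real k powr (- 1 - r))"
  shows "(\<lambda>k. P k * real k powr (1 + r)) \<longlonglongrightarrow> c"
proof -
  have "(\<lambda>k. P k * real k powr (1 + r)) \<sim>[at_top] (\<lambda>k. c * real k powr (- 1 - r) * real k powr (1 + r))"
    by (intro asymp_equiv_mult assms asymp_equiv_refl)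
  moreover have "(\<lambda>k. c * real k powr (- 1 - r) * real k powr (1 + r)) \<longlonglongrightarrow> c"
  proof (rule tendsto_eventually)
    show "eventually (\<lambda>k. c * real k powr (- 1 - r) * real k powr (1 + r) = c) sequentially"
      using eventually_gt_at_top[of 0]
    proof eventually_elim
      case (elim k)
      then have "real k powr (- 1 - r) * real k powr (1 + r) = 1" by (simp add: powr_add[symmetric])
      then show ?case by (simp only: mult.assoc mult_1_right)
    qed
  qed
  ultimately show ?thesis by (subst tendsto_asymp_equiv_cong)
qed

lemma summable_first_moment:
  fixes P :: "nat \<Rightarrow> real"
  assumes "1 < r" "\<And>k. 0 \<le> P k" "(\<lambda>k. P k * real k powr (1 + r)) \<longlonglongrightarrow> c"
  shows "summable (\<lambda>k. P k * real k)"
proof -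
  obtain B where B: "\<forall>k. norm (P k * real k powr (1 + r)) \<le> B"
    by (rule BseqE[OF convergent_imp_Bseq[OF convergentI[OF assms(3)]]]) (rule that)
  have "summable (\<lambda>k. B * real k powr (- r))"
    using assms(1) by (intro summable_mult) (simp add: summable_real_powr_iff)
  then show ?thesis
  proof (rule summable_comparison_test'[where N = 1])
    fix k :: nat assume "1 \<le> k"
    then have "real k powr (1 + r) * real k powr (- r) = real k" by (simp add: powr_add[symmetric])
    then have "P k * real k = P k * real k powr (1 + r) * real k powr (- r)" by (simp only: mult.assoc)
    also have "\<dots> \<le> B * real k powr (- r)"
      using spec[OF B, of k] by (intro mult_right_mono) simp_all
    finally show "norm (P k * real k) \<le> B * real k powr (- r)" using assms(2)[of k] by simp
  qed
qed

text \<open>Expands e^(-sk) to first order under the sum. The remainder series starts at index 1,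
  since its term at k = 0 vanishes.\<close>

lemma pgf_expansion:
  assumes sum: "summable (\<lambda>k. pmf Q k * real k)" and s: "0 \<le> s"
  shows "pgf Q (exp (- s)) = 1 - s * (\<Sum>k. pmf Q k * real k)
    + (\<Sum>k. pmf Q (Suc k) * (exp (- (s * real (Suc k))) - 1 + s * real (Suc k)))"
proof -
  define f where "f k = pmf Q k * (exp (- (s * real k)) - 1 + s * real k)" for k
  have "ennreal (pgf Q 1) = 1" by (subst ennreal_pgf) simp_all
  then have one: "pgf Q 1 = 1" by (simp only: ennreal_eq_1)
  have 1: "(\<lambda>k. pmf Q k * 1 ^ k) sums 1"
    using summable_sums[OF pmf_power_summable[of 1 Q]] unfolding pgf_def[symmetric] one by simp
  have 2: "(\<lambda>k. pmf Q k * exp (- s) ^ k) sums pgf Q (exp (- s))"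
    unfolding pgf_def using s by (intro summable_sums pmf_power_summable) simp
  have "(\<lambda>k. pmf Q k * exp (- s) ^ k - pmf Q k * 1 ^ k + s * (pmf Q k * real k)) sums
      (pgf Q (exp (- s)) - 1 + s * (\<Sum>k. pmf Q k * real k))"
    by (intro sums_add sums_diff 1 2 sums_mult summable_sums sum)
  moreover have "f k = pmf Q k * exp (- s) ^ k - pmf Q k * 1 ^ k + s * (pmf Q k * real k)" for k
  proof -
    have "exp (- (s * real k)) = exp (- s) ^ k" by (simp add: exp_of_nat_mult[symmetric] mult.commute)
    then show ?thesis unfolding f_def by (simp add: algebra_simps)
  qed
  ultimately have f: "f sums (pgf Q (exp (- s)) - 1 + s * (\<Sum>k. pmf Q k * real k))" by presburger
  have "(\<Sum>k. f (Suc k)) = suminf f - f 0" by (rule suminf_split_head[OF sums_summable[OF f]])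
  then have "(\<Sum>k. f (Suc k)) = pgf Q (exp (- s)) - 1 + s * (\<Sum>k. pmf Q k * real k)"
    unfolding sums_unique[OF f, symmetric] by (simp add: f_def)
  then show ?thesis unfolding f_def by simp
qed

context splitting
begin

text \<open>Allows the passage between the parameter t, in which the periodic part lives, and s =
  -ln(rphi t), in which the generating function is evaluated at e^(-s).\<close>

lemma log_rphi:
  assumes t: "0 < t" "t \<le> 1 / 4"
  shows "\<bar>- ln (rphi t) - t\<bar> \<le> 9 * t\<^sup>2"
proof -
  define y where "y = rphi t - 1"
  have t2: "t\<^sup>2 \<le> t * 1" using t unfolding power2_eq_square by (intro mult_left_mono) simp_all
  have "1 / lam * t\<^sup>2 \<le> 1 * t\<^sup>2" using p_pos by (intro mult_right_mono) simp_all
  then have 1: "\<bar>y + t\<bar> \<le> t\<^sup>2" using L.phi_approx[of t] t unfolding y_def by simp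
  then have 2: "\<bar>y\<bar> \<le> 2 * t" using t t2 by linarith
  then have "\<bar>y\<bar> \<le> 1 / 2" using t by linarith
  then have "\<bar>ln (1 + y) - y\<bar> \<le> 2 * y\<^sup>2" by (rule abs_ln_one_plus_x_minus_x_bound)
  also have "y\<^sup>2 \<le> (2 * t)\<^sup>2" using power_mono[OF 2, of 2] by simp
  finally have "\<bar>ln (1 + y) - y\<bar> \<le> 8 * t\<^sup>2" by (simp add: power_mult_distrib)
  then have "\<bar>- ln (1 + y) - t\<bar> \<le> 9 * t\<^sup>2" using 1 by linarith
  then show ?thesis by (simp add: y_def)
qed

text \<open>The real form of \<open>gsum_phi\<close> scaled by 2p/a: constant term 1, a linear term,
  the periodic part, and a correction that is O(t^2) by
  \<open>remainder_down_quadratic\<close>.\<close>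

lemma pk_pgf_rphi:
  assumes "0 < t"
  shows "pgf (pk_pmf p j) (rphi t) = mix_par * L.periodic_part j t + 1
    - mix_par * (\<Sum>n. real j * (lam / apar) ^ n) * t
    - mix_par * (\<Sum>n. apar ^ Suc n * L.remainder j (t / lam ^ Suc n))"
proof -
  have t: "0 \<le> t" using assms by simp
  have "gser j (rphi t) = (\<Sum>n. rphi (lam ^ n * t) ^ j / apar ^ n)"
    unfolding gser_def L.phi_lam_pow[OF t] ..
  also have "\<dots> = (\<Sum>n. L.remainder j (lam ^ n * t) / apar ^ n) + (\<Sum>n. (1 / apar) ^ n)
      - (\<Sum>n. real j * (lam / apar) ^ n) * t"
    by (rule sums_unique[symmetric, OF L.real_gsum_phi[OF assms]])
  also have "(\<Sum>n. (1 / apar) ^ n) = 1 / mix_par"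
    using p_pos by (subst suminf_geometric) (simp_all add: field_simps)
  finally have g: "gser j (rphi t) = L.periodic_part j t
      - (\<Sum>n. apar ^ Suc n * L.remainder j (t / lam ^ Suc n))
      + 1 / mix_par - (\<Sum>n. real j * (lam / apar) ^ n) * t"
    unfolding L.periodic_part_def by simp
  have "mix_par * (a - b + 1 / mix_par - c) = mix_par * a + 1 - mix_par * c - mix_par * b" for a b c :: real
  proof -
    have "mix_par \<noteq> 0" using p_pos by simp
    then show ?thesis by (simp only: distrib_left right_diff_distrib) simp
  qed
  then show ?thesis
    unfolding pk_pmf_eq mix_pgf[OF L.phi_nonneg[OF t] L.phi_le_1[OF t]] g by (simp only: mult.assoc)
qed

lemma remainder_down_quadratic:
  obtains B where
    "\<And>t. 0 \<le> t \<Longrightarrow> \<bar>\<Sum>n. apar ^ Suc n * L.remainder j (t / lam ^ Suc n)\<bar> \<le> B * t\<^sup>2"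
proof -
  obtain B where B: "\<And>t n. 0 \<le> t \<Longrightarrow>
    \<bar>apar ^ n * L.remainder j (t / lam ^ n)\<bar> \<le> B * t\<^sup>2 * (apar / lam\<^sup>2) ^ n"
    by (rule L.remainder_down_bound[of j]) (rule that)
  define S where "S = (\<Sum>n. (apar / lam\<^sup>2) ^ Suc n)"
  have sS: "summable (\<lambda>n. (apar / lam\<^sup>2) ^ Suc n)" using summable_apar_lam[of 1] by simp
  show ?thesis
  proof (rule that)
    fix t :: real assume t: "0 \<le> t"
    have "norm (\<Sum>n. apar ^ Suc n * L.remainder j (t / lam ^ Suc n)) \<le> (\<Sum>n. B * t\<^sup>2 * (apar / lam\<^sup>2) ^ Suc n)"
      by (rule norm_suminf_le[OF _ summable_apar_lam]) (unfold real_norm_def, rule B[OF t])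
    also have "\<dots> = B * t\<^sup>2 * S" unfolding S_def by (rule suminf_mult[OF sS])
    finally show "\<bar>\<Sum>n. apar ^ Suc n * L.remainder j (t / lam ^ Suc n)\<bar> \<le> B * S * t\<^sup>2"
      by (simp only: real_norm_def mult_ac)
  qed
qed

lemma periodic_part_scale: "0 < t \<Longrightarrow> L.periodic_part j (t / lam ^ n) / (t / lam ^ n) powr rho p = L.periodic_part j t / t powr rho p"
proof (induction n)
  case (Suc n)
  define v where "v = t / lam ^ Suc n"
  have v: "0 < v" and lv: "lam * v = t / lam ^ n" using Suc.prems p_pos by (simp_all add: v_def)
  have "L.periodic_part j (lam * v) / (lam * v) powr rho p = L.periodic_part j v / v powr rho p"
    unfolding L.periodic_part_lam[OF less_imp_le[OF v]] powr_mult rho_bounds(3) using p_pos by simp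
  then show ?case using Suc.IH[OF Suc.prems] unfolding lv unfolding v_def by simp
qed simp

text \<open>Evaluate the generating function at e^(-s) = rphi(t) in two ways. The Abelian limit
  gives J s^rho to leading order after removal of the linear part, \<open>pk_pgf_rphi\<close> gives
  the periodic part plus a linear term plus O(t^2). Since the periodic part is self-similar along
  t0/lam^n, its normalised value at every t0 is the same constant.\<close>

theorem pk_not_regular:
  assumes j: "1 \<le> j"
  shows "\<not> pk p j \<sim>[at_top] (\<lambda>k. c * real k powr (- 1 - rho p))"
proof
  assume asy: "pk p j \<sim>[at_top] (\<lambda>k. c * real k powr (- 1 - rho p))"
  define r where "r = rho p"
  have r: "1 < r" "r < 2" using rho_bounds by (simp_all add: r_def)
  have lim: "(\<lambda>k. pk p j k * real k powr (1 + r)) \<longlonglongrightarrow> c"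
    using asymp_equiv_power_limit[OF asy] by (simp only: r_def)
  have mom: "summable (\<lambda>k. pk p j k * real k)" by (rule summable_first_moment[OF r(1) pmf_nonneg lim])
  define R where "R s = (\<Sum>k. pk p j (Suc k) * (exp (- (s * real (Suc k))) - 1 + s * real (Suc k)))" for s
  define mu where "mu = (\<Sum>k. pk p j k * real k)"
  define dn where "dn t = (\<Sum>n. apar ^ Suc n * L.remainder j (t / lam ^ Suc n))" for t
  define J where "J = (LBINT u. indicator {0<..} u * (c * ((exp (- u) - 1 + u) * u powr (- 1 - r))))"
  have J: "(\<lambda>n. R (s n) / s n powr r) \<longlonglongrightarrow> J"
    if "\<And>n. 0 < s n" "s \<longlonglongrightarrow> 0" for s :: "nat \<Rightarrow> real"
    unfolding R_def J_def by (rule abelian_limit[OF r pmf_nonneg lim that])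
  obtain B where B: "\<And>t. 0 \<le> t \<Longrightarrow>
      \<bar>\<Sum>n. apar ^ Suc n * L.remainder j (t / lam ^ Suc n)\<bar> \<le> B * t\<^sup>2"
    by (rule remainder_down_quadratic[of j]) (rule that)
  \<comment> \<open>The mismatch of the two linear coefficients, namely the mean of (p_k) and the
    coefficient in \<open>pk_pgf_rphi\<close>. It is shown below to vanish.\<close>
  define A where "A = mu - mix_par * (\<Sum>n. real j * (lam / apar) ^ n)"
  define sg where "sg t = - ln (rphi t)" for t
  define E where "E t = mu * (sg t - t) - mix_par * dn t" for t
  have sg: "0 < sg t" "exp (- sg t) = rphi t" if "0 < t" for t
    using L.phi_pos[of t] L.phi_less_1[of t] that by (simp_all add: sg_def)
  have main: "R (sg t) = mix_par * L.periodic_part j t + A * t + E t" if t: "0 < t" for t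
  proof -
    have "1 - sg t * mu + R (sg t) = pgf (pk_pmf p j) (rphi t)"
      unfolding mu_def R_def sg(2)[OF t, symmetric]
      by (rule pgf_expansion[OF mom less_imp_le[OF sg(1)[OF t]], symmetric])
    then show ?thesis unfolding pk_pgf_rphi[OF t] A_def E_def dn_def by (simp add: algebra_simps)
  qed
  define C where "C = \<bar>mu\<bar> * 9 + mix_par * B"
  have E: "\<bar>E t\<bar> \<le> C * t\<^sup>2" if t: "0 < t" "t \<le> 1 / 4" for t
  proof -
    have "\<bar>E t\<bar> \<le> \<bar>mu * (sg t - t)\<bar> + \<bar>mix_par * dn t\<bar>" unfolding E_def by (rule abs_triangle_ineq4)
    also have "\<dots> = \<bar>mu\<bar> * \<bar>sg t - t\<bar> + mix_par * \<bar>dn t\<bar>" using p_pos by (simp add: abs_mult)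
    also have "\<dots> \<le> \<bar>mu\<bar> * (9 * t\<^sup>2) + mix_par * (B * t\<^sup>2)"
      using log_rphi[OF t] B[of t] t p_pos unfolding sg_def dn_def
      by (intro add_mono mult_left_mono) simp_all
    also have "\<dots> = C * t\<^sup>2" unfolding C_def by (simp add: algebra_simps)
    finally show ?thesis .
  qed
  have pure: "L.periodic_part j t0 = J / mix_par * t0 powr rho p" if t0: "0 < t0" for t0
  proof -
    \<comment> \<open>Along this sequence the ratio of the periodic part to t^rho keeps its value h
      at t0, so limits as n grows give exact information at t0.\<close>
    define t where "t n = t0 / lam ^ n" for n
    have t: "0 < t n" for n using t0 p_pos by (simp add: t_def)
    have "(\<lambda>n. t0 * (1 / lam) ^ n) \<longlonglongrightarrow> t0 * 0"
      using p_pos by (intro tendsto_mult tendsto_const LIMSEQ_realpow_zero) simp_all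
    then have tl: "t \<longlonglongrightarrow> 0" unfolding t_def[abs_def] by (simp add: power_inverse divide_inverse)
    have small: "eventually (\<lambda>n. t n \<le> 1 / 4) sequentially"
      using order_tendstoD(2)[OF tl, of "1 / 4"] by (auto elim: eventually_mono)
    have tpow: "(\<lambda>n. t n powr a) \<longlonglongrightarrow> 0" if "0 < a" for a
      using tendsto_powr2[OF tl tendsto_const[of a]] t that by (simp add: less_imp_le)
    have ratio: "(\<lambda>n. sg (t n) / t n) \<longlonglongrightarrow> 1"
    proof (rule LIM_zero_cancel, rule Lim_null_comparison)
      show "(\<lambda>n. 9 * t n) \<longlonglongrightarrow> 0" using tendsto_mult[OF tendsto_const[of 9] tl] by simp
      show "eventually (\<lambda>n. norm (sg (t n) / t n - 1) \<le> 9 * t n) sequentially"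
        using small
      proof eventually_elim
        case (elim n)
        have "sg (t n) / t n - 1 = (sg (t n) - t n) / t n" using t[of n] by (simp add: field_simps)
        also have "\<bar>\<dots>\<bar> \<le> 9 * (t n)\<^sup>2 / t n"
          using log_rphi[OF t elim] t[of n] unfolding sg_def[symmetric] abs_divide
          by (simp add: divide_right_mono)
        also have "\<dots> = 9 * t n" using t[of n] by (simp add: power2_eq_square)
        finally show ?case by simp
      qed
    qed
    have "(\<lambda>n. sg (t n) / t n * t n) \<longlonglongrightarrow> 1 * 0" by (intro tendsto_mult ratio tl)
    then have "(\<lambda>n. sg (t n)) \<longlonglongrightarrow> 0" using t by (simp add: less_imp_neq[symmetric])
    from J[OF sg(1)[OF t] this] have Jt: "(\<lambda>n. R (sg (t n)) / sg (t n) powr r) \<longlonglongrightarrow> J" .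
    have "(\<lambda>n. R (sg (t n)) / sg (t n) powr r * (sg (t n) / t n) powr r) \<longlonglongrightarrow> J * 1 powr r"
      by (intro tendsto_mult Jt tendsto_powr ratio tendsto_const) simp
    moreover have "R (sg (t n)) / sg (t n) powr r * (sg (t n) / t n) powr r = R (sg (t n)) / t n powr r" for n
    proof -
      have "(sg (t n) / t n) powr r = sg (t n) powr r / t n powr r"
        by (rule powr_divide)
      then show ?thesis using sg(1)[OF t, of n] by simp
    qed
    ultimately have Rt: "(\<lambda>n. R (sg (t n)) / t n powr r) \<longlonglongrightarrow> J" by simp
    have Et: "(\<lambda>n. E (t n) / t n powr r) \<longlonglongrightarrow> 0"
    proof (rule Lim_null_comparison)
      show "(\<lambda>n. C * t n powr (2 - r)) \<longlonglongrightarrow> 0"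
        using tendsto_mult[OF tendsto_const[of C] tpow[of "2 - r"]] r by simp
      show "eventually (\<lambda>n. norm (E (t n) / t n powr r) \<le> C * t n powr (2 - r)) sequentially"
        using small
      proof eventually_elim
        case (elim n)
        have "\<bar>E (t n)\<bar> / t n powr r \<le> C * (t n)\<^sup>2 / t n powr r"
          by (rule divide_right_mono[OF E[OF t elim]]) simp
        also have "(t n)\<^sup>2 = t n powr 2" using t[of n] by (simp add: powr_numeral)
        also have "C * t n powr 2 / t n powr r = C * t n powr (2 - r)" by (simp add: powr_diff)
        finally show ?case by simp
      qed
    qed
    define h where "h = L.periodic_part j t0 / t0 powr r"
    have Af: "R (sg (t n)) / t n powr r - mix_par * h - E (t n) / t n powr r = A * t n powr (1 - r)" for n
    proof -
      have "L.periodic_part j (t n) / t n powr r = h"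
        unfolding h_def t_def r_def by (rule periodic_part_scale[OF t0])
      then have "R (sg (t n)) / t n powr r = mix_par * h + A * (t n / t n powr r) + E (t n) / t n powr r"
        unfolding main[OF t] add_divide_distrib times_divide_eq_right[symmetric] by (simp only:)
      moreover have "t n / t n powr r = t n powr (1 - r)" using t[of n] by (simp add: powr_diff)
      ultimately show ?thesis by simp
    qed
    have "(\<lambda>n. R (sg (t n)) / t n powr r - mix_par * h - E (t n) / t n powr r) \<longlonglongrightarrow> J - mix_par * h - 0"
      by (intro tendsto_diff Rt Et tendsto_const)
    then have At: "(\<lambda>n. A * t n powr (1 - r)) \<longlonglongrightarrow> J - mix_par * h" unfolding Af by simp
    \<comment> \<open>A t^(1-r) converges although 1 - r < 0; multiplying by t^(r-1) -> 0 gives A =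
      0, and then the limit itself gives J = (2p/a) h.\<close>
    have "(\<lambda>n. A * t n powr (1 - r) * t n powr (r - 1)) \<longlonglongrightarrow> (J - mix_par * h) * 0"
      using r by (intro tendsto_mult At tpow) simp
    moreover have "A * t n powr (1 - r) * t n powr (r - 1) = A" for n
      using t[of n] by (simp add: powr_add[symmetric] mult.assoc)
    ultimately have "(\<lambda>n::nat. A) \<longlonglongrightarrow> 0" by simp
    then have "A = 0" by (simp add: LIMSEQ_const_iff)
    then have "J - mix_par * h = 0" using At by (simp add: LIMSEQ_const_iff)
    then have "h = J / mix_par" using p_pos by (simp add: field_simps)
    then have "L.periodic_part j t0 / t0 powr r = J / mix_par" unfolding h_def .
    then show ?thesis using t0 unfolding r_def by (simp add: divide_eq_eq)
  qed
  from periodic_part_not_power[OF j] pure show False by blast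
qed

end

theorem corollary2p3:
  shows "(\<forall>j\<in>{1, 2 :: nat}. \<exists>Z. Z \<subseteq> {0<..<1 :: real} \<and> Z sparse_in {0<..<1} \<and>
            (\<forall>p\<in>{0<..<1} - Z. \<not> Psi p j constant_on UNIV \<and>
               (\<forall>c. \<not> (pk p j \<sim>[at_top] (\<lambda>k. c * real k powr (- 1 - rho p)))))) \<and>
         (\<forall>j\<ge>1. \<exists>p0\<in>{0<..<1}. \<forall>p\<in>{p0<..<1}. \<not> Psi p j constant_on UNIV \<and>
               (\<forall>c. \<not> (pk p j \<sim>[at_top] (\<lambda>k. c * real k powr (- 1 - rho p)))))"
proof -
  \<comment> \<open>Both conclusions for every p in (0,1) and every j >= 1; the exceptional set is
    therefore taken empty and p0 = 1/2.\<close>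
  have *: "\<not> Psi p j constant_on UNIV \<and>
      (\<forall>c. \<not> (pk p j \<sim>[at_top] (\<lambda>k. c * real k powr (- 1 - rho p))))"
    if "p \<in> {0<..<1}" "1 \<le> j" for p j
  proof -
    interpret splitting p using that by unfold_locales simp_all
    show ?thesis using Psi_not_constant[OF that(2)] pk_not_regular[OF that(2)] by blast
  qed
  show ?thesis
  proof (intro conjI ballI allI impI)
    fix j :: nat assume "j \<in> {1, 2}"
    then have "1 \<le> j" by auto
    then show "\<exists>Z. Z \<subseteq> {0<..<1 :: real} \<and> Z sparse_in {0<..<1} \<and>
            (\<forall>p\<in>{0<..<1} - Z. \<not> Psi p j constant_on UNIV \<and>
               (\<forall>c. \<not> (pk p j \<sim>[at_top] (\<lambda>k. c * real k powr (- 1 - rho p)))))"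
      using * by (intro exI[of _ "{}"]) (simp add: sparse_in_empty)
  next
    fix j :: nat assume j: "1 \<le> j"
    show "\<exists>p0\<in>{0<..<1}. \<forall>p\<in>{p0<..<1}. \<not> Psi p j constant_on UNIV \<and>
               (\<forall>c. \<not> (pk p j \<sim>[at_top] (\<lambda>k. c * real k powr (- 1 - rho p))))"
      using *[OF _ j] by (intro bexI[of _ "1 / 2"]) simp_all
  qed
qed

end
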